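(* Let $\mathcal C$ be a strict monoidal category with coequalizers, let $A$ be an algebra in $\mathcal C$ which is a left coflat object, and let $X$ be a left coflat object of $\mathcal C$. Regard $A\otimes X$ as a left $A$-module in $\mathcal C$ via $m_A\otimes X$. (In composites, the identity morphism of an object is denoted by the object.) (i) $A$-ring structures on $A\otimes X$ in $\mathcal C$ (with the given left $A$-module structure) correspond bijectively to triples of morphisms $\psi: X\otimes A\to A\otimes X$, $\zeta: X\otimes X\to A\otimes X$, $\sigma:\underline 1\to A\otimes X$ in $\mathcal C$ such that $$\psi(X\otimes m_A)=(m_A\otimes X)(A\otimes\psi)(\psi\otimes A),\qquad \psi(X\otimes \eta_A)=\eta_A\otimes X,$$ $$(m_A\otimes X)(A\otimes\psi)(\zeta\otimes A)=(m_A\otimes X)(A\otimes\zeta)(\psi\otimes X)(X\otimes\psi),$$ $$(m_A\otimes X)(A\otimes\zeta)(\psi\otimes X)(X\otimes\zeta)=(m_A\otimes X)(A\otimes\zeta)(\zeta\otimes X),$$ $$(m_A\otimes X)(A\otimes\sigma)=(m_A\otimes X)(A\otimes\psi)(\sigma\otimes A),$$ $$(m_A\otimes X)(A\otimes\zeta)(\psi\otimes X)(X\otimes\sigma)=\eta_A\otimes X=(m_A\otimes X)(A\otimes\zeta)(\sigma\otimes X).$$ (ii) $A$-coring structures on $A\otimes X$ in $\mathcal C$ (with the given left $A$-module structure) correspond bijectively to triples of morphisms $\psi: X\otimes A\to A\otimes X$, $\delta: X\to A\otimes X\otimes X$, $f: X\to A$ in $\mathcal C$ such that $$\psi(X\otimes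 m_A)=(m_A\otimes X)(A\otimes\psi)(\psi\otimes A),\qquad \psi(X\otimes \eta_A)=\eta_A\otimes X,$$ $$(m_A\otimes X\otimes X)(A\otimes\delta)\psi=(m_A\otimes X\otimes X)(A\otimes\psi\otimes X)(A\otimes X\otimes\psi)(\delta\otimes A),$$ $$(m_A\otimes X^{\otimes 3})(A\otimes\psi\otimes X^{\otimes 2})(A\otimes X\otimes\delta)\delta=(m_A\otimes X^{\otimes 3})(A\otimes\delta\otimes X)\delta,$$ $$m_A(A\otimes f)\psi=m_A(f\otimes A),$$ $$(m_A\otimes X)(A\otimes f\otimes X)\delta=\eta_A\otimes X=(m_A\otimes X)(A\otimes\psi)(A\otimes X\otimes f)\delta.$$
   Context: $\mathcal C$ has tensor product $\otimes$ and unit object $\underline 1$. An algebra $A$ in $\mathcal C$ has multiplication $m_A:A\otimes A\to A$ and unit $\eta_A:\underline 1\to A$. An object $X$ is left coflat if $-\otimes X:\mathcal C\to\mathcal C$ preserves coequalizers. For a right $A$-module $M$ and a left $A$-module $Y$ in $\mathcal C$, $q_{M,Y}: M\otimes Y\to M\otimes_A Y$ denotes the coequalizer of the two morphisms $M\otimes A\otimes Y\rightrightarrows M\otimes Y$ given by the actions. A left $A$-module $Y$ is left robust if for every object $M$ and every right $A$-module $Z$ the canonical morphism $(M\otimes Z)\otimes_A Y\to M\otimes(Z\otimes_A Y)$ induced by $M\otimes q_{Z,Y}$ is an isomorphism. If $A$ is left coflat, the category ${}^!_A\mathcal C_A$ of $A$-bimodules in $\mathcal C$ that are left coflat objects and left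 robust as left $A$-modules is monoidal, with tensor product $\otimes_A$ and unit $A$. An $A$-ring (resp. $A$-coring) in $\mathcal C$ is an algebra (resp. coalgebra) in ${}^!_A\mathcal C_A$. An $A$-(co)ring structure on the left $A$-module $A\otimes X$ consists of a right $A$-action making it an $A$-bimodule together with a (co)multiplication and (co)unit making it an $A$-(co)ring. *)

theory Defs
  imports Main
begin

section \<open>Monoidal categories\<close>

record ('o, 'm) moncat =
  Obj :: "'o set"
  Arr :: "'m set"
  Dom :: "'m \<Rightarrow> 'o"
  Cod :: "'m \<Rightarrow> 'o"
  Id :: "'o \<Rightarrow> 'm" (\<open>\<iota>\<index>\<close>)
  Comp :: "'m \<Rightarrow> 'm \<Rightarrow> 'm" (infixr \<open>\<cdot>\<index>\<close> 65)
  TensO :: "'o \<Rightarrow> 'o \<Rightarrow> 'o" (infixr \<open>\<otimes>\<^sub>o\<index>\<close> 70)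
  Tens :: "'m \<Rightarrow> 'm \<Rightarrow> 'm" (infixr \<open>\<otimes>\<index>\<close> 70)
  One :: "'o" (\<open>\<one>\<index>\<close>)
  Assoc :: "'o \<Rightarrow> 'o \<Rightarrow> 'o \<Rightarrow> 'm"
  Lunit :: "'o \<Rightarrow> 'm"
  Runit :: "'o \<Rightarrow> 'm"

definition hom :: "('o, 'm) moncat \<Rightarrow> 'o \<Rightarrow> 'o \<Rightarrow> 'm set" where
  "hom C a b = {f \<in> Arr C. Dom C f = a \<and> Cod C f = b}"

definition is_iso :: "('o, 'm) moncat \<Rightarrow> 'm \<Rightarrow> bool" where
  "is_iso C f \<longleftrightarrow> f \<in> Arr C \<and>
     (\<exists>g \<in> hom C (Cod C f) (Dom C f). g \<cdot> f = \<iota> (Dom C f) \<and> f \<cdot> g = \<iota> (Cod C f))"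
  for C (structure)

locale category =
  fixes C :: "('o, 'm) moncat" (structure)
  assumes Dom_Obj: "f \<in> Arr C \<Longrightarrow> Dom C f \<in> Obj C"
    and Cod_Obj: "f \<in> Arr C \<Longrightarrow> Cod C f \<in> Obj C"
    and Id_hom: "a \<in> Obj C \<Longrightarrow> \<iota> a \<in> hom C a a"
    and Comp_hom: "\<lbrakk>f \<in> hom C a b; g \<in> hom C b c\<rbrakk> \<Longrightarrow> g \<cdot> f \<in> hom C a c"
    and Comp_Id: "f \<in> hom C a b \<Longrightarrow> f \<cdot> \<iota> a = f"
    and Id_Comp: "f \<in> hom C a b \<Longrightarrow> \<iota> b \<cdot> f = f"
    and Comp_assoc: "\<lbrakk>f \<in> hom C a b; g \<in> hom C b c; h \<in> hom C c d\<rbrakk>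
      \<Longrightarrow> (h \<cdot> g) \<cdot> f = h \<cdot> (g \<cdot> f)"

locale monoidal_category = category +
  assumes One_Obj: "\<one> \<in> Obj C"
    and TensO_Obj: "\<lbrakk>a \<in> Obj C; b \<in> Obj C\<rbrakk> \<Longrightarrow> a \<otimes>\<^sub>o b \<in> Obj C"
    and Tens_hom: "\<lbrakk>f \<in> hom C a b; g \<in> hom C c d\<rbrakk> \<Longrightarrow> f \<otimes> g \<in> hom C (a \<otimes>\<^sub>o c) (b \<otimes>\<^sub>o d)"
    and Tens_Id: "\<lbrakk>a \<in> Obj C; b \<in> Obj C\<rbrakk> \<Longrightarrow> \<iota> a \<otimes> \<iota> b = \<iota> (a \<otimes>\<^sub>o b)"
    and Tens_Comp: "\<lbrakk>f \<in> hom C a b; g \<in> hom C b c; f' \<in> hom C a' b'; g' \<in> hom C b' c'\<rbrakk>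
      \<Longrightarrow> (g \<cdot> f) \<otimes> (g' \<cdot> f') = (g \<otimes> g') \<cdot> (f \<otimes> f')"
    and Assoc_hom: "\<lbrakk>a \<in> Obj C; b \<in> Obj C; c \<in> Obj C\<rbrakk>
      \<Longrightarrow> Assoc C a b c \<in> hom C ((a \<otimes>\<^sub>o b) \<otimes>\<^sub>o c) (a \<otimes>\<^sub>o (b \<otimes>\<^sub>o c))"
    and Assoc_iso: "\<lbrakk>a \<in> Obj C; b \<in> Obj C; c \<in> Obj C\<rbrakk> \<Longrightarrow> is_iso C (Assoc C a b c)"
    and Assoc_natural: "\<lbrakk>f \<in> hom C a a'; g \<in> hom C b b'; h \<in> hom C c c'\<rbrakk>
      \<Longrightarrow> Assoc C a' b' c' \<cdot> ((f \<otimes> g) \<otimes> h) = (f \<otimes> (g \<otimes> h)) \<cdot> Assoc C a b c"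
    and Lunit_hom: "a \<in> Obj C \<Longrightarrow> Lunit C a \<in> hom C (\<one> \<otimes>\<^sub>o a) a"
    and Lunit_iso: "a \<in> Obj C \<Longrightarrow> is_iso C (Lunit C a)"
    and Lunit_natural: "f \<in> hom C a b \<Longrightarrow> Lunit C b \<cdot> (\<iota> \<one> \<otimes> f) = f \<cdot> Lunit C a"
    and Runit_hom: "a \<in> Obj C \<Longrightarrow> Runit C a \<in> hom C (a \<otimes>\<^sub>o \<one>) a"
    and Runit_iso: "a \<in> Obj C \<Longrightarrow> is_iso C (Runit C a)"
    and Runit_natural: "f \<in> hom C a b \<Longrightarrow> Runit C b \<cdot> (f \<otimes> \<iota> \<one>) = f \<cdot> Runit C a"
    and pentagon: "\<lbrakk>a \<in> Obj C; b \<in> Obj C; c \<in> Obj C; d \<in> Obj C\<rbrakk>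
      \<Longrightarrow> (\<iota> a \<otimes> Assoc C b c d) \<cdot> Assoc C a (b \<otimes>\<^sub>o c) d \<cdot> (Assoc C a b c \<otimes> \<iota> d)
        = Assoc C a b (c \<otimes>\<^sub>o d) \<cdot> Assoc C (a \<otimes>\<^sub>o b) c d"
    and triangle: "\<lbrakk>a \<in> Obj C; b \<in> Obj C\<rbrakk>
      \<Longrightarrow> (\<iota> a \<otimes> Lunit C b) \<cdot> Assoc C a \<one> b = Runit C a \<otimes> \<iota> b"

locale strict_monoidal_category = monoidal_category +
  assumes TensO_assoc: "\<lbrakk>a \<in> Obj C; b \<in> Obj C; c \<in> Obj C\<rbrakk>
      \<Longrightarrow> (a \<otimes>\<^sub>o b) \<otimes>\<^sub>o c = a \<otimes>\<^sub>o (b \<otimes>\<^sub>o c)"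
    and One_TensO: "a \<in> Obj C \<Longrightarrow> \<one> \<otimes>\<^sub>o a = a"
    and TensO_One: "a \<in> Obj C \<Longrightarrow> a \<otimes>\<^sub>o \<one> = a"
    and Assoc_Id: "\<lbrakk>a \<in> Obj C; b \<in> Obj C; c \<in> Obj C\<rbrakk>
      \<Longrightarrow> Assoc C a b c = \<iota> (a \<otimes>\<^sub>o (b \<otimes>\<^sub>o c))"
    and Lunit_Id: "a \<in> Obj C \<Longrightarrow> Lunit C a = \<iota> a"
    and Runit_Id: "a \<in> Obj C \<Longrightarrow> Runit C a = \<iota> a"

definition algebra :: "('o, 'm) moncat \<Rightarrow> 'o \<Rightarrow> 'm \<Rightarrow> 'm \<Rightarrow> bool" where
  "algebra C A m e \<longleftrightarrow>
     A \<in> Obj C \<and> m \<in> hom C (A \<otimes>\<^sub>o A) A \<and> e \<in> hom C \<one> A \<and>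
     m \<cdot> (m \<otimes> \<iota> A) = m \<cdot> (\<iota> A \<otimes> m) \<cdot> Assoc C A A A \<and>
     m \<cdot> (e \<otimes> \<iota> A) = Lunit C A \<and> m \<cdot> (\<iota> A \<otimes> e) = Runit C A"
  for C (structure)

definition coalgebra :: "('o, 'm) moncat \<Rightarrow> 'o \<Rightarrow> 'm \<Rightarrow> 'm \<Rightarrow> bool" where
  "coalgebra C D d e \<longleftrightarrow>
     D \<in> Obj C \<and> d \<in> hom C D (D \<otimes>\<^sub>o D) \<and> e \<in> hom C D \<one> \<and>
     Assoc C D D D \<cdot> (d \<otimes> \<iota> D) \<cdot> d = (\<iota> D \<otimes> d) \<cdot> d \<and>
     Lunit C D \<cdot> (e \<otimes> \<iota> D) \<cdot> d = \<iota> D \<and> Runit C D \<cdot> (\<iota> D \<otimes> e) \<cdot> d = \<iota> D"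
  for C (structure)


section \<open>Coequalizers\<close>

definition is_coequalizer :: "('o, 'm) moncat \<Rightarrow> 'm \<Rightarrow> 'm \<Rightarrow> 'm \<Rightarrow> bool" where
  "is_coequalizer C f g q \<longleftrightarrow>
     f \<in> Arr C \<and> g \<in> hom C (Dom C f) (Cod C f) \<and> q \<in> Arr C \<and> Dom C q = Cod C f \<and>
     q \<cdot> f = q \<cdot> g \<and>
     (\<forall>h \<in> Arr C. Dom C h = Cod C f \<and> h \<cdot> f = h \<cdot> g \<longrightarrow>
        (\<exists>!k. k \<in> hom C (Cod C q) (Cod C h) \<and> k \<cdot> q = h))"
  for C (structure)

definition has_coequalizers :: "('o, 'm) moncat \<Rightarrow> bool" where
  "has_coequalizers C \<longleftrightarrow>
     (\<forall>f \<in> Arr C. \<forall>g \<in> hom C (Dom C f) (Cod C f). \<exists>q. is_coequalizer C f g q)"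

text \<open>The tensor product over an algebra depends on which coequalizers are taken;
  \<open>coeq\<close> below is an arbitrary choice function, \<open>coeq f g\<close> being the coequalizer of \<open>f\<close> and \<open>g\<close>.\<close>

definition coequalizer_choice :: "('o, 'm) moncat \<Rightarrow> ('m \<Rightarrow> 'm \<Rightarrow> 'm) \<Rightarrow> bool" where
  "coequalizer_choice C coeq \<longleftrightarrow>
     (\<forall>f g. (\<exists>q. is_coequalizer C f g q) \<longrightarrow> is_coequalizer C f g (coeq f g))"

text \<open>The factorization of \<open>h\<close> through \<open>q\<close>; used only where \<open>q\<close> is epi and \<open>h\<close> does factor.\<close>

definition induced :: "('o, 'm) moncat \<Rightarrow> 'm \<Rightarrow> 'm \<Rightarrow> 'm" where
  "induced C q h = (THE k. k \<in> hom C (Cod C q) (Cod C h) \<and> k \<cdot> q = h)"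
  for C (structure)

definition left_coflat :: "('o, 'm) moncat \<Rightarrow> 'o \<Rightarrow> bool" where
  "left_coflat C X \<longleftrightarrow> X \<in> Obj C \<and>
     (\<forall>f g q. is_coequalizer C f g q \<longrightarrow>
        is_coequalizer C (f \<otimes> \<iota> X) (g \<otimes> \<iota> X) (q \<otimes> \<iota> X))"
  for C (structure)


section \<open>Modules over an algebra in a strict monoidal category\<close>

text \<open>From here on \<open>C\<close> is meant to be strict, so that its associators and unitors are omitted.\<close>

definition left_module ::
    "('o, 'm) moncat \<Rightarrow> 'o \<Rightarrow> 'm \<Rightarrow> 'm \<Rightarrow> 'o \<Rightarrow> 'm \<Rightarrow> bool" where
  "left_module C A m e Y l \<longleftrightarrow> Y \<in> Obj C \<and> l \<in> hom C (A \<otimes>\<^sub>o Y) Y \<and>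
     l \<cdot> (m \<otimes> \<iota> Y) = l \<cdot> (\<iota> A \<otimes> l) \<and> l \<cdot> (e \<otimes> \<iota> Y) = \<iota> Y"
  for C (structure)

definition right_module ::
    "('o, 'm) moncat \<Rightarrow> 'o \<Rightarrow> 'm \<Rightarrow> 'm \<Rightarrow> 'o \<Rightarrow> 'm \<Rightarrow> bool" where
  "right_module C A m e M r \<longleftrightarrow> M \<in> Obj C \<and> r \<in> hom C (M \<otimes>\<^sub>o A) M \<and>
     r \<cdot> (\<iota> M \<otimes> m) = r \<cdot> (r \<otimes> \<iota> A) \<and> r \<cdot> (\<iota> M \<otimes> e) = \<iota> M"
  for C (structure)

text \<open>\<open>tensor_q C coeq M r Y l\<close> is the coequalizer \<open>q\<close> from \<open>M \<otimes> Y\<close> to \<open>M \<otimes>\<^sub>A Y\<close>.\<close>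

definition tensor_q ::
    "('o, 'm) moncat \<Rightarrow> ('m \<Rightarrow> 'm \<Rightarrow> 'm) \<Rightarrow> 'o \<Rightarrow> 'm \<Rightarrow> 'o \<Rightarrow> 'm \<Rightarrow> 'm" where
  "tensor_q C coeq M r Y l = coeq (r \<otimes> \<iota> Y) (\<iota> M \<otimes> l)"
  for C (structure)

definition left_robust ::
    "('o, 'm) moncat \<Rightarrow> ('m \<Rightarrow> 'm \<Rightarrow> 'm) \<Rightarrow> 'o \<Rightarrow> 'm \<Rightarrow> 'm \<Rightarrow> 'o \<Rightarrow> 'm \<Rightarrow> bool" where
  "left_robust C coeq A m e Y l \<longleftrightarrow>
     (\<forall>M \<in> Obj C. \<forall>Z r. right_module C A m e Z r \<longrightarrow>
        is_iso C (induced C (tensor_q C coeq (M \<otimes>\<^sub>o Z) (\<iota> M \<otimes> r) Y l)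
                            (\<iota> M \<otimes> tensor_q C coeq Z r Y l)))"
  for C (structure)


section \<open>The monoidal category of left coflat, left robust bimodules\<close>

datatype ('o, 'm) bimodule = Bimodule (under: 'o) (lact: 'm) (ract: 'm)

datatype ('o, 'm) bimod_arr =
  Bimod_Arr (src: "('o, 'm) bimodule") (mor: 'm) (tgt: "('o, 'm) bimodule")

definition is_bimodule ::
    "('o, 'm) moncat \<Rightarrow> 'o \<Rightarrow> 'm \<Rightarrow> 'm \<Rightarrow> ('o, 'm) bimodule \<Rightarrow> bool" where
  "is_bimodule C A m e B \<longleftrightarrow>
     left_module C A m e (under B) (lact B) \<and> right_module C A m e (under B) (ract B) \<and>
     ract B \<cdot> (lact B \<otimes> \<iota> A) = lact B \<cdot> (\<iota> A \<otimes> ract B)"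
  for C (structure)

definition is_bimod_arr ::
    "('o, 'm) moncat \<Rightarrow> 'o \<Rightarrow> ('o, 'm) bimod_arr \<Rightarrow> bool" where
  "is_bimod_arr C A h \<longleftrightarrow>
     mor h \<in> hom C (under (src h)) (under (tgt h)) \<and>
     mor h \<cdot> lact (src h) = lact (tgt h) \<cdot> (\<iota> A \<otimes> mor h) \<and>
     mor h \<cdot> ract (src h) = ract (tgt h) \<cdot> (mor h \<otimes> \<iota> A)"
  for C (structure)

definition bimod_q ::
    "('o, 'm) moncat \<Rightarrow> ('m \<Rightarrow> 'm \<Rightarrow> 'm) \<Rightarrow> ('o, 'm) bimodule \<Rightarrow> ('o, 'm) bimodule \<Rightarrow> 'm" where
  "bimod_q C coeq M N = tensor_q C coeq (under M) (ract M) (under N) (lact N)"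

definition bimod_tensor ::
    "('o, 'm) moncat \<Rightarrow> ('m \<Rightarrow> 'm \<Rightarrow> 'm) \<Rightarrow> 'o \<Rightarrow>
     ('o, 'm) bimodule \<Rightarrow> ('o, 'm) bimodule \<Rightarrow> ('o, 'm) bimodule" where
  "bimod_tensor C coeq A M N =
     (let q = bimod_q C coeq M N in
      Bimodule (Cod C q)
        (induced C (\<iota> A \<otimes> q) (q \<cdot> (lact M \<otimes> \<iota> (under N))))
        (induced C (q \<otimes> \<iota> A) (q \<cdot> (\<iota> (under M) \<otimes> ract N))))"
  for C (structure)

definition bimod_tensor_arr ::
    "('o, 'm) moncat \<Rightarrow> ('m \<Rightarrow> 'm \<Rightarrow> 'm) \<Rightarrow> 'o \<Rightarrow>
     ('o, 'm) bimod_arr \<Rightarrow> ('o, 'm) bimod_arr \<Rightarrow> ('o, 'm) bimod_arr" where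
  "bimod_tensor_arr C coeq A f g =
     Bimod_Arr (bimod_tensor C coeq A (src f) (src g))
       (induced C (bimod_q C coeq (src f) (src g))
                  (bimod_q C coeq (tgt f) (tgt g) \<cdot> (mor f \<otimes> mor g)))
       (bimod_tensor C coeq A (tgt f) (tgt g))"
  for C (structure)

text \<open>The associator is the factorization of
  \<open>M \<otimes> N \<otimes> P \<longrightarrow> M \<otimes> (N \<otimes>\<^sub>A P) \<longrightarrow> M \<otimes>\<^sub>A (N \<otimes>\<^sub>A P)\<close> through
  \<open>M \<otimes> N \<otimes> P \<longrightarrow> (M \<otimes>\<^sub>A N) \<otimes> P \<longrightarrow> (M \<otimes>\<^sub>A N) \<otimes>\<^sub>A P\<close>.\<close>

definition bimod_assoc ::
    "('o, 'm) moncat \<Rightarrow> ('m \<Rightarrow> 'm \<Rightarrow> 'm) \<Rightarrow> 'o \<Rightarrow>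
     ('o, 'm) bimodule \<Rightarrow> ('o, 'm) bimodule \<Rightarrow> ('o, 'm) bimodule \<Rightarrow> ('o, 'm) bimod_arr" where
  "bimod_assoc C coeq A M N P =
     (let MN = bimod_tensor C coeq A M N; NP = bimod_tensor C coeq A N P in
      Bimod_Arr (bimod_tensor C coeq A MN P)
        (induced C (bimod_q C coeq MN P \<cdot> (bimod_q C coeq M N \<otimes> \<iota> (under P)))
                   (bimod_q C coeq M NP \<cdot> (\<iota> (under M) \<otimes> bimod_q C coeq N P)))
        (bimod_tensor C coeq A M NP))"
  for C (structure)

definition bimod_cat ::
    "('o, 'm) moncat \<Rightarrow> ('m \<Rightarrow> 'm \<Rightarrow> 'm) \<Rightarrow> 'o \<Rightarrow> 'm \<Rightarrow> 'm \<Rightarrow>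
     (('o, 'm) bimodule, ('o, 'm) bimod_arr) moncat" where
  "bimod_cat C coeq A m e =
     (let Ob = {B. is_bimodule C A m e B \<and> left_coflat C (under B) \<and>
                   left_robust C coeq A m e (under B) (lact B)};
          U = Bimodule A m m in
      \<lparr>Obj = Ob,
       Arr = {h. src h \<in> Ob \<and> tgt h \<in> Ob \<and> is_bimod_arr C A h},
       Dom = src,
       Cod = tgt,
       Id = (\<lambda>M. Bimod_Arr M (\<iota> (under M)) M),
       Comp = (\<lambda>g f. Bimod_Arr (src f) (mor g \<cdot> mor f) (tgt g)),
       TensO = bimod_tensor C coeq A,
       Tens = bimod_tensor_arr C coeq A,
       One = U,
       Assoc = bimod_assoc C coeq A,
       Lunit = (\<lambda>M. Bimod_Arr (bimod_tensor C coeq A U M)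
                      (induced C (bimod_q C coeq U M) (lact M)) M),
       Runit = (\<lambda>M. Bimod_Arr (bimod_tensor C coeq A M U)
                      (induced C (bimod_q C coeq M U) (ract M)) M)\<rparr>)"
  for C (structure)


section \<open>Ring and coring structures on the free left module \<open>A \<otimes> X\<close>\<close>

definition free_bimodule ::
    "('o, 'm) moncat \<Rightarrow> 'o \<Rightarrow> 'm \<Rightarrow> 'o \<Rightarrow> 'm \<Rightarrow> ('o, 'm) bimodule" where
  "free_bimodule C A m X r = Bimodule (A \<otimes>\<^sub>o X) (m \<otimes> \<iota> X) r"
  for C (structure)

definition ring_structures ::
    "('o, 'm) moncat \<Rightarrow> ('m \<Rightarrow> 'm \<Rightarrow> 'm) \<Rightarrow> 'o \<Rightarrow> 'm \<Rightarrow> 'm \<Rightarrow> 'o \<Rightarrow>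
     ('m \<times> ('o, 'm) bimod_arr \<times> ('o, 'm) bimod_arr) set" where
  "ring_structures C coeq A m e X =
     {(r, \<mu>, u). algebra (bimod_cat C coeq A m e) (free_bimodule C A m X r) \<mu> u}"

definition coring_structures ::
    "('o, 'm) moncat \<Rightarrow> ('m \<Rightarrow> 'm \<Rightarrow> 'm) \<Rightarrow> 'o \<Rightarrow> 'm \<Rightarrow> 'm \<Rightarrow> 'o \<Rightarrow>
     ('m \<times> ('o, 'm) bimod_arr \<times> ('o, 'm) bimod_arr) set" where
  "coring_structures C coeq A m e X =
     {(r, \<Delta>, \<epsilon>). coalgebra (bimod_cat C coeq A m e) (free_bimodule C A m X r) \<Delta> \<epsilon>}"

text \<open>The correspondences restrict the structure maps along the unit \<open>e\<close> of \<open>A\<close>, using the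
  canonical isomorphism from \<open>(A \<otimes> X) \<otimes>\<^sub>A (A \<otimes> X)\<close> to \<open>A \<otimes> X \<otimes> X\<close> induced by \<open>r \<otimes> X\<close>.
  In the ring case its inverse composed with \<open>e \<otimes> X \<otimes> X\<close> is \<open>q \<cdot> (e \<otimes> X \<otimes> e \<otimes> X)\<close>.\<close>

definition ring_data ::
    "('o, 'm) moncat \<Rightarrow> ('m \<Rightarrow> 'm \<Rightarrow> 'm) \<Rightarrow> 'o \<Rightarrow> 'm \<Rightarrow> 'm \<Rightarrow> 'o \<Rightarrow>
     'm \<times> ('o, 'm) bimod_arr \<times> ('o, 'm) bimod_arr \<Rightarrow> 'm \<times> 'm \<times> 'm" where
  "ring_data C coeq A m e X = (\<lambda>(r, \<mu>, u).
     let B = free_bimodule C A m X r in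
     (r \<cdot> (e \<otimes> \<iota> X \<otimes> \<iota> A),
      mor \<mu> \<cdot> bimod_q C coeq B B \<cdot> (e \<otimes> \<iota> X \<otimes> e \<otimes> \<iota> X),
      mor u \<cdot> e))"
  for C (structure)

definition coring_data ::
    "('o, 'm) moncat \<Rightarrow> ('m \<Rightarrow> 'm \<Rightarrow> 'm) \<Rightarrow> 'o \<Rightarrow> 'm \<Rightarrow> 'm \<Rightarrow> 'o \<Rightarrow>
     'm \<times> ('o, 'm) bimod_arr \<times> ('o, 'm) bimod_arr \<Rightarrow> 'm \<times> 'm \<times> 'm" where
  "coring_data C coeq A m e X = (\<lambda>(r, \<Delta>, \<epsilon>).
     let B = free_bimodule C A m X r in
     (r \<cdot> (e \<otimes> \<iota> X \<otimes> \<iota> A),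
      induced C (bimod_q C coeq B B) (r \<otimes> \<iota> X) \<cdot> mor \<Delta> \<cdot> (e \<otimes> \<iota> X),
      mor \<epsilon> \<cdot> (e \<otimes> \<iota> X)))"
  for C (structure)

end

theory Submission
  imports Defs
begin

text \<open>
  Everything rests on two facts about a left \<open>A\<close>-module that is free on an object \<open>W\<close>, that is,
  isomorphic to \<open>A \<otimes> W\<close>.

  First, a left \<open>A\<close>-linear map \<open>A \<otimes> W \<rightarrow> A \<otimes> V\<close> is determined by its restriction \<open>g : W \<rightarrow> A \<otimes> V\<close>
  along \<open>e \<otimes> W\<close>, and every \<open>g\<close> occurs: it extends to \<open>(m \<otimes> V) (A \<otimes> g)\<close>, called \<open>lext V g\<close> below.
  This is Kleisli composition for the monad \<open>A \<otimes> -\<close> (\<open>lext_unit\<close>, \<open>lext_comp\<close>), and it makes an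
  equation between linear maps equivalent to the equation between their restrictions
  (\<open>lext_inject\<close>).

  Second, for a right module \<open>M\<close> with action \<open>r\<close>, the coequalizer defining \<open>M \<otimes>\<^sub>A (A \<otimes> W)\<close> is split,
  with quotient map \<open>r \<otimes> W\<close> onto \<open>M \<otimes> W\<close> (\<open>tensor_coequalizer\<close>). Whatever coequalizers are chosen,
  there is thus an isomorphism \<open>M \<otimes>\<^sub>A Y \<rightarrow> M \<otimes> W\<close> for every \<open>Y\<close> free on \<open>W\<close>; it is called \<open>coords\<close>.
  Split coequalizers are preserved by all functors, so free modules are left robust
  (\<open>free_on_left_robust\<close>); and a module free on a left coflat object is left coflat because \<open>A\<close> is
  (\<open>free_on_left_coflat\<close>). So all bimodules that matter lie in the monoidal category of the statement.

  Let \<open>B\<close> be \<open>A \<otimes> X\<close> with a right action \<open>r\<close>. As \<open>r\<close> is left linear, it is \<open>lext X \<psi>\<close> for a unique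
  \<open>\<psi> : X \<otimes> A \<rightarrow> A \<otimes> X\<close>, and the right module axioms become the two equations on \<open>\<psi>\<close> alone
  (\<open>free_bimodule_iff\<close>). In coordinates \<open>B \<otimes>\<^sub>A B\<close> is \<open>A \<otimes> X \<otimes> X\<close>, both triple products are
  \<open>A \<otimes> X \<otimes> X \<otimes> X\<close>, and the structure of the bimodule category turns into the following:
  the associator and the unitors become identities (\<open>bimod_assoc_coords\<close>, \<open>Lunit_coords\<close>,
  \<open>Runit_coords\<close>), \<open>h \<otimes>\<^sub>A B\<close> becomes \<open>h \<otimes> X\<close> (\<open>tensor_id_coords\<close>), and \<open>B \<otimes>\<^sub>A h\<close> becomes the
  extension of \<open>(\<psi> \<otimes> V) (X \<otimes> g)\<close>, where \<open>g\<close> is the restriction of \<open>h\<close> (\<open>id_tensor_coords\<close>). A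
  multiplication, a unit, a comultiplication and a counit are then extensions of unique morphisms
  \<open>\<zeta>\<close>, \<open>\<sigma>\<close>, \<open>\<delta>\<close> and \<open>f\<close>; right linearity (\<open>bimod_hom_coords\<close>) and each (co)algebra axiom is an
  equation between extensions, and comparing restrictions yields exactly the listed equations
  (\<open>algebra_iff_ring_triple\<close>, \<open>coalgebra_iff_coring_triple\<close>).
\<close>

section \<open>Calculus in a strict monoidal category\<close>

text \<open>The simplification rules of this section bring a morphism into the form of a right-nested
  composite of generators tensored with identities: composition and tensor product are associated
  to the right, adjacent identities are merged, and whiskering is distributed over composition.
  The side conditions on domains and codomains are decided by the typing rules. The interchange law
  has no preferred direction; it is applied by hand to the two morphisms that have to change
  places.\<close>

context strict_monoidal_category
begin

lemma arr_homI: "f \<in> Arr C \<Longrightarrow> f \<in> hom C (Dom C f) (Cod C f)"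
  by (simp add: hom_def)

lemmas [simp] = Dom_Obj Cod_Obj One_Obj TensO_Obj

lemma Id_typing [simp]:
  assumes "a \<in> Obj C"
  shows "\<iota> a \<in> Arr C" "Dom C (\<iota> a) = a" "Cod C (\<iota> a) = a"
  using Id_hom[OF assms] by (auto simp: hom_def)

lemma Comp_typing [simp]:
  assumes "f \<in> Arr C" "g \<in> Arr C" "Dom C g = Cod C f"
  shows "g \<cdot> f \<in> Arr C" "Dom C (g \<cdot> f) = Dom C f" "Cod C (g \<cdot> f) = Cod C g"
  using Comp_hom[of f "Dom C f" "Cod C f" g "Cod C g"] assms by (auto simp: hom_def)

lemma Tens_typing [simp]:
  assumes "f \<in> Arr C" "g \<in> Arr C"
  shows "f \<otimes> g \<in> Arr C" "Dom C (f \<otimes> g) = Dom C f \<otimes>\<^sub>o Dom C g"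
    "Cod C (f \<otimes> g) = Cod C f \<otimes>\<^sub>o Cod C g"
  using Tens_hom[OF assms[THEN arr_homI]] by (auto simp: hom_def)

lemma comp_assoc [simp]:
  assumes "f \<in> Arr C" "g \<in> Arr C" "h \<in> Arr C" "Dom C g = Cod C f" "Dom C h = Cod C g"
  shows "(h \<cdot> g) \<cdot> f = h \<cdot> g \<cdot> f"
  using Comp_assoc[of f "Dom C f" "Cod C f" g "Cod C g" h "Cod C h"] assms
  by (auto simp: hom_def)

lemma comp_ident [simp]: "f \<in> Arr C \<Longrightarrow> Dom C f = a \<Longrightarrow> f \<cdot> \<iota> a = f"
  using Comp_Id[of f "Dom C f" "Cod C f"] by (auto simp: hom_def)

lemma ident_comp [simp]: "f \<in> Arr C \<Longrightarrow> Cod C f = a \<Longrightarrow> \<iota> a \<cdot> f = f"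
  using Id_Comp[of f "Dom C f" "Cod C f"] by (auto simp: hom_def)

lemmas [simp] = TensO_assoc One_TensO TensO_One Tens_Id

lemma tens_assoc [simp]:
  assumes "f \<in> Arr C" "g \<in> Arr C" "h \<in> Arr C"
  shows "(f \<otimes> g) \<otimes> h = f \<otimes> g \<otimes> h"
  using Assoc_natural[OF assms[THEN arr_homI]] assms by (simp add: Assoc_Id)

lemma one_tens [simp]: "f \<in> Arr C \<Longrightarrow> \<iota> \<one> \<otimes> f = f"
  using Lunit_natural[OF arr_homI[of f]] by (simp add: Lunit_Id)

lemma tens_one [simp]: "f \<in> Arr C \<Longrightarrow> f \<otimes> \<iota> \<one> = f"
  using Runit_natural[OF arr_homI[of f]] by (simp add: Runit_Id)

lemma tens_ident_assoc [simp]: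
  assumes "a \<in> Obj C" "b \<in> Obj C" "f \<in> Arr C"
  shows "\<iota> a \<otimes> \<iota> b \<otimes> f = \<iota> (a \<otimes>\<^sub>o b) \<otimes> f"
  using tens_assoc[of "\<iota> a" "\<iota> b" f] assms by (simp del: tens_assoc)

lemma tens_comp:
  assumes "f \<in> Arr C" "g \<in> Arr C" "f' \<in> Arr C" "g' \<in> Arr C"
    "Dom C g = Cod C f" "Dom C g' = Cod C f'"
  shows "(g \<cdot> f) \<otimes> (g' \<cdot> f') = (g \<otimes> g') \<cdot> (f \<otimes> f')"
  using Tens_Comp[of f "Dom C f" "Cod C f" g "Cod C g" f' "Dom C f'" "Cod C f'" g' "Cod C g'"]
    assms by (auto simp: hom_def)

lemma whisker_left [simp]:
  assumes "a \<in> Obj C" "f \<in> Arr C" "g \<in> Arr C" "Dom C g = Cod C f"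
  shows "\<iota> a \<otimes> (g \<cdot> f) = (\<iota> a \<otimes> g) \<cdot> (\<iota> a \<otimes> f)"
  using tens_comp[of "\<iota> a" "\<iota> a" f g] assms by simp

lemma whisker_right [simp]:
  assumes "a \<in> Obj C" "f \<in> Arr C" "g \<in> Arr C" "Dom C g = Cod C f"
  shows "(g \<cdot> f) \<otimes> \<iota> a = (g \<otimes> \<iota> a) \<cdot> (f \<otimes> \<iota> a)"
  using tens_comp[of f g "\<iota> a" "\<iota> a"] assms by simp

lemma tens_right_first:
  assumes "f \<in> Arr C" "g \<in> Arr C"
  shows "f \<otimes> g = (f \<otimes> \<iota> (Cod C g)) \<cdot> (\<iota> (Dom C f) \<otimes> g)"
  using tens_comp[of "\<iota> (Dom C f)" f g "\<iota> (Cod C g)"] assms by simp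

lemma tens_left_first:
  assumes "f \<in> Arr C" "g \<in> Arr C"
  shows "f \<otimes> g = (\<iota> (Cod C f) \<otimes> g) \<cdot> (f \<otimes> \<iota> (Dom C g))"
  using tens_comp[of f "\<iota> (Cod C f)" "\<iota> (Dom C g)" g] assms by simp

lemma interchange:
  assumes "f \<in> Arr C" "g \<in> Arr C"
  shows "(f \<otimes> \<iota> (Cod C g)) \<cdot> (\<iota> (Dom C f) \<otimes> g) = (\<iota> (Cod C f) \<otimes> g) \<cdot> (f \<otimes> \<iota> (Dom C g))"
  by (rule trans[OF tens_right_first[OF assms, symmetric] tens_left_first[OF assms]])

end

section \<open>Free left modules over an algebra\<close>

locale coflat_algebra = strict_monoidal_category C
  for C :: "('o, 'm) moncat" (structure) +
  fixes coeq :: "'m \<Rightarrow> 'm \<Rightarrow> 'm" and A :: 'o and m e :: 'm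
  assumes alg: "algebra C A m e"
    and choice: "coequalizer_choice C coeq"
    and coflat_A: "left_coflat C A"
begin

lemma A_Obj [simp]: "A \<in> Obj C"
  using alg by (simp add: algebra_def)

lemma m_typing [simp]: "m \<in> Arr C" "Dom C m = A \<otimes>\<^sub>o A" "Cod C m = A"
  using alg by (auto simp: algebra_def hom_def)

lemma e_typing [simp]: "e \<in> Arr C" "Dom C e = \<one>" "Cod C e = A"
  using alg by (auto simp: algebra_def hom_def)

lemma m_assoc: "m \<cdot> (m \<otimes> \<iota> A) = m \<cdot> (\<iota> A \<otimes> m)"
  using alg by (simp add: algebra_def Assoc_Id)

lemma m_unit_left: "m \<cdot> (e \<otimes> \<iota> A) = \<iota> A"
  using alg by (simp add: algebra_def Lunit_Id)

lemma m_unit_right: "m \<cdot> (\<iota> A \<otimes> e) = \<iota> A"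
  using alg by (simp add: algebra_def Runit_Id)

lemma left_module_iff:
  "left_module C A m e Y l \<longleftrightarrow> Y \<in> Obj C \<and> l \<in> Arr C \<and> Dom C l = A \<otimes>\<^sub>o Y \<and> Cod C l = Y \<and>
     l \<cdot> (m \<otimes> \<iota> Y) = l \<cdot> (\<iota> A \<otimes> l) \<and> l \<cdot> (e \<otimes> \<iota> Y) = \<iota> Y"
  by (auto simp: left_module_def hom_def)

lemma right_module_iff:
  "right_module C A m e M r \<longleftrightarrow> M \<in> Obj C \<and> r \<in> Arr C \<and> Dom C r = M \<otimes>\<^sub>o A \<and> Cod C r = M \<and>
     r \<cdot> (\<iota> M \<otimes> m) = r \<cdot> (r \<otimes> \<iota> A) \<and> r \<cdot> (\<iota> M \<otimes> e) = \<iota> M"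
  by (auto simp: right_module_def hom_def)

text \<open>The map \<open>i\<close> is the inclusion of the generators and \<open>p\<close> the coordinate map, the inverse of
  the isomorphism \<open>A \<otimes> W \<rightarrow> Y\<close> extending \<open>i\<close>. Both are kept as data since \<open>M \<otimes>\<^sub>A Y\<close> is free only up
  to an isomorphism that depends on the chosen coequalizer.\<close>
definition free_on :: "'o \<Rightarrow> 'm \<Rightarrow> 'o \<Rightarrow> 'm \<Rightarrow> 'm \<Rightarrow> bool" where
  "free_on Y l W i p \<longleftrightarrow> left_module C A m e Y l \<and> W \<in> Obj C \<and>
     i \<in> hom C W Y \<and> p \<in> hom C Y (A \<otimes>\<^sub>o W) \<and>
     p \<cdot> l \<cdot> (\<iota> A \<otimes> i) = \<iota> (A \<otimes>\<^sub>o W) \<and> l \<cdot> (\<iota> A \<otimes> i) \<cdot> p = \<iota> Y"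

lemma free_onD:
  assumes "free_on Y l W i p"
  shows "Y \<in> Obj C" "W \<in> Obj C" "l \<in> Arr C" "Dom C l = A \<otimes>\<^sub>o Y" "Cod C l = Y"
    "i \<in> Arr C" "Dom C i = W" "Cod C i = Y" "p \<in> Arr C" "Dom C p = Y" "Cod C p = A \<otimes>\<^sub>o W"
  using assms by (auto simp: free_on_def left_module_iff hom_def)

lemma free_on_eqs:
  assumes "free_on Y l W i p"
  shows "l \<cdot> (m \<otimes> \<iota> Y) = l \<cdot> (\<iota> A \<otimes> l)" "l \<cdot> (e \<otimes> \<iota> Y) = \<iota> Y"
    "p \<cdot> l \<cdot> (\<iota> A \<otimes> i) = \<iota> (A \<otimes>\<^sub>o W)" "l \<cdot> (\<iota> A \<otimes> i) \<cdot> p = \<iota> Y"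
  using assms by (auto simp: free_on_def left_module_iff hom_def)

text \<open>The inverse of a linear isomorphism is linear.\<close>
lemma free_coords_linear:
  assumes "free_on Y l W i p"
  shows "p \<cdot> l = (m \<otimes> \<iota> W) \<cdot> (\<iota> A \<otimes> p)"
proof -
  note [simp] = free_onD[OF assms] and eqs = free_on_eqs[OF assms]
  have "p \<cdot> l = p \<cdot> (l \<cdot> (\<iota> A \<otimes> l)) \<cdot> (\<iota> (A \<otimes>\<^sub>o A) \<otimes> i) \<cdot> (\<iota> A \<otimes> p)"
    using arg_cong[OF eqs(4), of "\<lambda>k. p \<cdot> l \<cdot> (\<iota> A \<otimes> k)"] by simp
  also have "\<dots> = p \<cdot> (l \<cdot> (m \<otimes> \<iota> Y)) \<cdot> (\<iota> (A \<otimes>\<^sub>o A) \<otimes> i) \<cdot> (\<iota> A \<otimes> p)"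
    by (simp only: eqs)
  also have "\<dots> = (p \<cdot> l \<cdot> (\<iota> A \<otimes> i)) \<cdot> (m \<otimes> \<iota> W) \<cdot> (\<iota> A \<otimes> p)"
    using arg_cong[OF interchange[of m i], of "\<lambda>k. p \<cdot> l \<cdot> k \<cdot> (\<iota> A \<otimes> p)"] by simp
  also have "\<dots> = (m \<otimes> \<iota> W) \<cdot> (\<iota> A \<otimes> p)"
    by (simp add: eqs(3) del: comp_assoc)
  finally show ?thesis .
qed

lemma free_coords_basis:
  assumes "free_on Y l W i p"
  shows "p \<cdot> i = e \<otimes> \<iota> W"
proof -
  note [simp] = free_onD[OF assms] and eqs = free_on_eqs[OF assms]
  have "p \<cdot> i = p \<cdot> (l \<cdot> (e \<otimes> \<iota> Y)) \<cdot> i"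
    by (simp add: eqs del: comp_assoc)
  also have "\<dots> = (p \<cdot> l \<cdot> (\<iota> A \<otimes> i)) \<cdot> (e \<otimes> \<iota> W)"
    using arg_cong[OF interchange[of e i], of "\<lambda>k. p \<cdot> l \<cdot> k"] by simp
  finally show ?thesis by (simp add: eqs(3) del: comp_assoc)
qed

text \<open>A linear map out of a free module is determined by its values on the generators, because every
  element of \<open>Y\<close> is a combination of generators: \<open>l (A \<otimes> i) p\<close> is the identity.\<close>
lemma linear_map_eq:
  assumes "free_on Y l W i p" "left_module C A m e Z k"
    and "h \<in> hom C Y Z" "h \<cdot> l = k \<cdot> (\<iota> A \<otimes> h)"
  shows "h = k \<cdot> (\<iota> A \<otimes> (h \<cdot> i)) \<cdot> p"
proof -
  note [simp] = free_onD[OF assms(1)] and eqs = free_on_eqs[OF assms(1)]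
  have [simp]: "Z \<in> Obj C" "k \<in> Arr C" "Dom C k = A \<otimes>\<^sub>o Z" "Cod C k = Z"
      "h \<in> Arr C" "Dom C h = Y" "Cod C h = Z"
    using assms by (auto simp: left_module_iff hom_def)
  show ?thesis
    using arg_cong[OF eqs(4), of "\<lambda>x. h \<cdot> x"] arg_cong[OF assms(4), of "\<lambda>x. x \<cdot> (\<iota> A \<otimes> i) \<cdot> p"]
    by simp
qed

lemma free_on_tensor:
  assumes "free_on Y l W i p" "V \<in> Obj C"
  shows "free_on (Y \<otimes>\<^sub>o V) (l \<otimes> \<iota> V) (W \<otimes>\<^sub>o V) (i \<otimes> \<iota> V) (p \<otimes> \<iota> V)"
proof -
  note [simp] = free_onD[OF assms(1)] assms(2) and eqs = free_on_eqs[OF assms(1)]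
  show ?thesis
    using eqs[THEN arg_cong[of _ _ "\<lambda>x. x \<otimes> \<iota> V"]]
    by (simp add: free_on_def left_module_iff hom_def)
qed

lemma tensor_left_module:
  assumes "left_module C A m e Y l" "V \<in> Obj C"
  shows "left_module C A m e (Y \<otimes>\<^sub>o V) (l \<otimes> \<iota> V)"
proof -
  have [simp]: "Y \<in> Obj C" "l \<in> Arr C" "Dom C l = A \<otimes>\<^sub>o Y" "Cod C l = Y" "V \<in> Obj C"
    and eqs: "l \<cdot> (m \<otimes> \<iota> Y) = l \<cdot> (\<iota> A \<otimes> l)" "l \<cdot> (e \<otimes> \<iota> Y) = \<iota> Y"
    using assms by (auto simp: left_module_iff)
  show ?thesis
    using eqs[THEN arg_cong[of _ _ "\<lambda>x. x \<otimes> \<iota> V"]] by (simp add: left_module_iff)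
qed

lemma tensor_right_module:
  assumes "right_module C A m e Z r" "K \<in> Obj C"
  shows "right_module C A m e (K \<otimes>\<^sub>o Z) (\<iota> K \<otimes> r)"
proof -
  have [simp]: "Z \<in> Obj C" "r \<in> Arr C" "Dom C r = Z \<otimes>\<^sub>o A" "Cod C r = Z" "K \<in> Obj C"
    and eqs: "r \<cdot> (\<iota> Z \<otimes> m) = r \<cdot> (r \<otimes> \<iota> A)" "r \<cdot> (\<iota> Z \<otimes> e) = \<iota> Z"
    using assms by (auto simp: right_module_iff)
  show ?thesis
    using eqs[THEN arg_cong[of _ _ "\<lambda>x. \<iota> K \<otimes> x"]] by (simp add: right_module_iff)
qed

end

section \<open>Split epimorphisms and coequalizers\<close>

context strict_monoidal_category
begin

lemma split_epi_cancel:
  assumes "q \<cdot> s = \<iota> (Cod C q)" "q \<in> Arr C" "s \<in> Arr C" "Dom C q = Cod C s"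
    and "g \<in> Arr C" "h \<in> Arr C" "Dom C g = Cod C q" "Dom C h = Cod C q"
    and "g \<cdot> q = h \<cdot> q"
  shows "g = h"
proof -
  have "Cod C s = Dom C q" using assms(4) by simp
  have "g \<cdot> q \<cdot> s = h \<cdot> q \<cdot> s"
    using arg_cong[OF assms(9), of "\<lambda>x. x \<cdot> s"] assms(1-8) by (simp del: assms(1))
  then show ?thesis using assms(1-8) by simp
qed

lemma split_mono_cancel:
  assumes "s \<cdot> t = \<iota> (Dom C t)" "t \<in> Arr C" "s \<in> Arr C" "Dom C s = Cod C t"
    and "g \<in> Arr C" "h \<in> Arr C" "Cod C g = Dom C t" "Cod C h = Dom C t"
    and "t \<cdot> g = t \<cdot> h"
  shows "g = h"
proof -
  have "(s \<cdot> t) \<cdot> g = (s \<cdot> t) \<cdot> h"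
    using assms(2-9) by simp
  then show ?thesis using assms(1,5-8) by (simp del: comp_assoc)
qed

lemma induced_eqI:
  assumes "q \<cdot> s = \<iota> (Cod C q)" "q \<in> Arr C" "s \<in> Arr C" "Dom C q = Cod C s"
    and "k \<in> Arr C" "Dom C k = Cod C q" "k \<cdot> q = h"
  shows "induced C q h = k"
  unfolding induced_def
proof (rule the_equality)
  have "Cod C h = Cod C k" using assms by auto
  then show "k \<in> hom C (Cod C q) (Cod C h) \<and> k \<cdot> q = h"
    using assms by (auto simp: hom_def)
  show "g = k" if "g \<in> hom C (Cod C q) (Cod C h) \<and> g \<cdot> q = h" for g
    by (rule split_epi_cancel[OF assms(1-4)]; use that assms in \<open>auto simp: hom_def\<close>)
qed

lemma coequalizer_factor:
  assumes "is_coequalizer C f g q" "h \<in> Arr C" "Dom C h = Cod C f" "h \<cdot> f = h \<cdot> g"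
  obtains k where "k \<in> Arr C" "Dom C k = Cod C q" "Cod C k = Cod C h" "k \<cdot> q = h"
  using assms unfolding is_coequalizer_def hom_def by blast

lemma coequalizer_cancel:
  assumes "is_coequalizer C f g q" "h \<in> Arr C" "k \<in> Arr C" "Dom C h = Cod C q" "Dom C k = Cod C q"
    and "h \<cdot> q = k \<cdot> q"
  shows "h = k"
proof -
  have [simp]: "q \<in> Arr C" "f \<in> Arr C" "g \<in> Arr C" "Dom C g = Dom C f" "Cod C g = Cod C f"
    "Dom C q = Cod C f" and eq: "q \<cdot> f = q \<cdot> g"
    using assms(1) by (auto simp: is_coequalizer_def hom_def)
  have cod: "Cod C k = Cod C h"
    using arg_cong[OF assms(6), of "Cod C"] assms(2-5) by simp
  have "(h \<cdot> q) \<cdot> f = (h \<cdot> q) \<cdot> g" using eq assms(2,4) by simp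
  moreover have "h \<cdot> q \<in> Arr C" "Dom C (h \<cdot> q) = Cod C f"
    using assms(2,4) by simp_all
  ultimately have "\<exists>!x. x \<in> hom C (Cod C q) (Cod C (h \<cdot> q)) \<and> x \<cdot> q = h \<cdot> q"
    using assms(1) unfolding is_coequalizer_def by blast
  moreover have "h \<in> hom C (Cod C q) (Cod C (h \<cdot> q))" "k \<in> hom C (Cod C q) (Cod C (h \<cdot> q))"
    using assms(2-5) cod by (simp_all add: hom_def)
  ultimately show ?thesis using assms(6) by metis
qed

text \<open>The usual criterion for split coequalizers: with a section \<open>s\<close> of \<open>q\<close>, the factorization of
  \<open>h\<close> through \<open>q\<close> can only be \<open>h s\<close>.\<close>
lemma is_coequalizerI:
  assumes "f \<in> Arr C" "g \<in> Arr C" "Dom C g = Dom C f" "Cod C g = Cod C f"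
    and "q \<in> Arr C" "Dom C q = Cod C f" "q \<cdot> f = q \<cdot> g"
    and "s \<in> Arr C" "Dom C s = Cod C q" "Cod C s = Dom C q" "q \<cdot> s = \<iota> (Cod C q)"
    and "\<And>h. h \<in> Arr C \<Longrightarrow> Dom C h = Cod C f \<Longrightarrow> h \<cdot> f = h \<cdot> g \<Longrightarrow> h \<cdot> s \<cdot> q = h"
  shows "is_coequalizer C f g q"
  unfolding is_coequalizer_def
proof (intro conjI ballI impI)
  fix h assume h: "h \<in> Arr C" "Dom C h = Cod C f \<and> h \<cdot> f = h \<cdot> g"
  have hsq: "h \<cdot> s \<cdot> q = h" using assms(12) h by blast
  show "\<exists>!k. k \<in> hom C (Cod C q) (Cod C h) \<and> k \<cdot> q = h"
  proof (rule ex1I)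
    show "h \<cdot> s \<in> hom C (Cod C q) (Cod C h) \<and> (h \<cdot> s) \<cdot> q = h"
      using assms(1-6,8-10) h(1) conjunct1[OF h(2)] hsq by (simp add: hom_def)
    show "k = h \<cdot> s" if "k \<in> hom C (Cod C q) (Cod C h) \<and> k \<cdot> q = h" for k
      by (rule split_epi_cancel[OF assms(11)];
          use that assms(1-6,8-10) h(1) conjunct1[OF h(2)] hsq in \<open>auto simp: hom_def\<close>)
  qed
qed (use assms(1-7) in \<open>auto simp: hom_def\<close>)

lemma is_isoI:
  assumes "f \<in> Arr C" "g \<in> Arr C" "Dom C g = Cod C f" "Cod C g = Dom C f"
    and "g \<cdot> f = \<iota> (Dom C f)" "f \<cdot> g = \<iota> (Cod C f)"
  shows "is_iso C f"
  using assms by (auto simp: is_iso_def hom_def)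

end

section \<open>Tensoring a right module with a free left module\<close>

context coflat_algebra
begin

lemma right_moduleD:
  assumes "right_module C A m e M r"
  shows "M \<in> Obj C" "r \<in> Arr C" "Dom C r = M \<otimes>\<^sub>o A" "Cod C r = M"
  using assms by (auto simp: right_module_iff)

text \<open>A balanced map is determined by its values on generators of \<open>Y\<close>: write an element of \<open>Y\<close> in
  coordinates and move the coefficients to the left factor.\<close>
lemma balanced_factor:
  assumes "right_module C A m e M r" "free_on Y l W i p"
    and h: "h \<in> Arr C" "Dom C h = M \<otimes>\<^sub>o Y" "h \<cdot> (r \<otimes> \<iota> Y) = h \<cdot> (\<iota> M \<otimes> l)"
  shows "h \<cdot> (\<iota> M \<otimes> i) \<cdot> (r \<otimes> \<iota> W) \<cdot> (\<iota> M \<otimes> p) = h"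
proof -
  note [simp] = right_moduleD[OF assms(1)] free_onD[OF assms(2)] h(1,2)
  have "h \<cdot> (\<iota> M \<otimes> i) \<cdot> (r \<otimes> \<iota> W) \<cdot> (\<iota> M \<otimes> p)
      = (h \<cdot> (r \<otimes> \<iota> Y)) \<cdot> (\<iota> (M \<otimes>\<^sub>o A) \<otimes> i) \<cdot> (\<iota> M \<otimes> p)"
    using arg_cong[OF interchange[of r i], of "\<lambda>x. h \<cdot> x \<cdot> (\<iota> M \<otimes> p)"] by simp
  also have "\<dots> = h \<cdot> (\<iota> M \<otimes> (l \<cdot> (\<iota> A \<otimes> i) \<cdot> p))"
    by (simp only: h) simp
  also have "\<dots> = h"
    by (simp only: free_on_eqs[OF assms(2)]) simp
  finally show ?thesis .
qed

text \<open>Inserting a generator and then letting its coefficient \<open>e\<close> act on the right of \<open>M\<close> does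
  nothing.\<close>
lemma tensor_section:
  assumes "right_module C A m e M r" "free_on Y l W i p"
  shows "(r \<otimes> \<iota> W) \<cdot> (\<iota> M \<otimes> p) \<cdot> (\<iota> M \<otimes> i) = \<iota> (M \<otimes>\<^sub>o W)"
proof -
  note [simp] = right_moduleD[OF assms(1)] free_onD[OF assms(2)]
  have "(r \<otimes> \<iota> W) \<cdot> (\<iota> M \<otimes> p) \<cdot> (\<iota> M \<otimes> i) = (r \<otimes> \<iota> W) \<cdot> (\<iota> M \<otimes> (p \<cdot> i))"
    by simp
  also have "\<dots> = (r \<cdot> (\<iota> M \<otimes> e)) \<otimes> \<iota> W"
    by (simp add: free_coords_basis[OF assms(2)])
  also have "\<dots> = \<iota> (M \<otimes>\<^sub>o W)"
    using assms(1) by (simp add: right_module_iff)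
  finally show ?thesis .
qed

lemma tensor_coequalizer:
  assumes "right_module C A m e M r" "free_on Y l W i p"
  shows "is_coequalizer C (r \<otimes> \<iota> Y) (\<iota> M \<otimes> l) ((r \<otimes> \<iota> W) \<cdot> (\<iota> M \<otimes> p))"
proof -
  note [simp] = right_moduleD[OF assms(1)] free_onD[OF assms(2)]
  have r: "r \<cdot> (\<iota> M \<otimes> m) = r \<cdot> (r \<otimes> \<iota> A)"
    using assms(1) by (simp add: right_module_iff)
  have "((r \<otimes> \<iota> W) \<cdot> (\<iota> M \<otimes> p)) \<cdot> (r \<otimes> \<iota> Y) = ((r \<cdot> (r \<otimes> \<iota> A)) \<otimes> \<iota> W) \<cdot> (\<iota> (M \<otimes>\<^sub>o A) \<otimes> p)"
    using arg_cong[OF interchange[of r p], of "\<lambda>x. (r \<otimes> \<iota> W) \<cdot> x"] by simp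
  also have "\<dots> = ((r \<cdot> (\<iota> M \<otimes> m)) \<otimes> \<iota> W) \<cdot> (\<iota> (M \<otimes>\<^sub>o A) \<otimes> p)"
    by (simp only: r)
  also have "\<dots> = ((r \<otimes> \<iota> W) \<cdot> (\<iota> M \<otimes> p)) \<cdot> (\<iota> M \<otimes> l)"
    using arg_cong[OF free_coords_linear[OF assms(2)], of "\<lambda>x. (r \<otimes> \<iota> W) \<cdot> (\<iota> M \<otimes> x)"] by simp
  finally have coeq: "((r \<otimes> \<iota> W) \<cdot> (\<iota> M \<otimes> p)) \<cdot> (r \<otimes> \<iota> Y)
    = ((r \<otimes> \<iota> W) \<cdot> (\<iota> M \<otimes> p)) \<cdot> (\<iota> M \<otimes> l)" .
  show ?thesis
    using coeq tensor_section[OF assms] balanced_factor[OF assms]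
    by (intro is_coequalizerI[where s = "\<iota> M \<otimes> i"]) simp_all
qed

text \<open>The canonical map \<open>M \<otimes>\<^sub>A Y \<rightarrow> M \<otimes> W\<close> out of the chosen coequalizer.\<close>
definition tensor_coords :: "'o \<Rightarrow> 'm \<Rightarrow> 'o \<Rightarrow> 'm \<Rightarrow> 'o \<Rightarrow> 'm \<Rightarrow> 'm" where
  "tensor_coords M r Y l W p =
     induced C (tensor_q C coeq M r Y l) ((r \<otimes> \<iota> W) \<cdot> (\<iota> M \<otimes> p))"

lemma tensor_q_coequalizer:
  assumes "right_module C A m e M r" "free_on Y l W i p"
  shows "is_coequalizer C (r \<otimes> \<iota> Y) (\<iota> M \<otimes> l) (tensor_q C coeq M r Y l)"
  using choice tensor_coequalizer[OF assms] unfolding coequalizer_choice_def tensor_q_def by blast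

lemma tensor_q_typing:
  assumes "right_module C A m e M r" "free_on Y l W i p"
  shows "tensor_q C coeq M r Y l \<in> Arr C" "Dom C (tensor_q C coeq M r Y l) = M \<otimes>\<^sub>o Y"
    and tensor_q_balanced: "tensor_q C coeq M r Y l \<cdot> (r \<otimes> \<iota> Y) = tensor_q C coeq M r Y l \<cdot> (\<iota> M \<otimes> l)"
  using tensor_q_coequalizer[OF assms] right_moduleD[OF assms(1)] free_onD[OF assms(2)]
  by (auto simp: is_coequalizer_def)

text \<open>Two coequalizers of the same pair are isomorphic. The inverse is explicit, namely \<open>q (M \<otimes> i)\<close>,
  so that \<open>q\<close> itself is a split epimorphism; later factorizations through \<open>q\<close> can
  therefore be written down and checked.\<close>
lemma tensor_coords_props:
  assumes "right_module C A m e M r" "free_on Y l W i p"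
  defines "q \<equiv> tensor_q C coeq M r Y l" and "\<theta> \<equiv> tensor_coords M r Y l W p"
  shows "\<theta> \<in> Arr C" "Dom C \<theta> = Cod C q" "Cod C \<theta> = M \<otimes>\<^sub>o W"
    and tensor_coords_q: "\<theta> \<cdot> q = (r \<otimes> \<iota> W) \<cdot> (\<iota> M \<otimes> p)"
    and tensor_coords_inverse: "q \<cdot> (\<iota> M \<otimes> i) \<cdot> \<theta> = \<iota> (Cod C q)"
proof -
  note [simp] = right_moduleD[OF assms(1)] free_onD[OF assms(2)]
    tensor_q_typing(1,2)[OF assms(1,2), folded q_def]
  note q = tensor_q_coequalizer[OF assms(1,2), folded q_def]
  let ?t = "(r \<otimes> \<iota> W) \<cdot> (\<iota> M \<otimes> p)"
  obtain k where k [simp]: "k \<in> Arr C" "Dom C k = Cod C q" "Cod C k = M \<otimes>\<^sub>o W" and kq: "k \<cdot> q = ?t"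
    using tensor_coequalizer[OF assms(1,2)]
    by (auto simp: is_coequalizer_def intro: coequalizer_factor[OF q, of ?t])
  have "(q \<cdot> (\<iota> M \<otimes> i) \<cdot> k) \<cdot> q = \<iota> (Cod C q) \<cdot> q"
    using balanced_factor[OF assms(1,2), of q] tensor_q_balanced[OF assms(1,2), folded q_def] kq
    by simp
  with coequalizer_cancel[OF q, of "q \<cdot> (\<iota> M \<otimes> i) \<cdot> k" "\<iota> (Cod C q)"]
  have qk: "q \<cdot> (\<iota> M \<otimes> i) \<cdot> k = \<iota> (Cod C q)"
    by simp
  have "\<theta> = k"
    unfolding \<theta>_def tensor_coords_def q_def[symmetric]
    using qk kq by (intro induced_eqI[where s = "(\<iota> M \<otimes> i) \<cdot> k"]) simp_all
  then show "\<theta> \<in> Arr C" "Dom C \<theta> = Cod C q" "Cod C \<theta> = M \<otimes>\<^sub>o W" "\<theta> \<cdot> q = ?t"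
    "q \<cdot> (\<iota> M \<otimes> i) \<cdot> \<theta> = \<iota> (Cod C q)"
    using kq qk by simp_all
qed

lemma tensor_coords_section:
  assumes "right_module C A m e M r" "free_on Y l W i p"
  shows "tensor_coords M r Y l W p \<cdot> tensor_q C coeq M r Y l \<cdot> (\<iota> M \<otimes> i) = \<iota> (M \<otimes>\<^sub>o W)"
proof -
  note [simp] = right_moduleD[OF assms(1)] free_onD[OF assms(2)]
    tensor_q_typing(1,2)[OF assms(1,2)] tensor_coords_props(1-3)[OF assms]
  show ?thesis
    using arg_cong[OF tensor_coords_q[OF assms], of "\<lambda>x. x \<cdot> (\<iota> M \<otimes> i)"] tensor_section[OF assms]
    by simp
qed

text \<open>In coordinates, both \<open>(K \<otimes> Z) \<otimes>\<^sub>A Y\<close> and \<open>K \<otimes> (Z \<otimes>\<^sub>A Y)\<close> are \<open>K \<otimes> Z \<otimes> W\<close>, and the canonical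
  morphism between them is the identity.\<close>
lemma free_on_left_robust:
  assumes "free_on Y l W i p"
  shows "left_robust C coeq A m e Y l"
  unfolding left_robust_def
proof (intro ballI allI impI)
  fix K Z r assume K [simp]: "K \<in> Obj C" and Z: "right_module C A m e Z r"
  note KZ = tensor_right_module[OF Z K]
  note [simp] = right_moduleD[OF Z] free_onD[OF assms]
  define q where "q = tensor_q C coeq Z r Y l"
  define \<theta> where "\<theta> = tensor_coords Z r Y l W p"
  define q' where "q' = tensor_q C coeq (K \<otimes>\<^sub>o Z) (\<iota> K \<otimes> r) Y l"
  define \<theta>' where "\<theta>' = tensor_coords (K \<otimes>\<^sub>o Z) (\<iota> K \<otimes> r) Y l W p"
  note [simp] = tensor_q_typing(1,2)[OF Z assms, folded q_def]
    tensor_coords_props(1-3)[OF Z assms, folded q_def \<theta>_def]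
    tensor_q_typing(1,2)[OF KZ assms, folded q'_def]
    tensor_coords_props(1-3)[OF KZ assms, folded q'_def \<theta>'_def]
  note c = tensor_coords_q[OF Z assms, folded q_def \<theta>_def]
    tensor_coords_inverse[OF Z assms, folded q_def \<theta>_def]
    tensor_coords_section[OF Z assms, folded q_def \<theta>_def]
  note c' = tensor_coords_q[OF KZ assms, folded q'_def \<theta>'_def]
    tensor_coords_inverse[OF KZ assms, folded q'_def \<theta>'_def]
    tensor_coords_section[OF KZ assms, folded q'_def \<theta>'_def]
  \<comment> \<open>The canonical morphism and its inverse, both passing through the coordinates \<open>K \<otimes> Z \<otimes> W\<close>.\<close>
  let ?f = "(\<iota> K \<otimes> q) \<cdot> (\<iota> (K \<otimes>\<^sub>o Z) \<otimes> i) \<cdot> \<theta>'"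
  let ?g = "q' \<cdot> (\<iota> (K \<otimes>\<^sub>o Z) \<otimes> i) \<cdot> (\<iota> K \<otimes> \<theta>)"
  have "?f \<cdot> q' = \<iota> K \<otimes> (q \<cdot> (\<iota> Z \<otimes> i) \<cdot> (r \<otimes> \<iota> W) \<cdot> (\<iota> Z \<otimes> p))"
    using c'(1) by simp
  also have "q \<cdot> (\<iota> Z \<otimes> i) \<cdot> (r \<otimes> \<iota> W) \<cdot> (\<iota> Z \<otimes> p) = q"
    using balanced_factor[OF Z assms, of q] tensor_q_balanced[OF Z assms, folded q_def] by simp
  finally have fq: "induced C q' (\<iota> K \<otimes> q) = ?f"
    using c'(2) by (intro induced_eqI[where s = "(\<iota> (K \<otimes>\<^sub>o Z) \<otimes> i) \<cdot> \<theta>'"]) simp_all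
  have "?f \<cdot> ?g = (\<iota> K \<otimes> q) \<cdot> (\<iota> (K \<otimes>\<^sub>o Z) \<otimes> i) \<cdot> (\<theta>' \<cdot> q' \<cdot> (\<iota> (K \<otimes>\<^sub>o Z) \<otimes> i)) \<cdot> (\<iota> K \<otimes> \<theta>)"
    by simp
  also have "\<dots> = \<iota> K \<otimes> (q \<cdot> (\<iota> Z \<otimes> i) \<cdot> \<theta>)"
    by (simp only: c'(3)) simp
  also have "\<dots> = \<iota> (Cod C ?f)"
    by (simp only: c(2)) simp
  finally have fg: "?f \<cdot> ?g = \<iota> (Cod C ?f)" .
  have "?g \<cdot> ?f = q' \<cdot> (\<iota> (K \<otimes>\<^sub>o Z) \<otimes> i) \<cdot> (\<iota> K \<otimes> (\<theta> \<cdot> q \<cdot> (\<iota> Z \<otimes> i))) \<cdot> \<theta>'"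
    by simp
  also have "\<dots> = \<iota> (Dom C ?f)"
    by (simp only: c(3)) (simp add: c'(2))
  finally have gf: "?g \<cdot> ?f = \<iota> (Dom C ?f)" .
  show "is_iso C (induced C (tensor_q C coeq (K \<otimes>\<^sub>o Z) (\<iota> K \<otimes> r) Y l) (\<iota> K \<otimes> tensor_q C coeq Z r Y l))"
    unfolding q_def[symmetric] q'_def[symmetric] fq
    by (rule is_isoI[OF _ _ _ _ gf fg]) simp_all
qed

text \<open>Tensoring with \<open>V \<otimes> W\<close> is tensoring with \<open>V\<close> and then with \<open>W\<close>.\<close>
lemma left_coflat_tensor:
  assumes "left_coflat C V" "left_coflat C W"
  shows "left_coflat C (V \<otimes>\<^sub>o W)"
  unfolding left_coflat_def
proof (intro conjI allI impI)
  have [simp]: "V \<in> Obj C" "W \<in> Obj C" using assms by (auto simp: left_coflat_def)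
  show "V \<otimes>\<^sub>o W \<in> Obj C" by simp
  fix f g q assume q: "is_coequalizer C f g q"
  then have [simp]: "f \<in> Arr C" "g \<in> Arr C" "q \<in> Arr C"
    by (auto simp: is_coequalizer_def hom_def)
  have "is_coequalizer C ((f \<otimes> \<iota> V) \<otimes> \<iota> W) ((g \<otimes> \<iota> V) \<otimes> \<iota> W) ((q \<otimes> \<iota> V) \<otimes> \<iota> W)"
    using assms q by (simp add: left_coflat_def del: tens_assoc)
  then show "is_coequalizer C (f \<otimes> \<iota> (V \<otimes>\<^sub>o W)) (g \<otimes> \<iota> (V \<otimes>\<^sub>o W)) (q \<otimes> \<iota> (V \<otimes>\<^sub>o W))"
    by simp
qed

lemma left_coflat_iso:
  assumes "left_coflat C V" "Y \<in> Obj C"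
    and "p \<in> Arr C" "Dom C p = Y" "Cod C p = V" "p' \<in> Arr C" "Dom C p' = V" "Cod C p' = Y"
    and inv: "p \<cdot> p' = \<iota> V" "p' \<cdot> p = \<iota> Y"
  shows "left_coflat C Y"
  unfolding left_coflat_def
proof (intro conjI allI impI)
  show "Y \<in> Obj C" by (fact assms)
  have [simp]: "V \<in> Obj C" using assms by (auto simp: left_coflat_def)
  note [simp] = assms(2-8)
  fix f g q assume fgq: "is_coequalizer C f g q"
  then have [simp]: "f \<in> Arr C" "g \<in> Arr C" "q \<in> Arr C"
      "Dom C g = Dom C f" "Cod C g = Cod C f" "Dom C q = Cod C f"
    and q: "q \<cdot> f = q \<cdot> g"
    unfolding is_coequalizer_def hom_def by blast+
  have qV: "is_coequalizer C (f \<otimes> \<iota> V) (g \<otimes> \<iota> V) (q \<otimes> \<iota> V)"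
    using assms(1) fgq unfolding left_coflat_def by blast
  have id: "(\<iota> x \<otimes> p') \<cdot> (\<iota> x \<otimes> p) = \<iota> (x \<otimes>\<^sub>o Y)" "(\<iota> x \<otimes> p) \<cdot> (\<iota> x \<otimes> p') = \<iota> (x \<otimes>\<^sub>o V)" if "x \<in> Obj C" for x
    using inv[THEN arg_cong[of _ _ "\<lambda>k. \<iota> x \<otimes> k"]] that by simp_all
  have "\<exists>!k. k \<in> hom C (Cod C q \<otimes>\<^sub>o Y) (Cod C h) \<and> k \<cdot> (q \<otimes> \<iota> Y) = h"
    if h [simp]: "h \<in> Arr C" "Dom C h = Cod C f \<otimes>\<^sub>o Y" and eq: "h \<cdot> (f \<otimes> \<iota> Y) = h \<cdot> (g \<otimes> \<iota> Y)" for h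
  proof -
    let ?h = "h \<cdot> (\<iota> (Cod C f) \<otimes> p')"
    have "?h \<cdot> (f \<otimes> \<iota> V) = (h \<cdot> (f \<otimes> \<iota> Y)) \<cdot> (\<iota> (Dom C f) \<otimes> p')"
      using interchange[of f p'] by simp
    also have "\<dots> = ?h \<cdot> (g \<otimes> \<iota> V)"
      unfolding eq using interchange[of g p'] by simp
    finally obtain k where k [simp]: "k \<in> Arr C" "Dom C k = Cod C q \<otimes>\<^sub>o V" "Cod C k = Cod C h"
      and kq: "k \<cdot> (q \<otimes> \<iota> V) = ?h"
      by (auto intro: coequalizer_factor[OF qV, of ?h])
    show ?thesis
    proof (rule ex1I)
      have "(k \<cdot> (\<iota> (Cod C q) \<otimes> p)) \<cdot> (q \<otimes> \<iota> Y) = (k \<cdot> (q \<otimes> \<iota> V)) \<cdot> (\<iota> (Cod C f) \<otimes> p)"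
        using interchange[of q p] by simp
      also have "\<dots> = h \<cdot> ((\<iota> (Cod C f) \<otimes> p') \<cdot> (\<iota> (Cod C f) \<otimes> p))"
        unfolding kq by simp
      also have "\<dots> = h" by (simp only: id Cod_Obj \<open>f \<in> Arr C\<close>) simp
      finally show "k \<cdot> (\<iota> (Cod C q) \<otimes> p) \<in> hom C (Cod C q \<otimes>\<^sub>o Y) (Cod C h) \<and>
          (k \<cdot> (\<iota> (Cod C q) \<otimes> p)) \<cdot> (q \<otimes> \<iota> Y) = h"
        by (simp add: hom_def)
    next
      fix k' assume "k' \<in> hom C (Cod C q \<otimes>\<^sub>o Y) (Cod C h) \<and> k' \<cdot> (q \<otimes> \<iota> Y) = h"
      then have [simp]: "k' \<in> Arr C" "Dom C k' = Cod C q \<otimes>\<^sub>o Y" "Cod C k' = Cod C h"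
        and k'q: "k' \<cdot> (q \<otimes> \<iota> Y) = h" by (auto simp: hom_def)
      have "(k' \<cdot> (\<iota> (Cod C q) \<otimes> p')) \<cdot> (q \<otimes> \<iota> V) = (k' \<cdot> (q \<otimes> \<iota> Y)) \<cdot> (\<iota> (Cod C f) \<otimes> p')"
        using interchange[of q p'] by simp
      also have "\<dots> = k \<cdot> (q \<otimes> \<iota> V)" by (simp only: k'q kq)
      finally have "k' \<cdot> (\<iota> (Cod C q) \<otimes> p') = k"
        using coequalizer_cancel[OF qV, of "k' \<cdot> (\<iota> (Cod C q) \<otimes> p')" k] by simp
      then show "k' = k \<cdot> (\<iota> (Cod C q) \<otimes> p)" using id by auto
    qed
  qed
  moreover have "(q \<otimes> \<iota> Y) \<cdot> (f \<otimes> \<iota> Y) = (q \<otimes> \<iota> Y) \<cdot> (g \<otimes> \<iota> Y)"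
    using arg_cong[OF q, of "\<lambda>x. x \<otimes> \<iota> Y"] by simp
  ultimately show "is_coequalizer C (f \<otimes> \<iota> Y) (g \<otimes> \<iota> Y) (q \<otimes> \<iota> Y)"
    by (simp add: is_coequalizer_def hom_def)
qed

lemma free_on_left_coflat:
  assumes "free_on Y l W i p" "left_coflat C W"
  shows "left_coflat C Y"
proof -
  note [simp] = free_onD[OF assms(1)]
  show ?thesis
    using free_on_eqs[OF assms(1)]
    by (intro left_coflat_iso[OF left_coflat_tensor[OF coflat_A assms(2)],
          where p = p and p' = "l \<cdot> (\<iota> A \<otimes> i)"]) simp_all
qed

section \<open>Tensor products of bimodules in coordinates\<close>

abbreviation bimodule :: "('o, 'm) bimodule \<Rightarrow> bool" where
  "bimodule M \<equiv> is_bimodule C A m e M"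

abbreviation free_bimod :: "('o, 'm) bimodule \<Rightarrow> 'o \<Rightarrow> 'm \<Rightarrow> 'm \<Rightarrow> bool" where
  "free_bimod N W i p \<equiv> is_bimodule C A m e N \<and> free_on (under N) (lact N) W i p"

abbreviation bq :: "('o, 'm) bimodule \<Rightarrow> ('o, 'm) bimodule \<Rightarrow> 'm" where
  "bq M N \<equiv> bimod_q C coeq M N"

abbreviation btensor :: "('o, 'm) bimodule \<Rightarrow> ('o, 'm) bimodule \<Rightarrow> ('o, 'm) bimodule"
    (infixr \<open>\<odot>\<close> 72) where
  "M \<odot> N \<equiv> bimod_tensor C coeq A M N"

definition coords :: "('o, 'm) bimodule \<Rightarrow> ('o, 'm) bimodule \<Rightarrow> 'o \<Rightarrow> 'm \<Rightarrow> 'm" where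
  "coords M N W p = tensor_coords (under M) (ract M) (under N) (lact N) W p"

lemma bimoduleD:
  assumes "bimodule M"
  shows "left_module C A m e (under M) (lact M)" "right_module C A m e (under M) (ract M)"
    "under M \<in> Obj C" "lact M \<in> Arr C" "Dom C (lact M) = A \<otimes>\<^sub>o under M" "Cod C (lact M) = under M"
    "ract M \<in> Arr C" "Dom C (ract M) = under M \<otimes>\<^sub>o A" "Cod C (ract M) = under M"
  using assms by (auto simp: is_bimodule_def left_module_iff right_module_iff)

lemma bimodule_eqs:
  assumes "bimodule M"
  shows "lact M \<cdot> (m \<otimes> \<iota> (under M)) = lact M \<cdot> (\<iota> A \<otimes> lact M)"
    "lact M \<cdot> (e \<otimes> \<iota> (under M)) = \<iota> (under M)"
    "ract M \<cdot> (\<iota> (under M) \<otimes> m) = ract M \<cdot> (ract M \<otimes> \<iota> A)"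
    "ract M \<cdot> (\<iota> (under M) \<otimes> e) = \<iota> (under M)"
    "ract M \<cdot> (lact M \<otimes> \<iota> A) = lact M \<cdot> (\<iota> A \<otimes> ract M)"
  using assms by (auto simp: is_bimodule_def left_module_iff right_module_iff)

lemma coords_typing:
  assumes M: "bimodule M" and N: "free_bimod N W i p"
  shows "bq M N \<in> Arr C" "Dom C (bq M N) = under M \<otimes>\<^sub>o under N" "Cod C (bq M N) \<in> Obj C"
    "coords M N W p \<in> Arr C" "Dom C (coords M N W p) = Cod C (bq M N)"
    "Cod C (coords M N W p) = under M \<otimes>\<^sub>o W"
  using tensor_q_typing(1,2)[OF bimoduleD(2)[OF M] conjunct2[OF N]]
    tensor_coords_props(1-3)[OF bimoduleD(2)[OF M] conjunct2[OF N]]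
  by (simp_all add: bimod_q_def coords_def)

lemma coords_eqs:
  assumes M: "bimodule M" and N: "free_bimod N W i p"
  shows bq_balanced: "bq M N \<cdot> (ract M \<otimes> \<iota> (under N)) = bq M N \<cdot> (\<iota> (under M) \<otimes> lact N)"
    and coords_q: "coords M N W p \<cdot> bq M N = (ract M \<otimes> \<iota> W) \<cdot> (\<iota> (under M) \<otimes> p)"
    and coords_left_inverse: "bq M N \<cdot> (\<iota> (under M) \<otimes> i) \<cdot> coords M N W p = \<iota> (Cod C (bq M N))"
    and coords_right_inverse: "coords M N W p \<cdot> bq M N \<cdot> (\<iota> (under M) \<otimes> i) = \<iota> (under M \<otimes>\<^sub>o W)"
  using tensor_q_balanced[OF bimoduleD(2)[OF M] conjunct2[OF N]]
    tensor_coords_props(4,5)[OF bimoduleD(2)[OF M] conjunct2[OF N]]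
    tensor_coords_section[OF bimoduleD(2)[OF M] conjunct2[OF N]]
  by (simp_all add: bimod_q_def coords_def)

text \<open>The actions of \<open>M \<otimes>\<^sub>A N\<close> are given as factorizations through \<open>A \<otimes> q\<close> and \<open>q \<otimes> A\<close>. These
  exist because the maps to be factored are balanced, over \<open>A \<otimes> M\<close> and \<open>N\<close> for the left action and
  over \<open>M\<close> and \<open>N \<otimes> A\<close> for the right one, and \<open>N \<otimes> A\<close> is free along with \<open>N\<close>.\<close>
lemma bimod_tensor_actions:
  assumes M: "bimodule M" and N: "free_bimod N W i p"
  shows "under (M \<odot> N) = Cod C (bq M N)"
    "lact (M \<odot> N) \<in> Arr C" "Dom C (lact (M \<odot> N)) = A \<otimes>\<^sub>o Cod C (bq M N)"
    "Cod C (lact (M \<odot> N)) = Cod C (bq M N)"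
    "ract (M \<odot> N) \<in> Arr C" "Dom C (ract (M \<odot> N)) = Cod C (bq M N) \<otimes>\<^sub>o A"
    "Cod C (ract (M \<odot> N)) = Cod C (bq M N)"
    and lact_tensor: "lact (M \<odot> N) \<cdot> (\<iota> A \<otimes> bq M N) = bq M N \<cdot> (lact M \<otimes> \<iota> (under N))"
    and ract_tensor: "ract (M \<odot> N) \<cdot> (bq M N \<otimes> \<iota> A) = bq M N \<cdot> (\<iota> (under M) \<otimes> ract N)"
proof -
  define q where "q = bq M N"
  define \<theta> where "\<theta> = coords M N W p"
  have N': "bimodule N" "free_on (under N) (lact N) W i p" using N by auto
  note [simp] = bimoduleD(3-9)[OF M] bimoduleD(3-9)[OF N'(1)] free_onD(6-11)[OF N'(2)] free_onD(2)[OF N'(2)]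
    coords_typing[OF M N, folded q_def \<theta>_def]
  note eqM = bimodule_eqs[OF M] and eqN = bimodule_eqs[OF N'(1)]
    and \<theta> = coords_eqs[OF M N, folded q_def \<theta>_def]
  let ?s = "(\<iota> (under M) \<otimes> i) \<cdot> \<theta>"
  let ?h = "q \<cdot> (lact M \<otimes> \<iota> (under N))" and ?k = "q \<cdot> (\<iota> (under M) \<otimes> ract N)"
  \<comment> \<open>\<open>?h\<close> is balanced over \<open>A \<otimes> M\<close> and \<open>N\<close>.\<close>
  have "?h \<cdot> ((\<iota> A \<otimes> ract M) \<otimes> \<iota> (under N)) = q \<cdot> ((lact M \<cdot> (\<iota> A \<otimes> ract M)) \<otimes> \<iota> (under N))"
    by simp
  also have "\<dots> = (q \<cdot> (ract M \<otimes> \<iota> (under N))) \<cdot> (lact M \<otimes> \<iota> (A \<otimes>\<^sub>o under N))"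
    by (simp only: eqM(5)[symmetric]) simp
  also have "\<dots> = q \<cdot> (\<iota> (under M) \<otimes> lact N) \<cdot> (lact M \<otimes> \<iota> (A \<otimes>\<^sub>o under N))"
    by (simp only: \<theta>) simp
  also have "\<dots> = ?h \<cdot> (\<iota> (A \<otimes>\<^sub>o under M) \<otimes> lact N)"
    using interchange[of "lact M" "lact N"] by simp
  finally have h: "?h \<cdot> (\<iota> (A \<otimes>\<^sub>o under M) \<otimes> i) \<cdot> ((\<iota> A \<otimes> ract M) \<otimes> \<iota> W) \<cdot> (\<iota> (A \<otimes>\<^sub>o under M) \<otimes> p) = ?h"
    by (intro balanced_factor[OF tensor_right_module[OF bimoduleD(2)[OF M]] N'(2)]) simp_all
  have "(?h \<cdot> (\<iota> A \<otimes> ?s)) \<cdot> (\<iota> A \<otimes> q) = ?h"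
    using arg_cong[OF \<theta>(2), of "\<lambda>x. ?h \<cdot> (\<iota> (A \<otimes>\<^sub>o under M) \<otimes> i) \<cdot> (\<iota> A \<otimes> x)"] h by simp
  moreover have "(\<iota> A \<otimes> q) \<cdot> (\<iota> A \<otimes> ?s) = \<iota> (A \<otimes>\<^sub>o Cod C q)"
    using arg_cong[OF \<theta>(3), of "\<lambda>x. \<iota> A \<otimes> x"] by simp
  ultimately have l: "lact (M \<odot> N) = ?h \<cdot> (\<iota> A \<otimes> ?s)" "(?h \<cdot> (\<iota> A \<otimes> ?s)) \<cdot> (\<iota> A \<otimes> q) = ?h"
    unfolding bimod_tensor_def q_def[symmetric] Let_def
    by (auto intro!: induced_eqI[where s = "\<iota> A \<otimes> ?s"])
  \<comment> \<open>\<open>?k\<close> is balanced over \<open>M\<close> and \<open>N \<otimes> A\<close>.\<close>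
  have "?k \<cdot> (ract M \<otimes> \<iota> (under N \<otimes>\<^sub>o A)) = (q \<cdot> (ract M \<otimes> \<iota> (under N))) \<cdot> (\<iota> (under M \<otimes>\<^sub>o A) \<otimes> ract N)"
    using interchange[of "ract M" "ract N"] by simp
  also have "\<dots> = q \<cdot> (\<iota> (under M) \<otimes> (lact N \<cdot> (\<iota> A \<otimes> ract N)))"
    by (simp only: \<theta>) simp
  also have "\<dots> = ?k \<cdot> (\<iota> (under M) \<otimes> (lact N \<otimes> \<iota> A))"
    by (simp only: eqN(5)[symmetric]) simp
  finally have k: "?k \<cdot> (\<iota> (under M) \<otimes> (i \<otimes> \<iota> A)) \<cdot> (ract M \<otimes> \<iota> (W \<otimes>\<^sub>o A)) \<cdot> (\<iota> (under M) \<otimes> (p \<otimes> \<iota> A)) = ?k"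
    by (intro balanced_factor[OF bimoduleD(2)[OF M] free_on_tensor[OF N'(2), of A]]) simp_all
  have "(?k \<cdot> (?s \<otimes> \<iota> A)) \<cdot> (q \<otimes> \<iota> A) = ?k"
    using arg_cong[OF \<theta>(2), of "\<lambda>x. ?k \<cdot> (\<iota> (under M) \<otimes> (i \<otimes> \<iota> A)) \<cdot> (x \<otimes> \<iota> A)"] k by simp
  moreover have "(q \<otimes> \<iota> A) \<cdot> (?s \<otimes> \<iota> A) = \<iota> (Cod C q \<otimes>\<^sub>o A)"
    using arg_cong[OF \<theta>(3), of "\<lambda>x. x \<otimes> \<iota> A"] by simp
  ultimately have r: "ract (M \<odot> N) = ?k \<cdot> (?s \<otimes> \<iota> A)" "(?k \<cdot> (?s \<otimes> \<iota> A)) \<cdot> (q \<otimes> \<iota> A) = ?k"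
    unfolding bimod_tensor_def q_def[symmetric] Let_def
    by (auto intro!: induced_eqI[where s = "?s \<otimes> \<iota> A"])
  show "under (M \<odot> N) = Cod C (bq M N)" by (simp add: bimod_tensor_def Let_def)
  show "lact (M \<odot> N) \<in> Arr C" "Dom C (lact (M \<odot> N)) = A \<otimes>\<^sub>o Cod C (bq M N)"
    "Cod C (lact (M \<odot> N)) = Cod C (bq M N)"
    "ract (M \<odot> N) \<in> Arr C" "Dom C (ract (M \<odot> N)) = Cod C (bq M N) \<otimes>\<^sub>o A"
    "Cod C (ract (M \<odot> N)) = Cod C (bq M N)"
    unfolding q_def[symmetric] l r by simp_all
  show "lact (M \<odot> N) \<cdot> (\<iota> A \<otimes> bq M N) = bq M N \<cdot> (lact M \<otimes> \<iota> (under N))"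
    "ract (M \<odot> N) \<cdot> (bq M N \<otimes> \<iota> A) = bq M N \<cdot> (\<iota> (under M) \<otimes> ract N)"
    unfolding q_def[symmetric] using l r by simp_all
qed

text \<open>The bimodule axioms are equations between maps out of \<open>A\<close>-whiskerings of \<open>Q\<close>; they may be checked
  after composing with the corresponding whiskering of \<open>q\<close>, where they are those of \<open>B\<close>.\<close>
lemma split_quotient_bimodule:
  assumes B: "bimodule B"
    and q: "q \<in> Arr C" "Dom C q = under B" "Cod C q = under Q"
    and s: "s \<in> Arr C" "Dom C s = under Q" "Cod C s = under B" "q \<cdot> s = \<iota> (under Q)"
    and lr: "lact Q \<in> hom C (A \<otimes>\<^sub>o under Q) (under Q)" "ract Q \<in> hom C (under Q \<otimes>\<^sub>o A) (under Q)"
    and l: "lact Q \<cdot> (\<iota> A \<otimes> q) = q \<cdot> lact B" and r: "ract Q \<cdot> (q \<otimes> \<iota> A) = q \<cdot> ract B"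
  shows "bimodule Q"
proof -
  have [simp]: "under Q \<in> Obj C" using Cod_Obj[OF q(1)] q(3) by simp
  note [simp] = bimoduleD(3-9)[OF B] q s(1-3)
  have [simp]: "lact Q \<in> Arr C" "Dom C (lact Q) = A \<otimes>\<^sub>o under Q" "Cod C (lact Q) = under Q"
    "ract Q \<in> Arr C" "Dom C (ract Q) = under Q \<otimes>\<^sub>o A" "Cod C (ract Q) = under Q"
    using lr by (auto simp: hom_def)
  note eqs = bimodule_eqs[OF B]
  have cancel: "g = h" if "g \<in> Arr C" "h \<in> Arr C" "Dom C g = a \<otimes>\<^sub>o under Q \<otimes>\<^sub>o b"
    "Dom C h = a \<otimes>\<^sub>o under Q \<otimes>\<^sub>o b"
    "g \<cdot> (\<iota> a \<otimes> q \<otimes> \<iota> b) = h \<cdot> (\<iota> a \<otimes> q \<otimes> \<iota> b)" "a \<in> Obj C" "b \<in> Obj C" for g h a b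
    using that arg_cong[OF s(4), of "\<lambda>x. \<iota> a \<otimes> x \<otimes> \<iota> b"]
    by (intro split_epi_cancel[where q = "\<iota> a \<otimes> q \<otimes> \<iota> b" and s = "\<iota> a \<otimes> s \<otimes> \<iota> b" and g = g and h = h]) simp_all
  have "lact Q \<cdot> (m \<otimes> \<iota> (under Q)) = lact Q \<cdot> (\<iota> A \<otimes> lact Q)"
  proof (rule cancel[of _ _ "A \<otimes>\<^sub>o A" \<one>])
    have "(lact Q \<cdot> (m \<otimes> \<iota> (under Q))) \<cdot> (\<iota> (A \<otimes>\<^sub>o A) \<otimes> q) = (lact Q \<cdot> (\<iota> A \<otimes> q)) \<cdot> (m \<otimes> \<iota> (under B))"
      using interchange[of m q] by simp
    also have "\<dots> = q \<cdot> (lact B \<cdot> (m \<otimes> \<iota> (under B)))" by (simp only: l) simp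
    also have "\<dots> = (q \<cdot> lact B) \<cdot> (\<iota> A \<otimes> lact B)" by (simp only: eqs) simp
    also have "\<dots> = lact Q \<cdot> (\<iota> A \<otimes> (q \<cdot> lact B))"
      using arg_cong[OF l, of "\<lambda>x. x \<cdot> (\<iota> A \<otimes> lact B)"] by simp
    also have "\<dots> = (lact Q \<cdot> (\<iota> A \<otimes> lact Q)) \<cdot> (\<iota> (A \<otimes>\<^sub>o A) \<otimes> q)"
      by (simp only: l[symmetric]) simp
    finally show "(lact Q \<cdot> (m \<otimes> \<iota> (under Q))) \<cdot> (\<iota> (A \<otimes>\<^sub>o A) \<otimes> q \<otimes> \<iota> \<one>)
        = (lact Q \<cdot> (\<iota> A \<otimes> lact Q)) \<cdot> (\<iota> (A \<otimes>\<^sub>o A) \<otimes> q \<otimes> \<iota> \<one>)" by simp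
  qed simp_all
  moreover have "lact Q \<cdot> (e \<otimes> \<iota> (under Q)) = \<iota> (under Q)"
  proof (rule cancel[of _ _ \<one> \<one>])
    have "(lact Q \<cdot> (e \<otimes> \<iota> (under Q))) \<cdot> q = (lact Q \<cdot> (\<iota> A \<otimes> q)) \<cdot> (e \<otimes> \<iota> (under B))"
      using interchange[of e q] by simp
    also have "\<dots> = q \<cdot> (lact B \<cdot> (e \<otimes> \<iota> (under B)))" by (simp only: l) simp
    finally show "(lact Q \<cdot> (e \<otimes> \<iota> (under Q))) \<cdot> (\<iota> \<one> \<otimes> q \<otimes> \<iota> \<one>) = \<iota> (under Q) \<cdot> (\<iota> \<one> \<otimes> q \<otimes> \<iota> \<one>)"
      by (simp add: eqs)
  qed simp_all
  moreover have "ract Q \<cdot> (\<iota> (under Q) \<otimes> m) = ract Q \<cdot> (ract Q \<otimes> \<iota> A)"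
  proof (rule cancel[of _ _ \<one> "A \<otimes>\<^sub>o A"])
    have "(ract Q \<cdot> (\<iota> (under Q) \<otimes> m)) \<cdot> (q \<otimes> \<iota> (A \<otimes>\<^sub>o A)) = (ract Q \<cdot> (q \<otimes> \<iota> A)) \<cdot> (\<iota> (under B) \<otimes> m)"
      using interchange[of q m] by simp
    also have "\<dots> = q \<cdot> (ract B \<cdot> (\<iota> (under B) \<otimes> m))" by (simp only: r) simp
    also have "\<dots> = (q \<cdot> ract B) \<cdot> (ract B \<otimes> \<iota> A)" by (simp only: eqs) simp
    also have "\<dots> = ract Q \<cdot> ((q \<cdot> ract B) \<otimes> \<iota> A)"
      using arg_cong[OF r, of "\<lambda>x. x \<cdot> (ract B \<otimes> \<iota> A)"] by simp
    also have "\<dots> = (ract Q \<cdot> (ract Q \<otimes> \<iota> A)) \<cdot> (q \<otimes> \<iota> (A \<otimes>\<^sub>o A))"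
      by (simp only: r[symmetric]) simp
    finally show "(ract Q \<cdot> (\<iota> (under Q) \<otimes> m)) \<cdot> (\<iota> \<one> \<otimes> q \<otimes> \<iota> (A \<otimes>\<^sub>o A))
        = (ract Q \<cdot> (ract Q \<otimes> \<iota> A)) \<cdot> (\<iota> \<one> \<otimes> q \<otimes> \<iota> (A \<otimes>\<^sub>o A))" by simp
  qed simp_all
  moreover have "ract Q \<cdot> (\<iota> (under Q) \<otimes> e) = \<iota> (under Q)"
  proof (rule cancel[of _ _ \<one> \<one>])
    have "(ract Q \<cdot> (\<iota> (under Q) \<otimes> e)) \<cdot> q = (ract Q \<cdot> (q \<otimes> \<iota> A)) \<cdot> (\<iota> (under B) \<otimes> e)"
      using interchange[of q e] by simp
    also have "\<dots> = q \<cdot> (ract B \<cdot> (\<iota> (under B) \<otimes> e))" by (simp only: r) simp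
    finally show "(ract Q \<cdot> (\<iota> (under Q) \<otimes> e)) \<cdot> (\<iota> \<one> \<otimes> q \<otimes> \<iota> \<one>) = \<iota> (under Q) \<cdot> (\<iota> \<one> \<otimes> q \<otimes> \<iota> \<one>)"
      by (simp add: eqs)
  qed simp_all
  moreover have "ract Q \<cdot> (lact Q \<otimes> \<iota> A) = lact Q \<cdot> (\<iota> A \<otimes> ract Q)"
  proof (rule cancel[of _ _ A A])
    have "(ract Q \<cdot> (lact Q \<otimes> \<iota> A)) \<cdot> (\<iota> A \<otimes> q \<otimes> \<iota> A) = ract Q \<cdot> ((lact Q \<cdot> (\<iota> A \<otimes> q)) \<otimes> \<iota> A)"
      by simp
    also have "\<dots> = (ract Q \<cdot> (q \<otimes> \<iota> A)) \<cdot> (lact B \<otimes> \<iota> A)" by (simp only: l) simp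
    also have "\<dots> = q \<cdot> (ract B \<cdot> (lact B \<otimes> \<iota> A))" by (simp only: r) simp
    also have "\<dots> = (q \<cdot> lact B) \<cdot> (\<iota> A \<otimes> ract B)" by (simp only: eqs) simp
    also have "\<dots> = lact Q \<cdot> (\<iota> A \<otimes> (q \<cdot> ract B))" by (simp only: l[symmetric]) simp
    also have "\<dots> = (lact Q \<cdot> (\<iota> A \<otimes> ract Q)) \<cdot> (\<iota> A \<otimes> q \<otimes> \<iota> A)"
      by (simp only: r[symmetric]) simp
    finally show "(ract Q \<cdot> (lact Q \<otimes> \<iota> A)) \<cdot> (\<iota> A \<otimes> q \<otimes> \<iota> A) = (lact Q \<cdot> (\<iota> A \<otimes> ract Q)) \<cdot> (\<iota> A \<otimes> q \<otimes> \<iota> A)" .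
  qed simp_all
  ultimately show ?thesis by (simp add: is_bimodule_def left_module_iff right_module_iff)
qed

text \<open>The bimodule \<open>M \<otimes> N\<close>, of which \<open>M \<otimes>\<^sub>A N\<close> is a split quotient.\<close>
lemma tensor_over_One_bimodule:
  assumes M: "bimodule M" and N: "bimodule N"
  shows "bimodule (Bimodule (under M \<otimes>\<^sub>o under N) (lact M \<otimes> \<iota> (under N)) (\<iota> (under M) \<otimes> ract N))"
proof -
  note [simp] = bimoduleD(3-9)[OF M] bimoduleD(3-9)[OF N]
  show ?thesis
    using tensor_left_module[OF bimoduleD(1)[OF M], of "under N"]
      tensor_right_module[OF bimoduleD(2)[OF N], of "under M"]
      interchange[of "lact M" "ract N"]
    by (simp add: is_bimodule_def)
qed

lemma bimod_tensor_bimodule: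
  assumes M: "bimodule M" and N: "free_bimod N W i p"
  shows "bimodule (M \<odot> N)"
proof -
  have N': "bimodule N" "free_on (under N) (lact N) W i p" using N by auto
  note [simp] = bimoduleD(3-9)[OF M] bimoduleD(3-9)[OF N'(1)] free_onD(6-11)[OF N'(2)] free_onD(2)[OF N'(2)]
    coords_typing[OF M N] bimod_tensor_actions(1-7)[OF M N]
  show ?thesis
    by (rule split_quotient_bimodule[OF tensor_over_One_bimodule[OF M N'(1)],
          where q = "bq M N" and s = "(\<iota> (under M) \<otimes> i) \<cdot> coords M N W p"])
      (simp_all add: hom_def coords_left_inverse[OF M N] lact_tensor[OF M N] ract_tensor[OF M N])
qed

text \<open>The isomorphism \<open>M \<otimes>\<^sub>A N \<rightarrow> M \<otimes> W\<close> is left linear for the action on the factor \<open>M\<close>, as the two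
  actions of \<open>M\<close> commute.\<close>
lemma coords_lact:
  assumes M: "bimodule M" and N: "free_bimod N W i p"
  shows "coords M N W p \<cdot> lact (M \<odot> N) = (lact M \<otimes> \<iota> W) \<cdot> (\<iota> A \<otimes> coords M N W p)"
proof -
  have N': "bimodule N" "free_on (under N) (lact N) W i p" using N by auto
  define q where "q = bq M N"
  define \<theta> where "\<theta> = coords M N W p"
  note [simp] = bimoduleD(3-9)[OF M] bimoduleD(3-9)[OF N'(1)] free_onD(6-11)[OF N'(2)] free_onD(2)[OF N'(2)]
    coords_typing[OF M N, folded q_def \<theta>_def] bimod_tensor_actions(1-7)[OF M N, folded q_def]
  note \<theta> = coords_eqs[OF M N, folded q_def \<theta>_def]
  have "\<theta> \<cdot> (lact (M \<odot> N) \<cdot> (\<iota> A \<otimes> q)) = (\<theta> \<cdot> q) \<cdot> (lact M \<otimes> \<iota> (under N))"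
    by (simp only: lact_tensor[OF M N, folded q_def]) simp
  also have "\<dots> = (ract M \<otimes> \<iota> W) \<cdot> (lact M \<otimes> \<iota> (A \<otimes>\<^sub>o W)) \<cdot> (\<iota> (A \<otimes>\<^sub>o under M) \<otimes> p)"
    using interchange[of "lact M" p] by (simp only: \<theta>) simp
  also have "\<dots> = ((ract M \<cdot> (lact M \<otimes> \<iota> A)) \<otimes> \<iota> W) \<cdot> (\<iota> (A \<otimes>\<^sub>o under M) \<otimes> p)"
    by simp
  also have "\<dots> = (lact M \<otimes> \<iota> W) \<cdot> (\<iota> A \<otimes> ((ract M \<otimes> \<iota> W) \<cdot> (\<iota> (under M) \<otimes> p)))"
    by (simp only: bimodule_eqs[OF M]) simp
  also have "\<dots> = (lact M \<otimes> \<iota> W) \<cdot> (\<iota> A \<otimes> (\<theta> \<cdot> q))"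
    by (simp only: \<theta>)
  finally have eq: "\<theta> \<cdot> (lact (M \<odot> N) \<cdot> (\<iota> A \<otimes> q)) = (lact M \<otimes> \<iota> W) \<cdot> (\<iota> A \<otimes> (\<theta> \<cdot> q))" .
  have "\<theta> \<cdot> lact (M \<odot> N) = (lact M \<otimes> \<iota> W) \<cdot> (\<iota> A \<otimes> \<theta>)"
    by (rule split_epi_cancel[where q = "\<iota> A \<otimes> q" and s = "\<iota> A \<otimes> ((\<iota> (under M) \<otimes> i) \<cdot> \<theta>)"];
        use eq arg_cong[OF \<theta>(3), of "\<lambda>x. \<iota> A \<otimes> x"] in simp)
  then show ?thesis by (simp add: \<theta>_def)
qed

text \<open>The right action on \<open>M \<otimes> W\<close> moves the scalar past \<open>W\<close> by the right action of \<open>N\<close> on generators,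
  and then into \<open>M\<close>.\<close>
lemma coords_ract:
  assumes M: "bimodule M" and N: "free_bimod N W i p"
  shows "coords M N W p \<cdot> ract (M \<odot> N)
    = (ract M \<otimes> \<iota> W) \<cdot> (\<iota> (under M) \<otimes> (p \<cdot> ract N \<cdot> (i \<otimes> \<iota> A))) \<cdot> (coords M N W p \<otimes> \<iota> A)"
proof -
  have N': "bimodule N" "free_on (under N) (lact N) W i p" using N by auto
  define q where "q = bq M N"
  define \<theta> where "\<theta> = coords M N W p"
  note [simp] = bimoduleD(3-9)[OF M] bimoduleD(3-9)[OF N'(1)] free_onD(6-11)[OF N'(2)] free_onD(2)[OF N'(2)]
    coords_typing[OF M N, folded q_def \<theta>_def] bimod_tensor_actions(1-7)[OF M N, folded q_def]
  note \<theta> = coords_eqs[OF M N, folded q_def \<theta>_def]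
  have "\<theta> \<cdot> ract (M \<odot> N) = \<theta> \<cdot> ract (M \<odot> N) \<cdot> ((q \<cdot> (\<iota> (under M) \<otimes> i) \<cdot> \<theta>) \<otimes> \<iota> A)"
    by (simp only: \<theta>) simp
  also have "\<dots> = \<theta> \<cdot> (ract (M \<odot> N) \<cdot> (q \<otimes> \<iota> A)) \<cdot> (\<iota> (under M) \<otimes> i \<otimes> \<iota> A) \<cdot> (\<theta> \<otimes> \<iota> A)"
    by simp
  also have "\<dots> = (\<theta> \<cdot> q) \<cdot> (\<iota> (under M) \<otimes> (ract N \<cdot> (i \<otimes> \<iota> A))) \<cdot> (\<theta> \<otimes> \<iota> A)"
    by (simp only: ract_tensor[OF M N, folded q_def]) simp
  also have "\<dots> = (ract M \<otimes> \<iota> W) \<cdot> (\<iota> (under M) \<otimes> (p \<cdot> ract N \<cdot> (i \<otimes> \<iota> A))) \<cdot> (\<theta> \<otimes> \<iota> A)"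
    by (simp only: \<theta>) simp
  finally show ?thesis by (simp only: \<theta>_def)
qed

text \<open>As \<open>M \<otimes>\<^sub>A N\<close> is \<open>M \<otimes> W\<close> as a left module, it is free on \<open>V \<otimes> W\<close> if \<open>M\<close> is free on \<open>V\<close>.\<close>
lemma free_bimod_tensor:
  assumes M: "free_bimod M V j s" and N: "free_bimod N W i p"
  shows "free_bimod (M \<odot> N) (V \<otimes>\<^sub>o W) (bq M N \<cdot> (j \<otimes> i)) ((s \<otimes> \<iota> W) \<cdot> coords M N W p)"
proof
  have M': "bimodule M" "free_on (under M) (lact M) V j s" using M by auto
  have N': "bimodule N" "free_on (under N) (lact N) W i p" using N by auto
  show bim: "bimodule (M \<odot> N)" by (rule bimod_tensor_bimodule[OF M'(1) N])
  define q where "q = bq M N"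
  define \<theta> where "\<theta> = coords M N W p"
  note [simp] = bimoduleD(3-9)[OF M'(1)] bimoduleD(3-9)[OF N'(1)] free_onD(6-11)[OF N'(2)] free_onD(2)[OF N'(2)]
    free_onD(6-11)[OF M'(2)] free_onD(2)[OF M'(2)]
    coords_typing[OF M'(1) N, folded q_def \<theta>_def] bimod_tensor_actions(1-7)[OF M'(1) N, folded q_def]
  note \<theta> = coords_eqs[OF M'(1) N, folded q_def \<theta>_def]
  note \<theta>l = coords_lact[OF M'(1) N, folded q_def \<theta>_def]
  have \<theta>i: "\<theta> \<cdot> q \<cdot> (j \<otimes> i) = j \<otimes> \<iota> W"
    using arg_cong[OF \<theta>(4), of "\<lambda>x. x \<cdot> (j \<otimes> \<iota> W)"] tens_left_first[of j i] by simp
  have "((s \<otimes> \<iota> W) \<cdot> \<theta>) \<cdot> lact (M \<odot> N) \<cdot> (\<iota> A \<otimes> (q \<cdot> (j \<otimes> i)))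
      = (s \<otimes> \<iota> W) \<cdot> (\<theta> \<cdot> lact (M \<odot> N)) \<cdot> (\<iota> A \<otimes> (q \<cdot> (j \<otimes> i)))"
    by simp
  also have "\<dots> = (s \<otimes> \<iota> W) \<cdot> (lact M \<otimes> \<iota> W) \<cdot> (\<iota> A \<otimes> (\<theta> \<cdot> q \<cdot> (j \<otimes> i)))"
    by (simp only: \<theta>l) simp
  also have "\<dots> = (s \<cdot> lact M \<cdot> (\<iota> A \<otimes> j)) \<otimes> \<iota> W"
    by (simp only: \<theta>i) simp
  also have "\<dots> = \<iota> (A \<otimes>\<^sub>o V \<otimes>\<^sub>o W)"
    by (simp only: free_on_eqs[OF M'(2)]) simp
  finally have 1: "((s \<otimes> \<iota> W) \<cdot> \<theta>) \<cdot> lact (M \<odot> N) \<cdot> (\<iota> A \<otimes> (q \<cdot> (j \<otimes> i))) = \<iota> (A \<otimes>\<^sub>o V \<otimes>\<^sub>o W)" .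
  have "\<theta> \<cdot> lact (M \<odot> N) \<cdot> (\<iota> A \<otimes> (q \<cdot> (j \<otimes> i))) \<cdot> (s \<otimes> \<iota> W) \<cdot> \<theta>
      = (\<theta> \<cdot> lact (M \<odot> N)) \<cdot> (\<iota> A \<otimes> (q \<cdot> (j \<otimes> i))) \<cdot> (s \<otimes> \<iota> W) \<cdot> \<theta>"
    by simp
  also have "\<dots> = (lact M \<otimes> \<iota> W) \<cdot> (\<iota> A \<otimes> (\<theta> \<cdot> q \<cdot> (j \<otimes> i))) \<cdot> (s \<otimes> \<iota> W) \<cdot> \<theta>"
    by (simp only: \<theta>l) simp
  also have "\<dots> = ((lact M \<cdot> (\<iota> A \<otimes> j) \<cdot> s) \<otimes> \<iota> W) \<cdot> \<theta>"
    by (simp only: \<theta>i) simp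
  also have "\<dots> = \<theta>"
    by (simp only: free_on_eqs[OF M'(2)]) simp
  finally have 2: "\<theta> \<cdot> lact (M \<odot> N) \<cdot> (\<iota> A \<otimes> (q \<cdot> (j \<otimes> i))) \<cdot> (s \<otimes> \<iota> W) \<cdot> \<theta> = \<theta>" .
  have 3: "lact (M \<odot> N) \<cdot> (\<iota> A \<otimes> (q \<cdot> (j \<otimes> i))) \<cdot> (s \<otimes> \<iota> W) \<cdot> \<theta> = \<iota> (Cod C q)"
    by (rule split_mono_cancel[where t = \<theta> and s = "q \<cdot> (\<iota> (under M) \<otimes> i)"])
       (use 2 \<theta> in simp_all)
  show "free_on (under (M \<odot> N)) (lact (M \<odot> N)) (V \<otimes>\<^sub>o W) (bq M N \<cdot> (j \<otimes> i)) ((s \<otimes> \<iota> W) \<cdot> coords M N W p)"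
    using 1 3 bimoduleD(1)[OF bim]
    unfolding free_on_def q_def[symmetric] \<theta>_def[symmetric] by (simp add: hom_def)
qed

text \<open>Evaluate on a generator \<open>w\<close> of the source of \<open>g\<close>: the coefficient of \<open>g w\<close> is moved to the left factor
  by the right action, which may happen before or after applying the right linear \<open>f\<close>.\<close>
lemma bimod_tensor_arr_coords:
  assumes f: "is_bimod_arr C A f" and g: "is_bimod_arr C A g"
    and M: "bimodule (src f)" "bimodule (tgt f)"
    and N: "free_bimod (src g) W i p" "free_bimod (tgt g) W' i' p'"
  shows "mor (bimod_tensor_arr C coeq A f g) \<in> hom C (Cod C (bq (src f) (src g))) (Cod C (bq (tgt f) (tgt g)))"
    and "coords (tgt f) (tgt g) W' p' \<cdot> mor (bimod_tensor_arr C coeq A f g)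
      = (mor f \<otimes> \<iota> W') \<cdot> (ract (src f) \<otimes> \<iota> W') \<cdot> (\<iota> (under (src f)) \<otimes> (p' \<cdot> mor g \<cdot> i)) \<cdot> coords (src f) (src g) W p"
proof -
  obtain M M' F N N' G where fg: "f = Bimod_Arr M F M'" "g = Bimod_Arr N G N'"
    by (metis bimod_arr.exhaust)
  have M: "bimodule M" "bimodule M'" using M by (auto simp: fg)
  have N: "free_bimod N W i p" "free_bimod N' W' i' p'" using N by (auto simp: fg)
  define q where "q = bq M N"
  define \<theta> where "\<theta> = coords M N W p"
  define q' where "q' = bq M' N'"
  define \<theta>' where "\<theta>' = coords M' N' W' p'"
  note N1 = conjunct1[OF N(1)] conjunct2[OF N(1)] and N2 = conjunct1[OF N(2)] conjunct2[OF N(2)]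
  note [simp] = bimoduleD(3-9)[OF M(1)] bimoduleD(3-9)[OF M(2)]
    bimoduleD(3-9)[OF N1(1)] free_onD(6-11)[OF N1(2)] free_onD(2)[OF N1(2)]
    bimoduleD(3-9)[OF N2(1)] free_onD(6-11)[OF N2(2)] free_onD(2)[OF N2(2)]
    coords_typing[OF M(1) N(1), folded q_def \<theta>_def] coords_typing[OF M(2) N(2), folded q'_def \<theta>'_def]
  note \<theta> = coords_eqs[OF M(1) N(1), folded q_def \<theta>_def]
  note \<theta>' = coords_eqs[OF M(2) N(2), folded q'_def \<theta>'_def]
  have [simp]: "F \<in> Arr C" "Dom C F = under M" "Cod C F = under M'"
    "G \<in> Arr C" "Dom C G = under N" "Cod C G = under N'"
    and F: "F \<cdot> ract M = ract M' \<cdot> (F \<otimes> \<iota> A)" and G: "G \<cdot> lact N = lact N' \<cdot> (\<iota> A \<otimes> G)"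
    using f g by (auto simp: is_bimod_arr_def hom_def fg)
  let ?h = "q' \<cdot> (F \<otimes> \<iota> (under N')) \<cdot> (\<iota> (under M) \<otimes> G)"
  have "?h \<cdot> (ract M \<otimes> \<iota> (under N))
      = q' \<cdot> ((F \<cdot> ract M) \<otimes> \<iota> (under N')) \<cdot> (\<iota> (under M \<otimes>\<^sub>o A) \<otimes> G)"
    using interchange[of "ract M" G] by simp
  also have "\<dots> = (q' \<cdot> (ract M' \<otimes> \<iota> (under N'))) \<cdot> (F \<otimes> \<iota> (A \<otimes>\<^sub>o under N')) \<cdot> (\<iota> (under M \<otimes>\<^sub>o A) \<otimes> G)"
    by (simp only: F) simp
  also have "\<dots> = q' \<cdot> (\<iota> (under M') \<otimes> lact N') \<cdot> (F \<otimes> \<iota> (A \<otimes>\<^sub>o under N')) \<cdot> (\<iota> (under M \<otimes>\<^sub>o A) \<otimes> G)"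
    by (simp only: \<theta>') simp
  also have "\<dots> = q' \<cdot> ((\<iota> (under M') \<otimes> lact N') \<cdot> (F \<otimes> \<iota> (A \<otimes>\<^sub>o under N'))) \<cdot> (\<iota> (under M \<otimes>\<^sub>o A) \<otimes> G)"
    by simp
  also have "(\<iota> (under M') \<otimes> lact N') \<cdot> (F \<otimes> \<iota> (A \<otimes>\<^sub>o under N')) = (F \<otimes> \<iota> (under N')) \<cdot> (\<iota> (under M) \<otimes> lact N')"
    using interchange[of F "lact N'"] by simp
  also have "q' \<cdot> ((F \<otimes> \<iota> (under N')) \<cdot> (\<iota> (under M) \<otimes> lact N')) \<cdot> (\<iota> (under M \<otimes>\<^sub>o A) \<otimes> G)
      = q' \<cdot> (F \<otimes> \<iota> (under N')) \<cdot> (\<iota> (under M) \<otimes> (lact N' \<cdot> (\<iota> A \<otimes> G)))"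
    by simp
  also have "\<dots> = ?h \<cdot> (\<iota> (under M) \<otimes> lact N)"
    by (simp only: G[symmetric]) simp
  finally have "?h \<cdot> (ract M \<otimes> \<iota> (under N)) = ?h \<cdot> (\<iota> (under M) \<otimes> lact N)" .
  then have h: "?h \<cdot> (\<iota> (under M) \<otimes> i) \<cdot> (ract M \<otimes> \<iota> W) \<cdot> (\<iota> (under M) \<otimes> p) = ?h"
    by (intro balanced_factor[OF bimoduleD(2)[OF M(1)] N1(2)]) simp_all
  have fg_h: "q' \<cdot> (F \<otimes> G) = ?h" using tens_right_first[of F G] by simp
  let ?k = "?h \<cdot> (\<iota> (under M) \<otimes> i) \<cdot> \<theta>"
  have "?k \<cdot> q = ?h"
    using h arg_cong[OF \<theta>(2), of "\<lambda>x. ?h \<cdot> (\<iota> (under M) \<otimes> i) \<cdot> x"] by simp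
  then have mor: "mor (bimod_tensor_arr C coeq A f g) = ?k"
    using \<theta>(3) unfolding bimod_tensor_arr_def fg bimod_arr.sel q_def[symmetric] q'_def[symmetric] fg_h
    by (intro induced_eqI[where s = "(\<iota> (under M) \<otimes> i) \<cdot> \<theta>"]) simp_all
  show "mor (bimod_tensor_arr C coeq A f g) \<in> hom C (Cod C (bq (src f) (src g))) (Cod C (bq (tgt f) (tgt g)))"
    unfolding mor unfolding fg bimod_arr.sel q_def[symmetric] q'_def[symmetric] by (simp add: hom_def)
  have "\<theta>' \<cdot> ?k = (\<theta>' \<cdot> q') \<cdot> (F \<otimes> \<iota> (under N')) \<cdot> (\<iota> (under M) \<otimes> (G \<cdot> i)) \<cdot> \<theta>"
    by simp
  also have "\<dots> = (ract M' \<otimes> \<iota> W') \<cdot> ((\<iota> (under M') \<otimes> p') \<cdot> (F \<otimes> \<iota> (under N'))) \<cdot> (\<iota> (under M) \<otimes> (G \<cdot> i)) \<cdot> \<theta>"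
    by (simp only: \<theta>') simp
  also have "(\<iota> (under M') \<otimes> p') \<cdot> (F \<otimes> \<iota> (under N')) = (F \<otimes> \<iota> (A \<otimes>\<^sub>o W')) \<cdot> (\<iota> (under M) \<otimes> p')"
    using interchange[of F p'] by simp
  also have "(ract M' \<otimes> \<iota> W') \<cdot> ((F \<otimes> \<iota> (A \<otimes>\<^sub>o W')) \<cdot> (\<iota> (under M) \<otimes> p')) \<cdot> (\<iota> (under M) \<otimes> (G \<cdot> i)) \<cdot> \<theta>
     = ((ract M' \<cdot> (F \<otimes> \<iota> A)) \<otimes> \<iota> W') \<cdot> (\<iota> (under M) \<otimes> (p' \<cdot> G \<cdot> i)) \<cdot> \<theta>"
    by simp
  also have "\<dots> = (F \<otimes> \<iota> W') \<cdot> (ract M \<otimes> \<iota> W') \<cdot> (\<iota> (under M) \<otimes> (p' \<cdot> G \<cdot> i)) \<cdot> \<theta>"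
    by (simp only: F[symmetric]) simp
  finally show "coords (tgt f) (tgt g) W' p' \<cdot> mor (bimod_tensor_arr C coeq A f g)
      = (mor f \<otimes> \<iota> W') \<cdot> (ract (src f) \<otimes> \<iota> W') \<cdot> (\<iota> (under (src f)) \<otimes> (p' \<cdot> mor g \<cdot> i)) \<cdot> coords (src f) (src g) W p"
    unfolding mor by (simp add: fg \<theta>_def \<theta>'_def)
qed

text \<open>Both triple tensor products have coordinates in \<open>M \<otimes> V \<otimes> W\<close>, and the associator is the identity
  there: on \<open>M \<otimes> N \<otimes> P\<close> either bracketing moves the coefficients from \<open>P\<close> through \<open>N\<close> to \<open>M\<close>.\<close>
lemma bimod_assoc_coords:
  assumes M: "bimodule M" and N: "free_bimod N V j s" and P: "free_bimod P W i p"
  shows "mor (bimod_assoc C coeq A M N P) \<in> hom C (Cod C (bq (M \<odot> N) P)) (Cod C (bq M (N \<odot> P)))"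
    and "coords M (N \<odot> P) (V \<otimes>\<^sub>o W) ((s \<otimes> \<iota> W) \<cdot> coords N P W p) \<cdot> mor (bimod_assoc C coeq A M N P)
      = (coords M N V s \<otimes> \<iota> W) \<cdot> coords (M \<odot> N) P W p"
proof -
  note N' = conjunct1[OF N] conjunct2[OF N] and P' = conjunct1[OF P] conjunct2[OF P]
  note MN = bimod_tensor_bimodule[OF M N] and NP = free_bimod_tensor[OF N P]
  define q where "q = bq M N"
  define \<theta> where "\<theta> = coords M N V s"
  define q' where "q' = bq N P"
  define \<theta>' where "\<theta>' = coords N P W p"
  define l where "l = bq (M \<odot> N) P"
  define \<kappa> where "\<kappa> = coords (M \<odot> N) P W p"
  define r where "r = bq M (N \<odot> P)"
  define \<rho> where "\<rho> = coords M (N \<odot> P) (V \<otimes>\<^sub>o W) ((s \<otimes> \<iota> W) \<cdot> \<theta>')"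
  let ?j = "q' \<cdot> (j \<otimes> i)" and ?s = "(s \<otimes> \<iota> W) \<cdot> \<theta>'"
  note [simp] = bimoduleD(3-9)[OF M]
    bimoduleD(3-9)[OF N'(1)] free_onD(6-11)[OF N'(2)] free_onD(2)[OF N'(2)]
    bimoduleD(3-9)[OF P'(1)] free_onD(6-11)[OF P'(2)] free_onD(2)[OF P'(2)]
    coords_typing[OF M N, folded q_def \<theta>_def] bimod_tensor_actions(1-7)[OF M N, folded q_def]
    coords_typing[OF N'(1) P, folded q'_def \<theta>'_def] bimod_tensor_actions(1-7)[OF N'(1) P, folded q'_def]
    coords_typing[OF MN P, folded l_def \<kappa>_def]
    coords_typing[OF M NP, folded q'_def \<theta>'_def, folded r_def \<rho>_def]
  note \<theta> = coords_eqs[OF M N, folded q_def \<theta>_def]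
  note \<theta>' = coords_eqs[OF N'(1) P, folded q'_def \<theta>'_def]
  note ks = coords_eqs[OF MN P, folded l_def \<kappa>_def]
  note \<rho> = coords_eqs[OF M NP, folded q'_def \<theta>'_def, folded r_def \<rho>_def]
  \<comment> \<open>\<open>?K\<close> is the inverse of \<open>\<rho>\<close>, and \<open>?k\<close> the associator read in coordinates.\<close>
  let ?K = "r \<cdot> (\<iota> (under M) \<otimes> ?j)"
  let ?k = "?K \<cdot> (\<theta> \<otimes> \<iota> W) \<cdot> \<kappa>"
  have K: "\<rho> \<cdot> ?K = \<iota> (under M \<otimes>\<^sub>o V \<otimes>\<^sub>o W)" "?K \<cdot> \<rho> = \<iota> (Cod C r)"
    using \<rho> by simp_all
  have "((\<theta> \<otimes> \<iota> W) \<cdot> \<kappa>) \<cdot> l \<cdot> (q \<otimes> \<iota> (under P))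
      = (\<theta> \<otimes> \<iota> W) \<cdot> (\<kappa> \<cdot> l) \<cdot> (q \<otimes> \<iota> (under P))" by simp
  also have "\<dots> = (\<theta> \<otimes> \<iota> W) \<cdot> (ract (M \<odot> N) \<otimes> \<iota> W) \<cdot> ((\<iota> (Cod C q) \<otimes> p) \<cdot> (q \<otimes> \<iota> (under P)))"
    by (simp only: ks) simp
  also have "(\<iota> (Cod C q) \<otimes> p) \<cdot> (q \<otimes> \<iota> (under P)) = (q \<otimes> \<iota> (A \<otimes>\<^sub>o W)) \<cdot> (\<iota> (under M \<otimes>\<^sub>o under N) \<otimes> p)"
    using interchange[of q p] by simp
  also have "(\<theta> \<otimes> \<iota> W) \<cdot> (ract (M \<odot> N) \<otimes> \<iota> W) \<cdot> \<dots>
     = (\<theta> \<otimes> \<iota> W) \<cdot> ((ract (M \<odot> N) \<cdot> (q \<otimes> \<iota> A)) \<otimes> \<iota> W) \<cdot> (\<iota> (under M \<otimes>\<^sub>o under N) \<otimes> p)"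
    by simp
  also have "\<dots> = ((\<theta> \<cdot> q) \<otimes> \<iota> W) \<cdot> (\<iota> (under M) \<otimes> ract N \<otimes> \<iota> W) \<cdot> (\<iota> (under M \<otimes>\<^sub>o under N) \<otimes> p)"
    by (simp only: ract_tensor[OF M N, folded q_def]) simp
  also have "\<dots> = (ract M \<otimes> \<iota> (V \<otimes>\<^sub>o W)) \<cdot> (\<iota> (under M) \<otimes> ((s \<otimes> \<iota> W) \<cdot> (ract N \<otimes> \<iota> W) \<cdot> (\<iota> (under N) \<otimes> p)))"
    by (simp only: \<theta>) simp
  also have "\<dots> = (ract M \<otimes> \<iota> (V \<otimes>\<^sub>o W)) \<cdot> (\<iota> (under M) \<otimes> ((s \<otimes> \<iota> W) \<cdot> (\<theta>' \<cdot> q')))"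
    by (simp only: \<theta>')
  also have "\<dots> = (\<rho> \<cdot> r) \<cdot> (\<iota> (under M) \<otimes> q')"
    by (simp only: \<rho>) simp
  finally have eq: "((\<theta> \<otimes> \<iota> W) \<cdot> \<kappa>) \<cdot> l \<cdot> (q \<otimes> \<iota> (under P)) = (\<rho> \<cdot> r) \<cdot> (\<iota> (under M) \<otimes> q')" .
  have "?k \<cdot> l \<cdot> (q \<otimes> \<iota> (under P)) = ?K \<cdot> (((\<theta> \<otimes> \<iota> W) \<cdot> \<kappa>) \<cdot> l \<cdot> (q \<otimes> \<iota> (under P)))"
    by simp
  also have "\<dots> = (?K \<cdot> \<rho>) \<cdot> r \<cdot> (\<iota> (under M) \<otimes> q')"
    by (simp only: eq) simp
  also have "\<dots> = r \<cdot> (\<iota> (under M) \<otimes> q')"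
    by (simp only: K) simp
  finally have kl: "?k \<cdot> l \<cdot> (q \<otimes> \<iota> (under P)) = r \<cdot> (\<iota> (under M) \<otimes> q')" .
  \<comment> \<open>The projection from \<open>M \<otimes> N \<otimes> P\<close> is split, so the factorization defining the associator is unique.\<close>
  have "(l \<cdot> (q \<otimes> \<iota> (under P))) \<cdot> (((\<iota> (under M) \<otimes> j) \<cdot> \<theta>) \<otimes> \<iota> (under P)) \<cdot> (\<iota> (Cod C q) \<otimes> i) \<cdot> \<kappa>
    = l \<cdot> ((q \<cdot> (\<iota> (under M) \<otimes> j) \<cdot> \<theta>) \<otimes> \<iota> (under P)) \<cdot> (\<iota> (Cod C q) \<otimes> i) \<cdot> \<kappa>"
    by simp
  also have "\<dots> = \<iota> (Cod C l)"
    using ks(3) by (simp only: \<theta>) simp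
  finally have "mor (bimod_assoc C coeq A M N P) = ?k"
    using kl unfolding bimod_assoc_def Let_def bimod_arr.sel q_def[symmetric] q'_def[symmetric]
      l_def[symmetric] r_def[symmetric]
    by (intro induced_eqI[where s = "(((\<iota> (under M) \<otimes> j) \<cdot> \<theta>) \<otimes> \<iota> (under P)) \<cdot> (\<iota> (Cod C q) \<otimes> i) \<cdot> \<kappa>"])
      simp_all
  moreover have "?k \<in> hom C (Cod C l) (Cod C r)" by (simp add: hom_def)
  moreover have "\<rho> \<cdot> ?k = (\<rho> \<cdot> ?K) \<cdot> (\<theta> \<otimes> \<iota> W) \<cdot> \<kappa>" by simp
  then have "\<rho> \<cdot> ?k = (\<theta> \<otimes> \<iota> W) \<cdot> \<kappa>" by (simp only: K) simp
  ultimately show "mor (bimod_assoc C coeq A M N P) \<in> hom C (Cod C (bq (M \<odot> N) P)) (Cod C (bq M (N \<odot> P)))"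
    "coords M (N \<odot> P) (V \<otimes>\<^sub>o W) ((s \<otimes> \<iota> W) \<cdot> coords N P W p) \<cdot> mor (bimod_assoc C coeq A M N P)
      = (coords M N V s \<otimes> \<iota> W) \<cdot> coords (M \<odot> N) P W p"
    by (simp_all only: q_def \<theta>_def q'_def \<theta>'_def l_def \<kappa>_def r_def \<rho>_def)
qed

section \<open>Bimodule morphisms between free modules\<close>

text \<open>The left linear extension of \<open>g : P \<rightarrow> A \<otimes> Q\<close> to \<open>A \<otimes> P\<close>; the object \<open>Q\<close> has to be passed since it
  cannot be recovered from the codomain of \<open>g\<close>.\<close>
definition lext :: "'o \<Rightarrow> 'm \<Rightarrow> 'm" where
  "lext Q g = (m \<otimes> \<iota> Q) \<cdot> (\<iota> A \<otimes> g)"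

lemma lext_typing [simp]:
  assumes "g \<in> Arr C" "Cod C g = A \<otimes>\<^sub>o Q" "Q \<in> Obj C"
  shows "lext Q g \<in> Arr C" "Dom C (lext Q g) = A \<otimes>\<^sub>o Dom C g" "Cod C (lext Q g) = A \<otimes>\<^sub>o Q"
  using assms by (simp_all add: lext_def)

lemma lext_unit:
  assumes [simp]: "g \<in> Arr C" "Cod C g = A \<otimes>\<^sub>o Q" "Q \<in> Obj C" "Dom C g = P"
  shows "lext Q g \<cdot> (e \<otimes> \<iota> P) = g"
proof -
  have [simp]: "P \<in> Obj C" using Dom_Obj[of g] by simp
  have "lext Q g \<cdot> (e \<otimes> \<iota> P) = ((m \<cdot> (e \<otimes> \<iota> A)) \<otimes> \<iota> Q) \<cdot> g"
    using interchange[of e g] by (simp add: lext_def)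
  then show ?thesis by (simp add: m_unit_left del: whisker_right)
qed

lemma lext_inject:
  assumes "g \<in> Arr C" "Cod C g = A \<otimes>\<^sub>o Q" "h \<in> Arr C" "Cod C h = A \<otimes>\<^sub>o Q" "Q \<in> Obj C" "Dom C g = Dom C h"
  shows "lext Q g = lext Q h \<longleftrightarrow> g = h"
  using lext_unit[of g Q] lext_unit[of h Q] assms by metis

lemma lext_comp:
  assumes [simp]: "g \<in> Arr C" "Cod C g = A \<otimes>\<^sub>o Q" "Q \<in> Obj C" "h \<in> Arr C" "Dom C h = Q" "Cod C h = A \<otimes>\<^sub>o R" "R \<in> Obj C"
  shows "lext R h \<cdot> lext Q g = lext R (lext R h \<cdot> g)"
proof -
  have "lext R h \<cdot> lext Q g = ((m \<cdot> (m \<otimes> \<iota> A)) \<otimes> \<iota> R) \<cdot> (\<iota> (A \<otimes>\<^sub>o A) \<otimes> h) \<cdot> (\<iota> A \<otimes> g)"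
    using arg_cong[OF interchange[of m h], of "\<lambda>x. (m \<otimes> \<iota> R) \<cdot> x \<cdot> (\<iota> A \<otimes> g)"]
    by (simp add: lext_def)
  also have "\<dots> = lext R (lext R h \<cdot> g)"
    by (simp only: m_assoc) (simp add: lext_def)
  finally show ?thesis .
qed

lemma lext_tensor:
  assumes [simp]: "g \<in> Arr C" "Cod C g = A \<otimes>\<^sub>o Q" "Q \<in> Obj C" "V \<in> Obj C"
  shows "lext Q g \<otimes> \<iota> V = lext (Q \<otimes>\<^sub>o V) (g \<otimes> \<iota> V)"
  by (simp add: lext_def)

lemma lext_precomp:
  assumes [simp]: "g \<in> Arr C" "Cod C g = A \<otimes>\<^sub>o Q" "Q \<in> Obj C" "k \<in> Arr C" "Cod C k = Dom C g"
  shows "lext Q g \<cdot> (\<iota> A \<otimes> k) = lext Q (g \<cdot> k)"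
  by (simp add: lext_def)

lemma lext_ident:
  assumes [simp]: "Q \<in> Obj C"
  shows "lext Q (e \<otimes> \<iota> Q) = \<iota> (A \<otimes>\<^sub>o Q)"
  using arg_cong[OF m_unit_right, of "\<lambda>x. x \<otimes> \<iota> Q"] by (simp add: lext_def)

lemma lext_eq_ident:
  assumes "g \<in> Arr C" "Cod C g = A \<otimes>\<^sub>o Q" "Q \<in> Obj C" "Dom C g = Q"
  shows "lext Q g = \<iota> (A \<otimes>\<^sub>o Q) \<longleftrightarrow> g = e \<otimes> \<iota> Q"
  using lext_inject[of g Q "e \<otimes> \<iota> Q"] lext_ident[of Q] assms by simp

text \<open>How a scalar is moved from the right to the left of a generator; for \<open>A \<otimes> X\<close> with its standard
  generators this is the \<open>\<psi>\<close> of the theorem.\<close>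
definition twist :: "('o, 'm) bimodule \<Rightarrow> 'm \<Rightarrow> 'm \<Rightarrow> 'm" where
  "twist Y i p = p \<cdot> ract Y \<cdot> (i \<otimes> \<iota> A)"

lemma twist_typing:
  assumes "free_bimod Y W i p"
  shows "twist Y i p \<in> Arr C" "Dom C (twist Y i p) = W \<otimes>\<^sub>o A" "Cod C (twist Y i p) = A \<otimes>\<^sub>o W"
  using bimoduleD[OF conjunct1[OF assms]] free_onD[OF conjunct2[OF assms]] by (simp_all add: twist_def)

text \<open>The right action commutes with the left one, so it is determined by the twist.\<close>
lemma ract_coords:
  assumes "free_bimod Y W i p"
  shows "p \<cdot> ract Y = lext W (twist Y i p) \<cdot> (p \<otimes> \<iota> A)"
proof -
  note Y = conjunct1[OF assms] conjunct2[OF assms]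
  note [simp] = bimoduleD(3-9)[OF Y(1)] free_onD(6-11)[OF Y(2)] free_onD(2)[OF Y(2)] twist_typing[OF assms]
  have "p \<cdot> ract Y = p \<cdot> ract Y \<cdot> ((lact Y \<cdot> (\<iota> A \<otimes> i) \<cdot> p) \<otimes> \<iota> A)"
    by (simp only: free_on_eqs[OF Y(2)]) simp
  also have "\<dots> = p \<cdot> (ract Y \<cdot> (lact Y \<otimes> \<iota> A)) \<cdot> (\<iota> A \<otimes> i \<otimes> \<iota> A) \<cdot> (p \<otimes> \<iota> A)"
    by simp
  also have "\<dots> = (p \<cdot> lact Y) \<cdot> (\<iota> A \<otimes> (ract Y \<cdot> (i \<otimes> \<iota> A))) \<cdot> (p \<otimes> \<iota> A)"
    by (simp only: bimodule_eqs[OF Y(1)]) simp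
  also have "\<dots> = lext W (twist Y i p) \<cdot> (p \<otimes> \<iota> A)"
    by (simp only: free_coords_linear[OF Y(2)]) (simp add: lext_def twist_def)
  finally show ?thesis .
qed

text \<open>In coordinates a morphism is the extension of its restriction \<open>s h i\<close>, and right linearity
  on generators says that the restriction is compatible with the twists.\<close>
lemma bimod_arr_coords:
  assumes Y: "free_bimod Y W i p" and Z: "free_bimod Z V j s"
    and h: "is_bimod_arr C A (Bimod_Arr Y h Z)"
  shows "h = lact Z \<cdot> (\<iota> A \<otimes> j) \<cdot> lext V (s \<cdot> h \<cdot> i) \<cdot> p"
    and "lext V (s \<cdot> h \<cdot> i) \<cdot> twist Y i p = lext V (twist Z j s) \<cdot> ((s \<cdot> h \<cdot> i) \<otimes> \<iota> A)"
proof -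
  note Y' = conjunct1[OF Y] conjunct2[OF Y] and Z' = conjunct1[OF Z] conjunct2[OF Z]
  note [simp] = bimoduleD(3-9)[OF Y'(1)] free_onD(6-11)[OF Y'(2)] free_onD(2)[OF Y'(2)]
    bimoduleD(3-9)[OF Z'(1)] free_onD(6-11)[OF Z'(2)] free_onD(2)[OF Z'(2)]
    twist_typing[OF Y] twist_typing[OF Z]
  have [simp]: "h \<in> Arr C" "Dom C h = under Y" "Cod C h = under Z"
    and l: "h \<cdot> lact Y = lact Z \<cdot> (\<iota> A \<otimes> h)" and r: "h \<cdot> ract Y = ract Z \<cdot> (h \<otimes> \<iota> A)"
    using h by (auto simp: is_bimod_arr_def hom_def)
  have "s \<cdot> h = s \<cdot> lact Z \<cdot> (\<iota> A \<otimes> (h \<cdot> i)) \<cdot> p"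
    using linear_map_eq[OF Y'(2) bimoduleD(1)[OF Z'(1)], of h] l by (simp add: hom_def)
  also have "\<dots> = (s \<cdot> lact Z) \<cdot> (\<iota> A \<otimes> (h \<cdot> i)) \<cdot> p" by simp
  also have "\<dots> = lext V (s \<cdot> h \<cdot> i) \<cdot> p"
    by (simp only: free_coords_linear[OF Z'(2)]) (simp add: lext_def)
  finally have sh: "s \<cdot> h = lext V (s \<cdot> h \<cdot> i) \<cdot> p" .
  have "h = (lact Z \<cdot> (\<iota> A \<otimes> j) \<cdot> s) \<cdot> h"
    by (simp only: free_on_eqs[OF Z'(2)]) simp
  also have "\<dots> = lact Z \<cdot> (\<iota> A \<otimes> j) \<cdot> (s \<cdot> h)" by simp
  also have "\<dots> = lact Z \<cdot> (\<iota> A \<otimes> j) \<cdot> lext V (s \<cdot> h \<cdot> i) \<cdot> p" by (simp only: sh)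
  finally show "h = lact Z \<cdot> (\<iota> A \<otimes> j) \<cdot> lext V (s \<cdot> h \<cdot> i) \<cdot> p" .
  have "lext V (s \<cdot> h \<cdot> i) \<cdot> twist Y i p = (lext V (s \<cdot> h \<cdot> i) \<cdot> p) \<cdot> ract Y \<cdot> (i \<otimes> \<iota> A)"
    by (simp add: twist_def)
  also have "\<dots> = s \<cdot> (h \<cdot> ract Y) \<cdot> (i \<otimes> \<iota> A)" by (simp only: sh[symmetric]) simp
  also have "\<dots> = (s \<cdot> ract Z) \<cdot> ((h \<cdot> i) \<otimes> \<iota> A)" by (simp only: r) simp
  also have "\<dots> = lext V (twist Z j s) \<cdot> ((s \<cdot> h \<cdot> i) \<otimes> \<iota> A)" by (simp only: ract_coords[OF Z]) simp
  finally show "lext V (s \<cdot> h \<cdot> i) \<cdot> twist Y i p = lext V (twist Z j s) \<cdot> ((s \<cdot> h \<cdot> i) \<otimes> \<iota> A)" .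
qed

text \<open>Conversely, compatibility with the twists on generators suffices for right linearity, because both
  sides are left linear.\<close>
lemma coords_bimod_arr:
  assumes Y: "free_bimod Y W i p" and Z: "free_bimod Z V j s"
    and g: "g \<in> hom C W (A \<otimes>\<^sub>o V)" "lext V g \<cdot> twist Y i p = lext V (twist Z j s) \<cdot> (g \<otimes> \<iota> A)"
  shows "is_bimod_arr C A (Bimod_Arr Y (lact Z \<cdot> (\<iota> A \<otimes> j) \<cdot> lext V g \<cdot> p) Z)"
proof -
  note Y' = conjunct1[OF Y] conjunct2[OF Y] and Z' = conjunct1[OF Z] conjunct2[OF Z]
  note [simp] = bimoduleD(3-9)[OF Y'(1)] free_onD(6-11)[OF Y'(2)] free_onD(2)[OF Y'(2)]
    bimoduleD(3-9)[OF Z'(1)] free_onD(6-11)[OF Z'(2)] free_onD(2)[OF Z'(2)]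
    twist_typing[OF Y] twist_typing[OF Z]
  have [simp]: "g \<in> Arr C" "Dom C g = W" "Cod C g = A \<otimes>\<^sub>o V"
    using g by (auto simp: hom_def)
  let ?h = "lact Z \<cdot> (\<iota> A \<otimes> j) \<cdot> lext V g \<cdot> p"
  have "(s \<cdot> lact Z \<cdot> (\<iota> A \<otimes> j)) \<cdot> lext V g \<cdot> p = lext V g \<cdot> p"
    by (simp only: free_on_eqs[OF Z'(2)]) simp
  then have sh: "s \<cdot> ?h = lext V g \<cdot> p" by simp
  have cancel: "x = y" if "x \<in> Arr C" "y \<in> Arr C" "Cod C x = under Z" "Cod C y = under Z" "s \<cdot> x = s \<cdot> y" for x y
    using that free_on_eqs(4)[OF Z'(2)]
    by (intro split_mono_cancel[where t = s and s = "lact Z \<cdot> (\<iota> A \<otimes> j)" and g = x and h = y]) simp_all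
  have l: "?h \<cdot> lact Y = lact Z \<cdot> (\<iota> A \<otimes> ?h)"
  proof (rule cancel)
    have "s \<cdot> ?h \<cdot> lact Y = (s \<cdot> ?h) \<cdot> lact Y" by simp
    also have "\<dots> = lext V g \<cdot> (p \<cdot> lact Y)" by (simp only: sh) simp
    \<comment> \<open>The multiplication \<open>m \<otimes> W\<close> is itself an extension, namely of the identity.\<close>
    also have "\<dots> = lext V g \<cdot> lext W (\<iota> (A \<otimes>\<^sub>o W)) \<cdot> (\<iota> A \<otimes> p)"
      by (simp only: free_coords_linear[OF Y'(2)]) (simp add: lext_def)
    also have "\<dots> = (lext V g \<cdot> lext W (\<iota> (A \<otimes>\<^sub>o W))) \<cdot> (\<iota> A \<otimes> p)" by simp
    also have "\<dots> = lext V (lext V g) \<cdot> (\<iota> A \<otimes> p)"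
      by (subst lext_comp) simp_all
    also have "\<dots> = (m \<otimes> \<iota> V) \<cdot> (\<iota> A \<otimes> (lext V g \<cdot> p))"
      by (simp add: lext_def[of V "lext V g"])
    also have "\<dots> = ((m \<otimes> \<iota> V) \<cdot> (\<iota> A \<otimes> s)) \<cdot> (\<iota> A \<otimes> ?h)"
      by (subst sh[symmetric]) simp
    also have "\<dots> = s \<cdot> lact Z \<cdot> (\<iota> A \<otimes> ?h)"
      by (simp only: free_coords_linear[OF Z'(2), symmetric]) simp
    finally show "s \<cdot> ?h \<cdot> lact Y = s \<cdot> lact Z \<cdot> (\<iota> A \<otimes> ?h)" .
  qed simp_all
  have r: "?h \<cdot> ract Y = ract Z \<cdot> (?h \<otimes> \<iota> A)"
  proof (rule cancel)
    have "s \<cdot> ?h \<cdot> ract Y = (s \<cdot> ?h) \<cdot> ract Y" by simp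
    also have "\<dots> = lext V g \<cdot> (p \<cdot> ract Y)" by (simp only: sh) simp
    also have "\<dots> = (lext V g \<cdot> lext W (twist Y i p)) \<cdot> (p \<otimes> \<iota> A)"
      by (simp only: ract_coords[OF Y]) simp
    also have "\<dots> = lext V (lext V g \<cdot> twist Y i p) \<cdot> (p \<otimes> \<iota> A)"
      by (subst lext_comp) simp_all
    also have "\<dots> = (lext V (twist Z j s) \<cdot> lext (V \<otimes>\<^sub>o A) (g \<otimes> \<iota> A)) \<cdot> (p \<otimes> \<iota> A)"
      unfolding g(2) by (subst lext_comp) simp_all
    also have "\<dots> = lext V (twist Z j s) \<cdot> ((lext V g \<cdot> p) \<otimes> \<iota> A)"
      by (simp add: lext_tensor)
    also have "\<dots> = (lext V (twist Z j s) \<cdot> (s \<otimes> \<iota> A)) \<cdot> (?h \<otimes> \<iota> A)"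
      by (subst sh[symmetric]) simp
    also have "\<dots> = s \<cdot> ract Z \<cdot> (?h \<otimes> \<iota> A)"
      by (simp only: ract_coords[OF Z, symmetric]) simp
    finally show "s \<cdot> ?h \<cdot> ract Y = s \<cdot> ract Z \<cdot> (?h \<otimes> \<iota> A)" .
  qed simp_all
  show ?thesis using l r by (simp add: is_bimod_arr_def hom_def del: comp_assoc whisker_left whisker_right)
qed

abbreviation D :: "(('o, 'm) bimodule, ('o, 'm) bimod_arr) moncat" where
  "D \<equiv> bimod_cat C coeq A m e"

lemma bimod_cat_simps [simp]:
  "Dom D = src" "Cod D = tgt" "Id D = (\<lambda>M. Bimod_Arr M (\<iota> (under M)) M)"
  "Comp D = (\<lambda>g f. Bimod_Arr (src f) (mor g \<cdot> mor f) (tgt g))"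
  "TensO D = bimod_tensor C coeq A" "Tens D = bimod_tensor_arr C coeq A"
  "One D = Bimodule A m m" "Assoc D = bimod_assoc C coeq A"
  by (simp_all add: bimod_cat_def Let_def)

lemma free_bimod_Obj:
  assumes "free_bimod B W i p" "left_coflat C W"
  shows "B \<in> Obj D"
  using assms free_on_left_coflat[of "under B" "lact B" W i p] free_on_left_robust[of "under B" "lact B" W i p]
  by (simp add: bimod_cat_def Let_def)

lemma bimod_cat_hom:
  "h \<in> hom D M N \<longleftrightarrow> M \<in> Obj D \<and> N \<in> Obj D \<and> src h = M \<and> tgt h = N \<and> is_bimod_arr C A h"
  by (auto simp: bimod_cat_def Let_def hom_def)

lemma Obj_bimodule: "B \<in> Obj D \<Longrightarrow> bimodule B"
  by (simp add: bimod_cat_def Let_def)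

lemma left_coflat_One: "left_coflat C \<one>"
proof -
  have "f \<otimes> \<iota> \<one> = f \<and> g \<otimes> \<iota> \<one> = g \<and> q \<otimes> \<iota> \<one> = q" if "is_coequalizer C f g q" for f g q
  proof -
    have "f \<in> Arr C" "g \<in> Arr C" "q \<in> Arr C"
      using that unfolding is_coequalizer_def hom_def by blast+
    then show ?thesis by simp
  qed
  then show ?thesis by (simp add: left_coflat_def)
qed

text \<open>The unit bimodule \<open>A\<close> is free on the unit object.\<close>
lemma unit_free_bimod: "free_bimod (Bimodule A m m) \<one> e (\<iota> A)"
  by (simp add: is_bimodule_def free_on_def left_module_iff right_module_iff hom_def
      m_assoc m_unit_left m_unit_right)

text \<open>The unitors are induced by the actions, and so are the coordinates of \<open>A \<otimes>\<^sub>A M\<close> and \<open>M \<otimes>\<^sub>A A\<close>.\<close>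
lemma Lunit_coords:
  assumes M: "free_bimod M W i p"
  shows "mor (Lunit D M) = lact M \<cdot> (\<iota> A \<otimes> i) \<cdot> coords (Bimodule A m m) M W p"
proof -
  let ?U = "Bimodule A m m"
  note U = conjunct1[OF unit_free_bimod] and M' = conjunct1[OF M] conjunct2[OF M]
  note [simp] = bimoduleD(3-9)[OF M'(1)] free_onD(6-11)[OF M'(2)] free_onD(2)[OF M'(2)]
    coords_typing[OF U M, simplified]
  note \<theta> = coords_eqs[OF U M, simplified]
  have "(lact M \<cdot> (\<iota> A \<otimes> i) \<cdot> coords ?U M W p) \<cdot> bq ?U M
    = lact M \<cdot> (\<iota> A \<otimes> i) \<cdot> (coords ?U M W p \<cdot> bq ?U M)" by simp
  also have "\<dots> = lact M \<cdot> (\<iota> A \<otimes> i) \<cdot> (p \<cdot> lact M)"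
    by (simp only: \<theta> free_coords_linear[OF M'(2)])
  also have "\<dots> = (lact M \<cdot> (\<iota> A \<otimes> i) \<cdot> p) \<cdot> lact M" by simp
  also have "\<dots> = lact M" by (simp only: free_on_eqs[OF M'(2)]) simp
  finally have "induced C (bq ?U M) (lact M) = lact M \<cdot> (\<iota> A \<otimes> i) \<cdot> coords ?U M W p"
    using \<theta>(3) by (intro induced_eqI[where s = "(\<iota> A \<otimes> i) \<cdot> coords ?U M W p"]) simp_all
  then show ?thesis by (simp add: bimod_cat_def Let_def)
qed

lemma Runit_coords:
  assumes M: "bimodule M"
  shows "mor (Runit D M) = coords M (Bimodule A m m) \<one> (\<iota> A)"
  using bimoduleD[OF M] by (simp add: bimod_cat_def Let_def coords_def tensor_coords_def bimod_q_def)

lemma bimod_cat_unit_sel [simp]: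
  "src (Lunit D M) = Bimodule A m m \<odot> M" "tgt (Lunit D M) = M"
  "src (Runit D M) = M \<odot> Bimodule A m m" "tgt (Runit D M) = M"
  by (simp_all add: bimod_cat_def Let_def)

section \<open>Bimodule structures on a free left module\<close>

lemma free_module_free_on:
  assumes "X \<in> Obj C"
  shows "free_on (A \<otimes>\<^sub>o X) (m \<otimes> \<iota> X) X (e \<otimes> \<iota> X) (\<iota> (A \<otimes>\<^sub>o X))"
  using free_on_tensor[OF conjunct2[OF unit_free_bimod] assms] assms by simp

lemma free_bimodule_sel [simp]:
  "under (free_bimodule C A m X r) = A \<otimes>\<^sub>o X"
  "lact (free_bimodule C A m X r) = m \<otimes> \<iota> X"
  "ract (free_bimodule C A m X r) = r"
  by (simp_all add: free_bimodule_def)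

text \<open>An extension \<open>lext X \<psi>\<close> commutes with the left action for free; its associativity and unit law
  are equations between left linear maps, which hold as soon as they hold on \<open>X\<close>.\<close>
lemma free_bimodule_iff:
  assumes X [simp]: "X \<in> Obj C" and \<psi>: "\<psi> \<in> hom C (X \<otimes>\<^sub>o A) (A \<otimes>\<^sub>o X)"
  shows "bimodule (free_bimodule C A m X (lext X \<psi>)) \<longleftrightarrow>
    \<psi> \<cdot> (\<iota> X \<otimes> m) = lext X \<psi> \<cdot> (\<psi> \<otimes> \<iota> A) \<and> \<psi> \<cdot> (\<iota> X \<otimes> e) = e \<otimes> \<iota> X"
proof -
  have [simp]: "\<psi> \<in> Arr C" "Dom C \<psi> = X \<otimes>\<^sub>o A" "Cod C \<psi> = A \<otimes>\<^sub>o X" using \<psi> by (auto simp: hom_def)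
  have "lext X \<psi> \<cdot> (m \<otimes> \<iota> (X \<otimes>\<^sub>o A)) = ((m \<cdot> (m \<otimes> \<iota> A)) \<otimes> \<iota> X) \<cdot> (\<iota> (A \<otimes>\<^sub>o A) \<otimes> \<psi>)"
    using interchange[of m \<psi>] by (simp add: lext_def)
  also have "\<dots> = (m \<otimes> \<iota> X) \<cdot> (\<iota> A \<otimes> lext X \<psi>)"
    by (simp only: m_assoc) (simp add: lext_def)
  finally have lin: "lext X \<psi> \<cdot> (m \<otimes> \<iota> (X \<otimes>\<^sub>o A)) = (m \<otimes> \<iota> X) \<cdot> (\<iota> A \<otimes> lext X \<psi>)" .
  have mult: "lext X \<psi> \<cdot> (\<iota> (A \<otimes>\<^sub>o X) \<otimes> m) = lext X \<psi> \<cdot> (lext X \<psi> \<otimes> \<iota> A)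
      \<longleftrightarrow> \<psi> \<cdot> (\<iota> X \<otimes> m) = lext X \<psi> \<cdot> (\<psi> \<otimes> \<iota> A)"
    using lext_precomp[of \<psi> X "\<iota> X \<otimes> m"] lext_inject[of "\<psi> \<cdot> (\<iota> X \<otimes> m)" X "lext X \<psi> \<cdot> (\<psi> \<otimes> \<iota> A)"]
    by (simp add: lext_tensor lext_comp)
  have unit: "lext X \<psi> \<cdot> (\<iota> (A \<otimes>\<^sub>o X) \<otimes> e) = \<iota> (A \<otimes>\<^sub>o X) \<longleftrightarrow> \<psi> \<cdot> (\<iota> X \<otimes> e) = e \<otimes> \<iota> X"
    using lext_precomp[of \<psi> X "\<iota> X \<otimes> e"] lext_eq_ident[of "\<psi> \<cdot> (\<iota> X \<otimes> e)" X] by simp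
  have "left_module C A m e (A \<otimes>\<^sub>o X) (m \<otimes> \<iota> X)"
    using free_module_free_on[OF X] by (simp add: free_on_def)
  then show ?thesis
    using lin mult unit by (simp add: is_bimodule_def right_module_iff)
qed

text \<open>The action \<open>r\<close> is a left linear map out of \<open>A \<otimes> X \<otimes> A\<close>, which is free on \<open>X \<otimes> A\<close>.\<close>
lemma free_bimodule_action:
  assumes X [simp]: "X \<in> Obj C" and B: "bimodule (free_bimodule C A m X r)"
  shows "r \<cdot> (e \<otimes> \<iota> X \<otimes> \<iota> A) \<in> hom C (X \<otimes>\<^sub>o A) (A \<otimes>\<^sub>o X)"
    and "r = lext X (r \<cdot> (e \<otimes> \<iota> X \<otimes> \<iota> A))"
proof -
  note [simp] = bimoduleD[OF B, simplified]
  show "r \<cdot> (e \<otimes> \<iota> X \<otimes> \<iota> A) \<in> hom C (X \<otimes>\<^sub>o A) (A \<otimes>\<^sub>o X)" by (simp add: hom_def)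
  show "r = lext X (r \<cdot> (e \<otimes> \<iota> X \<otimes> \<iota> A))"
    using linear_map_eq[OF free_on_tensor[OF free_module_free_on[OF X] A_Obj] bimoduleD(1)[OF B], of r]
      bimodule_eqs(5)[OF B]
    by (simp add: hom_def lext_def)
qed

lemma coords_cancel:
  assumes M: "bimodule M" and N: "free_bimod N W i p"
    and "f \<in> Arr C" "g \<in> Arr C" "Dom C f = under M \<otimes>\<^sub>o W" "Dom C g = under M \<otimes>\<^sub>o W"
  shows "f \<cdot> coords M N W p = g \<cdot> coords M N W p \<longleftrightarrow> f = g"
proof
  note [simp] = coords_typing[OF M N] bimoduleD(3-9)[OF M] bimoduleD(3-9)[OF conjunct1[OF N]]
    free_onD(6-11)[OF conjunct2[OF N]] free_onD(2)[OF conjunct2[OF N]]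
  show "f = g" if "f \<cdot> coords M N W p = g \<cdot> coords M N W p"
    by (rule split_epi_cancel[where q = "coords M N W p" and s = "bq M N \<cdot> (\<iota> (under M) \<otimes> i)"];
        use that assms(3-6) coords_right_inverse[OF M N] in simp)
qed simp

lemma coords_cancel_left:
  assumes M: "bimodule M" and N: "free_bimod N W i p"
    and "f \<in> Arr C" "g \<in> Arr C" "Cod C f = Cod C (bq M N)" "Cod C g = Cod C (bq M N)"
  shows "coords M N W p \<cdot> f = coords M N W p \<cdot> g \<longleftrightarrow> f = g"
proof
  note [simp] = coords_typing[OF M N] bimoduleD(3-9)[OF M] bimoduleD(3-9)[OF conjunct1[OF N]]
    free_onD(6-11)[OF conjunct2[OF N]] free_onD(2)[OF conjunct2[OF N]]
  show "f = g" if "coords M N W p \<cdot> f = coords M N W p \<cdot> g"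
    by (rule split_mono_cancel[where t = "coords M N W p" and s = "bq M N \<cdot> (\<iota> (under M) \<otimes> i)"];
        use that assms(3-6) coords_left_inverse[OF M N] in simp)
qed simp

lemma bimod_hom_coords:
  assumes Y: "free_bimod Y W i p" "Y \<in> Obj D" and Z: "free_bimod Z V j s" "Z \<in> Obj D"
  shows "h \<in> hom D Y Z \<longleftrightarrow>
    (\<exists>g \<in> hom C W (A \<otimes>\<^sub>o V). h = Bimod_Arr Y (lact Z \<cdot> (\<iota> A \<otimes> j) \<cdot> lext V g \<cdot> p) Z \<and>
       lext V g \<cdot> twist Y i p = lext V (twist Z j s) \<cdot> (g \<otimes> \<iota> A))"
proof
  assume h: "h \<in> hom D Y Z"
  then have b: "is_bimod_arr C A (Bimod_Arr Y (mor h) Z)" and hYZ: "h = Bimod_Arr Y (mor h) Z"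
    unfolding bimod_cat_hom by (cases h; auto)+
  have "s \<cdot> mor h \<cdot> i \<in> hom C W (A \<otimes>\<^sub>o V)"
    using b free_onD[OF conjunct2[OF Y(1)]] free_onD[OF conjunct2[OF Z(1)]]
    by (auto simp: is_bimod_arr_def hom_def)
  then show "\<exists>g \<in> hom C W (A \<otimes>\<^sub>o V). h = Bimod_Arr Y (lact Z \<cdot> (\<iota> A \<otimes> j) \<cdot> lext V g \<cdot> p) Z \<and>
       lext V g \<cdot> twist Y i p = lext V (twist Z j s) \<cdot> (g \<otimes> \<iota> A)"
    using bimod_arr_coords[OF Y(1) Z(1) b] hYZ by metis
next
  assume "\<exists>g \<in> hom C W (A \<otimes>\<^sub>o V). h = Bimod_Arr Y (lact Z \<cdot> (\<iota> A \<otimes> j) \<cdot> lext V g \<cdot> p) Z \<and>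
       lext V g \<cdot> twist Y i p = lext V (twist Z j s) \<cdot> (g \<otimes> \<iota> A)"
  then show "h \<in> hom D Y Z"
    using coords_bimod_arr[OF Y(1) Z(1)] Y(2) Z(2) unfolding bimod_cat_hom by auto
qed

lemma bimod_tensor_arr_sel [simp]:
  "src (bimod_tensor_arr C coeq A f g) = src f \<odot> src g"
  "tgt (bimod_tensor_arr C coeq A f g) = tgt f \<odot> tgt g"
  by (simp_all add: bimod_tensor_arr_def)

lemma bimod_assoc_sel [simp]:
  "src (bimod_assoc C coeq A M N P) = (M \<odot> N) \<odot> P"
  "tgt (bimod_assoc C coeq A M N P) = M \<odot> N \<odot> P"
  by (simp_all add: bimod_assoc_def Let_def)

lemma id_bimod_arr: "bimodule M \<Longrightarrow> is_bimod_arr C A (Bimod_Arr M (\<iota> (under M)) M)"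
  using bimoduleD[of M] by (simp add: is_bimod_arr_def hom_def)

end

section \<open>The entwined bimodule and its tensor powers\<close>

text \<open>The two equations on \<open>\<psi>\<close> say that \<open>A \<otimes> X\<close> is a bimodule; this is half of the axioms of an
  entwining structure, in which \<open>X\<close> would be a coalgebra.\<close>
locale entwined = coflat_algebra C coeq A m e
  for C :: "('o, 'm) moncat" (structure) and coeq A m e +
  fixes X :: 'o and \<psi> :: 'm
  assumes coflat_X: "left_coflat C X"
    and \<psi>_hom: "\<psi> \<in> hom C (X \<otimes>\<^sub>o A) (A \<otimes>\<^sub>o X)"
    and \<psi>_mult: "\<psi> \<cdot> (\<iota> X \<otimes> m) = lext X \<psi> \<cdot> (\<psi> \<otimes> \<iota> A)"
    and \<psi>_unit: "\<psi> \<cdot> (\<iota> X \<otimes> e) = e \<otimes> \<iota> X"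
begin

abbreviation B :: "('o, 'm) bimodule" where
  "B \<equiv> free_bimodule C A m X (lext X \<psi>)"

abbreviation U :: "('o, 'm) bimodule" where
  "U \<equiv> Bimodule A m m"

abbreviation \<theta> :: 'm where
  "\<theta> \<equiv> coords B B X (\<iota> (A \<otimes>\<^sub>o X))"

abbreviation basis2 :: 'm where
  "basis2 \<equiv> bq B B \<cdot> (e \<otimes> \<iota> X \<otimes> e \<otimes> \<iota> X)"

lemma X_Obj [simp]: "X \<in> Obj C"
  using coflat_X by (simp add: left_coflat_def)

lemma \<psi>_typing [simp]: "\<psi> \<in> Arr C" "Dom C \<psi> = X \<otimes>\<^sub>o A" "Cod C \<psi> = A \<otimes>\<^sub>o X"
  using \<psi>_hom by (auto simp: hom_def)

lemma B_free: "free_bimod B X (e \<otimes> \<iota> X) (\<iota> (A \<otimes>\<^sub>o X))"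
  using free_bimodule_iff[OF X_Obj \<psi>_hom] \<psi>_mult \<psi>_unit free_module_free_on[OF X_Obj] by simp

lemmas B_bimodule = conjunct1[OF B_free]

lemma \<theta>_typing [simp]:
  "bq B B \<in> Arr C" "Dom C (bq B B) = A \<otimes>\<^sub>o X \<otimes>\<^sub>o A \<otimes>\<^sub>o X" "Cod C (bq B B) \<in> Obj C"
  "\<theta> \<in> Arr C" "Dom C \<theta> = Cod C (bq B B)" "Cod C \<theta> = A \<otimes>\<^sub>o X \<otimes>\<^sub>o X"
  using coords_typing[OF B_bimodule B_free] by simp_all

lemma BB_free: "free_bimod (B \<odot> B) (X \<otimes>\<^sub>o X) basis2 \<theta>"
  using free_bimod_tensor[OF B_free B_free] by simp

lemmas BB_bimodule = conjunct1[OF BB_free]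
lemmas U_bimodule = conjunct1[OF unit_free_bimod]

lemma BB_typing [simp]: "under (B \<odot> B) = Cod C (bq B B)"
  using bimod_tensor_actions[OF B_bimodule B_free] by simp

lemma coflat_XX: "left_coflat C (X \<otimes>\<^sub>o X)"
  by (rule left_coflat_tensor[OF coflat_X coflat_X])

lemma B_Obj: "B \<in> Obj D" and BB_Obj: "B \<odot> B \<in> Obj D" and U_Obj: "U \<in> Obj D"
  using free_bimod_Obj[OF B_free coflat_X] free_bimod_Obj[OF BB_free coflat_XX]
    free_bimod_Obj[OF unit_free_bimod left_coflat_One] by auto

lemma twist_B: "twist B (e \<otimes> \<iota> X) (\<iota> (A \<otimes>\<^sub>o X)) = \<psi>"
  using lext_unit[of \<psi> X "X \<otimes>\<^sub>o A"] by (simp add: twist_def)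

lemma twist_U: "twist U e (\<iota> A) = \<iota> A"
  by (simp add: twist_def m_unit_left)

text \<open>A scalar passes \<open>X \<otimes> X\<close> one factor at a time.\<close>
lemma twist_BB: "twist (B \<odot> B) basis2 \<theta> = (\<psi> \<otimes> \<iota> X) \<cdot> (\<iota> X \<otimes> \<psi>)"
proof -
  note [simp] = bimoduleD(7-9)[OF BB_bimodule, simplified]
  have "twist (B \<odot> B) basis2 \<theta> = (\<theta> \<cdot> ract (B \<odot> B)) \<cdot> (basis2 \<otimes> \<iota> A)"
    by (simp add: twist_def)
  also have "\<dots> = (lext X \<psi> \<otimes> \<iota> X) \<cdot> (\<iota> (A \<otimes>\<^sub>o X) \<otimes> \<psi>) \<cdot> ((\<theta> \<cdot> basis2) \<otimes> \<iota> A)"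
    using coords_ract[OF B_bimodule B_free, folded twist_def, unfolded twist_B] by simp
  also have "\<dots> = (lext X \<psi> \<otimes> \<iota> X) \<cdot> (\<iota> (A \<otimes>\<^sub>o X) \<otimes> \<psi>) \<cdot> (e \<otimes> \<iota> (X \<otimes>\<^sub>o X \<otimes>\<^sub>o A))"
    by (simp only: free_coords_basis[OF conjunct2[OF BB_free]]) simp
  also have "\<dots> = lext (X \<otimes>\<^sub>o X) (\<psi> \<otimes> \<iota> X) \<cdot> (\<iota> A \<otimes> \<iota> X \<otimes> \<psi>) \<cdot> (e \<otimes> \<iota> (X \<otimes>\<^sub>o X \<otimes>\<^sub>o A))"
    by (simp add: lext_tensor)
  also have "\<dots> = (lext (X \<otimes>\<^sub>o X) (\<psi> \<otimes> \<iota> X) \<cdot> (\<iota> A \<otimes> (\<iota> X \<otimes> \<psi>))) \<cdot> (e \<otimes> \<iota> (X \<otimes>\<^sub>o X \<otimes>\<^sub>o A))"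
    by simp
  also have "\<dots> = (\<psi> \<otimes> \<iota> X) \<cdot> (\<iota> X \<otimes> \<psi>)"
    by (subst lext_precomp) (simp_all add: lext_unit)
  finally show ?thesis .
qed

text \<open>The restriction of the identity of \<open>B\<close> is \<open>e \<otimes> X\<close>, whose coefficient acts trivially.\<close>
lemma tensor_id_coords:
  assumes h: "is_bimod_arr C A h" "bimodule (src h)" "bimodule (tgt h)"
  shows "coords (tgt h) B X (\<iota> (A \<otimes>\<^sub>o X)) \<cdot> mor (bimod_tensor_arr C coeq A h (Bimod_Arr B (\<iota> (A \<otimes>\<^sub>o X)) B))
    = (mor h \<otimes> \<iota> X) \<cdot> coords (src h) B X (\<iota> (A \<otimes>\<^sub>o X))"
    and "mor (bimod_tensor_arr C coeq A h (Bimod_Arr B (\<iota> (A \<otimes>\<^sub>o X)) B))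
      \<in> hom C (Cod C (bq (src h) B)) (Cod C (bq (tgt h) B))"
proof -
  have id: "is_bimod_arr C A (Bimod_Arr B (\<iota> (A \<otimes>\<^sub>o X)) B)" using id_bimod_arr[OF B_bimodule] by simp
  note [simp] = bimoduleD(3-9)[OF h(2)] bimoduleD(3-9)[OF h(3)]
    coords_typing[OF h(2) B_free, simplified] coords_typing[OF h(3) B_free, simplified]
  have [simp]: "mor h \<in> Arr C" "Dom C (mor h) = under (src h)" "Cod C (mor h) = under (tgt h)"
    using h(1) by (auto simp: is_bimod_arr_def hom_def)
  note t = bimod_tensor_arr_coords[OF h(1) id h(2,3), simplified, OF B_free[simplified] B_free[simplified]]
  show "mor (bimod_tensor_arr C coeq A h (Bimod_Arr B (\<iota> (A \<otimes>\<^sub>o X)) B))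
      \<in> hom C (Cod C (bq (src h) B)) (Cod C (bq (tgt h) B))"
    using t(1) by simp
  show "coords (tgt h) B X (\<iota> (A \<otimes>\<^sub>o X)) \<cdot> mor (bimod_tensor_arr C coeq A h (Bimod_Arr B (\<iota> (A \<otimes>\<^sub>o X)) B))
    = (mor h \<otimes> \<iota> X) \<cdot> coords (src h) B X (\<iota> (A \<otimes>\<^sub>o X))"
    using t(2) arg_cong[OF bimodule_eqs(4)[OF h(2)],
        of "\<lambda>x. (mor h \<otimes> \<iota> X) \<cdot> (x \<otimes> \<iota> X) \<cdot> coords (src h) B X (\<iota> (A \<otimes>\<^sub>o X))"]
    by simp
qed

lemma id_tensor_coords:
  assumes h: "is_bimod_arr C A h" and Y: "free_bimod (src h) W i p" and Z: "free_bimod (tgt h) V j s"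
  shows "coords B (tgt h) V s \<cdot> mor (bimod_tensor_arr C coeq A (Bimod_Arr B (\<iota> (A \<otimes>\<^sub>o X)) B) h)
    = lext (X \<otimes>\<^sub>o V) ((\<psi> \<otimes> \<iota> V) \<cdot> (\<iota> X \<otimes> (s \<cdot> mor h \<cdot> i))) \<cdot> coords B (src h) W p"
    and "mor (bimod_tensor_arr C coeq A (Bimod_Arr B (\<iota> (A \<otimes>\<^sub>o X)) B) h)
      \<in> hom C (Cod C (bq B (src h))) (Cod C (bq B (tgt h)))"
proof -
  have id: "is_bimod_arr C A (Bimod_Arr B (\<iota> (A \<otimes>\<^sub>o X)) B)" using id_bimod_arr[OF B_bimodule] by simp
  note Y' = conjunct1[OF Y] conjunct2[OF Y] and Z' = conjunct1[OF Z] conjunct2[OF Z]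
  note [simp] = bimoduleD(3-9)[OF Y'(1)] bimoduleD(3-9)[OF Z'(1)]
    free_onD(6-11)[OF Y'(2)] free_onD(2)[OF Y'(2)] free_onD(6-11)[OF Z'(2)] free_onD(2)[OF Z'(2)]
    coords_typing[OF B_bimodule Y, simplified] coords_typing[OF B_bimodule Z, simplified]
  have [simp]: "mor h \<in> Arr C" "Dom C (mor h) = under (src h)" "Cod C (mor h) = under (tgt h)"
    using h(1) by (auto simp: is_bimod_arr_def hom_def)
  note t = bimod_tensor_arr_coords[OF id h _ _ Y Z, unfolded bimod_arr.sel, OF B_bimodule B_bimodule]
  show "mor (bimod_tensor_arr C coeq A (Bimod_Arr B (\<iota> (A \<otimes>\<^sub>o X)) B) h)
      \<in> hom C (Cod C (bq B (src h))) (Cod C (bq B (tgt h)))"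
    using t(1) by simp
  have "(lext X \<psi> \<otimes> \<iota> V) \<cdot> (\<iota> (A \<otimes>\<^sub>o X) \<otimes> (s \<cdot> mor h \<cdot> i))
      = lext (X \<otimes>\<^sub>o V) (\<psi> \<otimes> \<iota> V) \<cdot> (\<iota> A \<otimes> (\<iota> X \<otimes> (s \<cdot> mor h \<cdot> i)))"
    by (simp add: lext_tensor)
  also have "\<dots> = lext (X \<otimes>\<^sub>o V) ((\<psi> \<otimes> \<iota> V) \<cdot> (\<iota> X \<otimes> (s \<cdot> mor h \<cdot> i)))"
    by (rule lext_precomp) simp_all
  finally have "(lext X \<psi> \<otimes> \<iota> V) \<cdot> (\<iota> (A \<otimes>\<^sub>o X) \<otimes> (s \<cdot> mor h \<cdot> i))
      = lext (X \<otimes>\<^sub>o V) ((\<psi> \<otimes> \<iota> V) \<cdot> (\<iota> X \<otimes> (s \<cdot> mor h \<cdot> i)))" .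
  from arg_cong[OF this, of "\<lambda>x. x \<cdot> coords B (src h) W p"]
  show "coords B (tgt h) V s \<cdot> mor (bimod_tensor_arr C coeq A (Bimod_Arr B (\<iota> (A \<otimes>\<^sub>o X)) B) h)
    = lext (X \<otimes>\<^sub>o V) ((\<psi> \<otimes> \<iota> V) \<cdot> (\<iota> X \<otimes> (s \<cdot> mor h \<cdot> i))) \<cdot> coords B (src h) W p"
    using t(2) by simp
qed

end

context coflat_algebra
begin

section \<open>Ring structures\<close>

text \<open>The structure maps corresponding to \<open>\<zeta>\<close>, \<open>\<sigma>\<close>, \<open>\<delta>\<close> and \<open>f\<close>: their extensions, transported along
  the isomorphism of \<open>B \<otimes>\<^sub>A B\<close> with \<open>A \<otimes> X \<otimes> X\<close>. The comultiplication uses the inverse of that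
  isomorphism, which is the linear extension of the generators \<open>q (e \<otimes> X \<otimes> e \<otimes> X)\<close>.\<close>
definition ring_mult :: "'o \<Rightarrow> 'm \<Rightarrow> 'm \<Rightarrow> ('o, 'm) bimod_arr" where
  "ring_mult X \<psi> \<zeta> = (let B = free_bimodule C A m X (lext X \<psi>) in
     Bimod_Arr (B \<odot> B) (lext X \<zeta> \<cdot> coords B B X (\<iota> (A \<otimes>\<^sub>o X))) B)"

definition ring_unit :: "'o \<Rightarrow> 'm \<Rightarrow> 'm \<Rightarrow> ('o, 'm) bimod_arr" where
  "ring_unit X \<psi> \<sigma> = Bimod_Arr (Bimodule A m m) (lext X \<sigma>) (free_bimodule C A m X (lext X \<psi>))"

definition coring_comult :: "'o \<Rightarrow> 'm \<Rightarrow> 'm \<Rightarrow> ('o, 'm) bimod_arr" where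
  "coring_comult X \<psi> \<delta> = (let B = free_bimodule C A m X (lext X \<psi>) in
     Bimod_Arr B (lact (B \<odot> B) \<cdot> (\<iota> A \<otimes> (bq B B \<cdot> (e \<otimes> \<iota> X \<otimes> e \<otimes> \<iota> X))) \<cdot> lext (X \<otimes>\<^sub>o X) \<delta>) (B \<odot> B))"

definition coring_counit :: "'o \<Rightarrow> 'm \<Rightarrow> 'm \<Rightarrow> ('o, 'm) bimod_arr" where
  "coring_counit X \<psi> f = Bimod_Arr (free_bimodule C A m X (lext X \<psi>)) (lext \<one> f) (Bimodule A m m)"

text \<open>The equations of the theorem that involve \<open>\<zeta>\<close> and \<open>\<sigma>\<close>, or \<open>\<delta>\<close> and \<open>f\<close>, with every factor
  \<open>(m \<otimes> Q) (A \<otimes> g)\<close> read as a linear extension.\<close>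
definition ring_triple :: "'o \<Rightarrow> 'm \<Rightarrow> 'm \<Rightarrow> 'm \<Rightarrow> bool" where
  "ring_triple X \<psi> \<zeta> \<sigma> \<longleftrightarrow> \<zeta> \<in> hom C (X \<otimes>\<^sub>o X) (A \<otimes>\<^sub>o X) \<and> \<sigma> \<in> hom C \<one> (A \<otimes>\<^sub>o X) \<and>
     lext X \<psi> \<cdot> (\<zeta> \<otimes> \<iota> A) = lext X \<zeta> \<cdot> (\<psi> \<otimes> \<iota> X) \<cdot> (\<iota> X \<otimes> \<psi>) \<and>
     lext X \<zeta> \<cdot> (\<psi> \<otimes> \<iota> X) \<cdot> (\<iota> X \<otimes> \<zeta>) = lext X \<zeta> \<cdot> (\<zeta> \<otimes> \<iota> X) \<and>
     lext X \<sigma> = lext X \<psi> \<cdot> (\<sigma> \<otimes> \<iota> A) \<and>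
     lext X \<zeta> \<cdot> (\<psi> \<otimes> \<iota> X) \<cdot> (\<iota> X \<otimes> \<sigma>) = e \<otimes> \<iota> X \<and>
     e \<otimes> \<iota> X = lext X \<zeta> \<cdot> (\<sigma> \<otimes> \<iota> X)"

definition coring_triple :: "'o \<Rightarrow> 'm \<Rightarrow> 'm \<Rightarrow> 'm \<Rightarrow> bool" where
  "coring_triple X \<psi> \<delta> f \<longleftrightarrow> \<delta> \<in> hom C X (A \<otimes>\<^sub>o X \<otimes>\<^sub>o X) \<and> f \<in> hom C X A \<and>
     lext (X \<otimes>\<^sub>o X) \<delta> \<cdot> \<psi> = lext (X \<otimes>\<^sub>o X) ((\<psi> \<otimes> \<iota> X) \<cdot> (\<iota> X \<otimes> \<psi>)) \<cdot> (\<delta> \<otimes> \<iota> A) \<and>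
     lext (X \<otimes>\<^sub>o X \<otimes>\<^sub>o X) ((\<psi> \<otimes> \<iota> (X \<otimes>\<^sub>o X)) \<cdot> (\<iota> X \<otimes> \<delta>)) \<cdot> \<delta>
       = lext (X \<otimes>\<^sub>o X \<otimes>\<^sub>o X) (\<delta> \<otimes> \<iota> X) \<cdot> \<delta> \<and>
     lext \<one> f \<cdot> \<psi> = m \<cdot> (f \<otimes> \<iota> A) \<and>
     lext X (f \<otimes> \<iota> X) \<cdot> \<delta> = e \<otimes> \<iota> X \<and>
     e \<otimes> \<iota> X = lext X (\<psi> \<cdot> (\<iota> X \<otimes> f)) \<cdot> \<delta>"

lemma Bimod_Arr_eq_iff: "Bimod_Arr M x N = h \<longleftrightarrow> M = src h \<and> x = mor h \<and> N = tgt h"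
  by (cases h) auto

end

context entwined
begin

abbreviation idB :: "('o, 'm) bimod_arr" where
  "idB \<equiv> Bimod_Arr B (\<iota> (A \<otimes>\<^sub>o X)) B"

lemma B_retract: "(m \<otimes> \<iota> X) \<cdot> (\<iota> A \<otimes> e \<otimes> \<iota> X) = \<iota> (A \<otimes>\<^sub>o X)"
  using lext_ident[of X] by (simp add: lext_def)

lemma \<theta>_basis2: "\<theta> \<cdot> basis2 = e \<otimes> \<iota> (X \<otimes>\<^sub>o X)"
  by (rule free_coords_basis[OF conjunct2[OF BB_free]])

lemma ring_mult_hom_iff:
  "\<mu> \<in> hom D (B \<odot> B) B \<longleftrightarrow> (\<exists>\<zeta> \<in> hom C (X \<otimes>\<^sub>o X) (A \<otimes>\<^sub>o X). \<mu> = ring_mult X \<psi> \<zeta> \<and>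
     lext X \<zeta> \<cdot> (\<psi> \<otimes> \<iota> X) \<cdot> (\<iota> X \<otimes> \<psi>) = lext X \<psi> \<cdot> (\<zeta> \<otimes> \<iota> A))"
proof -
  have "lact B \<cdot> (\<iota> A \<otimes> e \<otimes> \<iota> X) \<cdot> lext X \<zeta> \<cdot> \<theta> = lext X \<zeta> \<cdot> \<theta>"
    if "\<zeta> \<in> hom C (X \<otimes>\<^sub>o X) (A \<otimes>\<^sub>o X)" for \<zeta>
    using that arg_cong[OF B_retract, of "\<lambda>x. x \<cdot> lext X \<zeta> \<cdot> \<theta>"] by (simp add: hom_def)
  then show ?thesis
    unfolding bimod_hom_coords[OF BB_free BB_Obj B_free B_Obj] twist_BB twist_B ring_mult_def Let_def
    by (metis (no_types, lifting))
qed

lemma ring_unit_hom_iff: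
  "u \<in> hom D U B \<longleftrightarrow> (\<exists>\<sigma> \<in> hom C \<one> (A \<otimes>\<^sub>o X). u = ring_unit X \<psi> \<sigma> \<and>
     lext X \<sigma> = lext X \<psi> \<cdot> (\<sigma> \<otimes> \<iota> A))"
proof -
  have "lact B \<cdot> (\<iota> A \<otimes> e \<otimes> \<iota> X) \<cdot> lext X \<sigma> \<cdot> \<iota> A = lext X \<sigma> \<and> lext X \<sigma> \<cdot> \<iota> A = lext X \<sigma>"
    if "\<sigma> \<in> hom C \<one> (A \<otimes>\<^sub>o X)" for \<sigma>
    using that arg_cong[OF B_retract, of "\<lambda>x. x \<cdot> lext X \<sigma>"] by (simp add: hom_def)
  then show ?thesis
    unfolding bimod_hom_coords[OF unit_free_bimod U_Obj B_free B_Obj] twist_U twist_B ring_unit_def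
    by (metis (no_types, lifting))
qed

lemma coring_comult_hom_iff:
  "\<Delta> \<in> hom D B (B \<odot> B) \<longleftrightarrow> (\<exists>\<delta> \<in> hom C X (A \<otimes>\<^sub>o X \<otimes>\<^sub>o X). \<Delta> = coring_comult X \<psi> \<delta> \<and>
     lext (X \<otimes>\<^sub>o X) \<delta> \<cdot> \<psi> = lext (X \<otimes>\<^sub>o X) ((\<psi> \<otimes> \<iota> X) \<cdot> (\<iota> X \<otimes> \<psi>)) \<cdot> (\<delta> \<otimes> \<iota> A))"
proof -
  have "lext (X \<otimes>\<^sub>o X) \<delta> \<cdot> \<iota> (A \<otimes>\<^sub>o X) = lext (X \<otimes>\<^sub>o X) \<delta>"
    if "\<delta> \<in> hom C X (A \<otimes>\<^sub>o X \<otimes>\<^sub>o X)" for \<delta>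
    using that by (simp add: hom_def)
  then show ?thesis
    unfolding bimod_hom_coords[OF B_free B_Obj BB_free BB_Obj] twist_BB twist_B coring_comult_def Let_def
    by (metis (no_types, lifting))
qed

lemma coring_counit_hom_iff:
  "\<epsilon> \<in> hom D B U \<longleftrightarrow> (\<exists>f \<in> hom C X A. \<epsilon> = coring_counit X \<psi> f \<and> lext \<one> f \<cdot> \<psi> = m \<cdot> (f \<otimes> \<iota> A))"
proof -
  have "lact U \<cdot> (\<iota> A \<otimes> e) \<cdot> lext \<one> f \<cdot> \<iota> (A \<otimes>\<^sub>o X) = lext \<one> f" if "f \<in> hom C X (A \<otimes>\<^sub>o \<one>)" for f
    using that arg_cong[OF m_unit_right, of "\<lambda>x. x \<cdot> lext \<one> f"] by (simp add: hom_def)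
  moreover have "lext \<one> (\<iota> A) = m" by (simp add: lext_def)
  moreover have "hom C X (A \<otimes>\<^sub>o \<one>) = hom C X A" by simp
  ultimately show ?thesis
    unfolding bimod_hom_coords[OF B_free B_Obj unit_free_bimod U_Obj] twist_U twist_B coring_counit_def
    by (metis (no_types, lifting))
qed

lemma \<theta>_comult:
  assumes "\<delta> \<in> hom C X (A \<otimes>\<^sub>o X \<otimes>\<^sub>o X)"
  shows "\<theta> \<cdot> mor (coring_comult X \<psi> \<delta>) = lext (X \<otimes>\<^sub>o X) \<delta>"
proof -
  have [simp]: "\<delta> \<in> Arr C" "Dom C \<delta> = X" "Cod C \<delta> = A \<otimes>\<^sub>o X \<otimes>\<^sub>o X" using assms by (auto simp: hom_def)
  note [simp] = bimoduleD(4-6)[OF BB_bimodule, simplified]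
  have "\<theta> \<cdot> mor (coring_comult X \<psi> \<delta>)
      = (\<theta> \<cdot> lact (B \<odot> B) \<cdot> (\<iota> A \<otimes> basis2)) \<cdot> lext (X \<otimes>\<^sub>o X) \<delta>"
    by (simp add: coring_comult_def Let_def)
  then show ?thesis by (simp only: free_on_eqs[OF conjunct2[OF BB_free]]) simp
qed

lemma coords3_typing:
  shows "coords (B \<odot> B) B X (\<iota> (A \<otimes>\<^sub>o X)) \<in> Arr C"
    "Dom C (coords (B \<odot> B) B X (\<iota> (A \<otimes>\<^sub>o X))) = Cod C (bq (B \<odot> B) B)"
    "Cod C (coords (B \<odot> B) B X (\<iota> (A \<otimes>\<^sub>o X))) = Cod C (bq B B) \<otimes>\<^sub>o X"
    "Cod C (bq (B \<odot> B) B) \<in> Obj C"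
    "coords B (B \<odot> B) (X \<otimes>\<^sub>o X) \<theta> \<in> Arr C"
    "Dom C (coords B (B \<odot> B) (X \<otimes>\<^sub>o X) \<theta>) = Cod C (bq B (B \<odot> B))"
    "Cod C (coords B (B \<odot> B) (X \<otimes>\<^sub>o X) \<theta>) = A \<otimes>\<^sub>o X \<otimes>\<^sub>o X \<otimes>\<^sub>o X"
    "Cod C (bq B (B \<odot> B)) \<in> Obj C" "bq B (B \<odot> B) \<in> Arr C"
  using coords_typing[OF BB_bimodule B_free] coords_typing[OF B_bimodule BB_free] by simp_all

lemma assoc_coords:
  "mor (bimod_assoc C coeq A B B B) \<in> hom C (Cod C (bq (B \<odot> B) B)) (Cod C (bq B (B \<odot> B)))"
  "coords B (B \<odot> B) (X \<otimes>\<^sub>o X) \<theta> \<cdot> mor (bimod_assoc C coeq A B B B)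
    = (\<theta> \<otimes> \<iota> X) \<cdot> coords (B \<odot> B) B X (\<iota> (A \<otimes>\<^sub>o X))"
  using bimod_assoc_coords[OF B_bimodule B_free B_free] by simp_all

lemma coords3_cancel:
  assumes [simp]: "f \<in> Arr C" "g \<in> Arr C" "Dom C f = A \<otimes>\<^sub>o X \<otimes>\<^sub>o X \<otimes>\<^sub>o X" "Dom C g = A \<otimes>\<^sub>o X \<otimes>\<^sub>o X \<otimes>\<^sub>o X"
  shows "f \<cdot> (\<theta> \<otimes> \<iota> X) \<cdot> coords (B \<odot> B) B X (\<iota> (A \<otimes>\<^sub>o X)) = g \<cdot> (\<theta> \<otimes> \<iota> X) \<cdot> coords (B \<odot> B) B X (\<iota> (A \<otimes>\<^sub>o X))
    \<longleftrightarrow> f = g"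
proof
  assume "f \<cdot> (\<theta> \<otimes> \<iota> X) \<cdot> coords (B \<odot> B) B X (\<iota> (A \<otimes>\<^sub>o X)) = g \<cdot> (\<theta> \<otimes> \<iota> X) \<cdot> coords (B \<odot> B) B X (\<iota> (A \<otimes>\<^sub>o X))"
  then have eq: "f \<cdot> (\<theta> \<otimes> \<iota> X) = g \<cdot> (\<theta> \<otimes> \<iota> X)"
    using coords_cancel[OF BB_bimodule B_free, of "f \<cdot> (\<theta> \<otimes> \<iota> X)" "g \<cdot> (\<theta> \<otimes> \<iota> X)"]
    by (simp add: coords3_typing)
  show "f = g"
    by (rule split_epi_cancel[where q = "\<theta> \<otimes> \<iota> X" and s = "(bq B B \<cdot> (\<iota> (A \<otimes>\<^sub>o X) \<otimes> e \<otimes> \<iota> X)) \<otimes> \<iota> X"];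
        use eq arg_cong[OF coords_right_inverse[OF B_bimodule B_free], of "\<lambda>x. x \<otimes> \<iota> X"] in simp)
qed simp

text \<open>In coordinates on \<open>A \<otimes> X \<otimes> X \<otimes> X\<close>, with \<open>M\<close> for \<open>lext X \<zeta>\<close>, associativity says that
  \<open>M (M \<otimes> X)\<close> equals \<open>M\<close> composed with the extension of \<open>(\<psi> \<otimes> X) (X \<otimes> \<zeta>)\<close>; restrict both to
  \<open>X \<otimes> X \<otimes> X\<close>.\<close>
lemma ring_assoc_iff:
  assumes \<zeta>: "\<zeta> \<in> hom C (X \<otimes>\<^sub>o X) (A \<otimes>\<^sub>o X)" and b: "is_bimod_arr C A (ring_mult X \<psi> \<zeta>)"
  shows "mor (ring_mult X \<psi> \<zeta>) \<cdot> mor (bimod_tensor_arr C coeq A (ring_mult X \<psi> \<zeta>) idB)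
      = mor (ring_mult X \<psi> \<zeta>) \<cdot> mor (bimod_tensor_arr C coeq A idB (ring_mult X \<psi> \<zeta>)) \<cdot> mor (bimod_assoc C coeq A B B B)
    \<longleftrightarrow> lext X \<zeta> \<cdot> (\<psi> \<otimes> \<iota> X) \<cdot> (\<iota> X \<otimes> \<zeta>) = lext X \<zeta> \<cdot> (\<zeta> \<otimes> \<iota> X)"
proof -
  have [simp]: "\<zeta> \<in> Arr C" "Dom C \<zeta> = X \<otimes>\<^sub>o X" "Cod C \<zeta> = A \<otimes>\<^sub>o X" using \<zeta> by (auto simp: hom_def)
  have sel: "src (ring_mult X \<psi> \<zeta>) = B \<odot> B" "tgt (ring_mult X \<psi> \<zeta>) = B" "mor (ring_mult X \<psi> \<zeta>) = lext X \<zeta> \<cdot> \<theta>"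
    by (simp_all add: ring_mult_def Let_def)
  define \<Theta> where "\<Theta> = coords (B \<odot> B) B X (\<iota> (A \<otimes>\<^sub>o X))"
  define \<Theta>' where "\<Theta>' = coords B (B \<odot> B) (X \<otimes>\<^sub>o X) \<theta>"
  note [simp] = coords3_typing[folded \<Theta>_def \<Theta>'_def]
  define L where "L = mor (bimod_tensor_arr C coeq A (ring_mult X \<psi> \<zeta>) idB)"
  define R where "R = mor (bimod_tensor_arr C coeq A idB (ring_mult X \<psi> \<zeta>))"
  define a where "a = mor (bimod_assoc C coeq A B B B)"
  have [simp]: "a \<in> Arr C" "Dom C a = Cod C (bq (B \<odot> B) B)" "Cod C a = Cod C (bq B (B \<odot> B))"
    and a: "\<Theta>' \<cdot> a = (\<theta> \<otimes> \<iota> X) \<cdot> \<Theta>"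
    using assoc_coords by (auto simp: a_def hom_def \<Theta>_def \<Theta>'_def)
  have [simp]: "L \<in> Arr C" "Dom C L = Cod C (bq (B \<odot> B) B)" "Cod C L = Cod C (bq B B)"
    and L: "\<theta> \<cdot> L = ((lext X \<zeta> \<cdot> \<theta>) \<otimes> \<iota> X) \<cdot> \<Theta>"
    using tensor_id_coords[OF b] B_bimodule BB_bimodule by (auto simp: sel L_def \<Theta>_def hom_def)
  have basis: "lext X \<zeta> \<cdot> \<theta> \<cdot> basis2 = \<zeta>"
    by (simp only: \<theta>_basis2) (simp add: lext_unit)
  have [simp]: "R \<in> Arr C" "Dom C R = Cod C (bq B (B \<odot> B))" "Cod C R = Cod C (bq B B)"
    and R: "\<theta> \<cdot> R = lext (X \<otimes>\<^sub>o X) ((\<psi> \<otimes> \<iota> X) \<cdot> (\<iota> X \<otimes> \<zeta>)) \<cdot> \<Theta>'"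
    using id_tensor_coords[OF b, unfolded sel, OF BB_free B_free] basis
    by (auto simp: R_def \<Theta>'_def hom_def)
  have "(lext X \<zeta> \<cdot> \<theta>) \<cdot> L = lext X \<zeta> \<cdot> (\<theta> \<cdot> L)" by simp
  also have "\<dots> = (lext X \<zeta> \<cdot> lext (X \<otimes>\<^sub>o X) (\<zeta> \<otimes> \<iota> X)) \<cdot> (\<theta> \<otimes> \<iota> X) \<cdot> \<Theta>"
    by (simp only: L) (simp add: lext_tensor)
  also have "lext X \<zeta> \<cdot> lext (X \<otimes>\<^sub>o X) (\<zeta> \<otimes> \<iota> X) = lext X (lext X \<zeta> \<cdot> (\<zeta> \<otimes> \<iota> X))"
    by (rule lext_comp) simp_all
  finally have 1: "(lext X \<zeta> \<cdot> \<theta>) \<cdot> L = lext X (lext X \<zeta> \<cdot> (\<zeta> \<otimes> \<iota> X)) \<cdot> (\<theta> \<otimes> \<iota> X) \<cdot> \<Theta>" .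
  have "(lext X \<zeta> \<cdot> \<theta>) \<cdot> R \<cdot> a = lext X \<zeta> \<cdot> (\<theta> \<cdot> R) \<cdot> a" by simp
  also have "\<dots> = (lext X \<zeta> \<cdot> lext (X \<otimes>\<^sub>o X) ((\<psi> \<otimes> \<iota> X) \<cdot> (\<iota> X \<otimes> \<zeta>))) \<cdot> (\<Theta>' \<cdot> a)"
    by (simp only: R) simp
  also have "lext X \<zeta> \<cdot> lext (X \<otimes>\<^sub>o X) ((\<psi> \<otimes> \<iota> X) \<cdot> (\<iota> X \<otimes> \<zeta>)) = lext X (lext X \<zeta> \<cdot> (\<psi> \<otimes> \<iota> X) \<cdot> (\<iota> X \<otimes> \<zeta>))"
    by (rule lext_comp) simp_all
  finally have 2: "(lext X \<zeta> \<cdot> \<theta>) \<cdot> R \<cdot> a = lext X (lext X \<zeta> \<cdot> (\<psi> \<otimes> \<iota> X) \<cdot> (\<iota> X \<otimes> \<zeta>)) \<cdot> (\<theta> \<otimes> \<iota> X) \<cdot> \<Theta>"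
    by (simp only: a)
  have "(lext X \<zeta> \<cdot> \<theta>) \<cdot> L = (lext X \<zeta> \<cdot> \<theta>) \<cdot> R \<cdot> a \<longleftrightarrow>
      lext X (lext X \<zeta> \<cdot> (\<zeta> \<otimes> \<iota> X)) = lext X (lext X \<zeta> \<cdot> (\<psi> \<otimes> \<iota> X) \<cdot> (\<iota> X \<otimes> \<zeta>))"
    unfolding 1 2 \<Theta>_def by (rule coords3_cancel) simp_all
  also have "\<dots> \<longleftrightarrow> lext X \<zeta> \<cdot> (\<zeta> \<otimes> \<iota> X) = lext X \<zeta> \<cdot> (\<psi> \<otimes> \<iota> X) \<cdot> (\<iota> X \<otimes> \<zeta>)"
    by (rule lext_inject) simp_all
  finally show ?thesis unfolding sel L_def R_def a_def by auto
qed

lemma ring_left_unit_iff: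
  assumes \<zeta>: "\<zeta> \<in> hom C (X \<otimes>\<^sub>o X) (A \<otimes>\<^sub>o X)" and \<sigma>: "\<sigma> \<in> hom C \<one> (A \<otimes>\<^sub>o X)"
    and b: "is_bimod_arr C A (ring_unit X \<psi> \<sigma>)"
  shows "mor (ring_mult X \<psi> \<zeta>) \<cdot> mor (bimod_tensor_arr C coeq A (ring_unit X \<psi> \<sigma>) idB) = mor (Lunit D B)
    \<longleftrightarrow> lext X \<zeta> \<cdot> (\<sigma> \<otimes> \<iota> X) = e \<otimes> \<iota> X"
proof -
  have [simp]: "\<zeta> \<in> Arr C" "Dom C \<zeta> = X \<otimes>\<^sub>o X" "Cod C \<zeta> = A \<otimes>\<^sub>o X" using \<zeta> by (auto simp: hom_def)
  have [simp]: "\<sigma> \<in> Arr C" "Dom C \<sigma> = \<one>" "Cod C \<sigma> = A \<otimes>\<^sub>o X" using \<sigma> by (auto simp: hom_def)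
  have sel: "src (ring_unit X \<psi> \<sigma>) = U" "tgt (ring_unit X \<psi> \<sigma>) = B" "mor (ring_unit X \<psi> \<sigma>) = lext X \<sigma>"
    "mor (ring_mult X \<psi> \<zeta>) = lext X \<zeta> \<cdot> \<theta>"
    by (simp_all add: ring_unit_def ring_mult_def Let_def)
  define \<Theta> where "\<Theta> = coords U B X (\<iota> (A \<otimes>\<^sub>o X))"
  note [simp] = coords_typing[OF U_bimodule B_free, folded \<Theta>_def, simplified]
  define L where "L = mor (bimod_tensor_arr C coeq A (ring_unit X \<psi> \<sigma>) idB)"
  have [simp]: "L \<in> Arr C" "Dom C L = Cod C (bq U B)" "Cod C L = Cod C (bq B B)"
    and L: "\<theta> \<cdot> L = (lext X \<sigma> \<otimes> \<iota> X) \<cdot> \<Theta>"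
    using tensor_id_coords[OF b] B_bimodule U_bimodule by (auto simp: sel L_def \<Theta>_def hom_def)
  have lunit: "mor (Lunit D B) = \<iota> (A \<otimes>\<^sub>o X) \<cdot> \<Theta>"
    using Lunit_coords[OF B_free] arg_cong[OF B_retract, of "\<lambda>x. x \<cdot> \<Theta>"] by (simp add: \<Theta>_def[symmetric])
  have "(lext X \<zeta> \<cdot> \<theta>) \<cdot> L = lext X \<zeta> \<cdot> (\<theta> \<cdot> L)" by simp
  also have "\<dots> = (lext X \<zeta> \<cdot> lext (X \<otimes>\<^sub>o X) (\<sigma> \<otimes> \<iota> X)) \<cdot> \<Theta>"
    by (simp only: L) (simp add: lext_tensor)
  also have "lext X \<zeta> \<cdot> lext (X \<otimes>\<^sub>o X) (\<sigma> \<otimes> \<iota> X) = lext X (lext X \<zeta> \<cdot> (\<sigma> \<otimes> \<iota> X))"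
    by (rule lext_comp) simp_all
  finally have 1: "(lext X \<zeta> \<cdot> \<theta>) \<cdot> L = lext X (lext X \<zeta> \<cdot> (\<sigma> \<otimes> \<iota> X)) \<cdot> \<Theta>" .
  have "(lext X \<zeta> \<cdot> \<theta>) \<cdot> L = mor (Lunit D B) \<longleftrightarrow> lext X (lext X \<zeta> \<cdot> (\<sigma> \<otimes> \<iota> X)) = \<iota> (A \<otimes>\<^sub>o X)"
    unfolding 1 lunit \<Theta>_def by (rule coords_cancel[OF U_bimodule B_free]) simp_all
  also have "\<dots> \<longleftrightarrow> lext X \<zeta> \<cdot> (\<sigma> \<otimes> \<iota> X) = e \<otimes> \<iota> X"
    by (rule lext_eq_ident) simp_all
  finally show ?thesis unfolding sel L_def .
qed

lemma ring_right_unit_iff: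
  assumes \<zeta>: "\<zeta> \<in> hom C (X \<otimes>\<^sub>o X) (A \<otimes>\<^sub>o X)" and \<sigma>: "\<sigma> \<in> hom C \<one> (A \<otimes>\<^sub>o X)"
    and b: "is_bimod_arr C A (ring_unit X \<psi> \<sigma>)"
  shows "mor (ring_mult X \<psi> \<zeta>) \<cdot> mor (bimod_tensor_arr C coeq A idB (ring_unit X \<psi> \<sigma>)) = mor (Runit D B)
    \<longleftrightarrow> lext X \<zeta> \<cdot> (\<psi> \<otimes> \<iota> X) \<cdot> (\<iota> X \<otimes> \<sigma>) = e \<otimes> \<iota> X"
proof -
  have [simp]: "\<zeta> \<in> Arr C" "Dom C \<zeta> = X \<otimes>\<^sub>o X" "Cod C \<zeta> = A \<otimes>\<^sub>o X" using \<zeta> by (auto simp: hom_def)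
  have [simp]: "\<sigma> \<in> Arr C" "Dom C \<sigma> = \<one>" "Cod C \<sigma> = A \<otimes>\<^sub>o X" using \<sigma> by (auto simp: hom_def)
  have sel: "src (ring_unit X \<psi> \<sigma>) = U" "tgt (ring_unit X \<psi> \<sigma>) = B" "mor (ring_unit X \<psi> \<sigma>) = lext X \<sigma>"
    "mor (ring_mult X \<psi> \<zeta>) = lext X \<zeta> \<cdot> \<theta>"
    by (simp_all add: ring_unit_def ring_mult_def Let_def)
  define \<Theta> where "\<Theta> = coords B U \<one> (\<iota> A)"
  note [simp] = coords_typing[OF B_bimodule unit_free_bimod, folded \<Theta>_def, simplified]
  define R where "R = mor (bimod_tensor_arr C coeq A idB (ring_unit X \<psi> \<sigma>))"
  have unit: "lext X \<sigma> \<cdot> e = \<sigma>" using lext_unit[of \<sigma> X \<one>] by simp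
  have [simp]: "R \<in> Arr C" "Dom C R = Cod C (bq B U)" "Cod C R = Cod C (bq B B)"
    and R: "\<theta> \<cdot> R = lext (X \<otimes>\<^sub>o X) ((\<psi> \<otimes> \<iota> X) \<cdot> (\<iota> X \<otimes> \<sigma>)) \<cdot> \<Theta>"
    using id_tensor_coords[OF b, unfolded sel, OF unit_free_bimod B_free] unit
    by (auto simp: R_def \<Theta>_def hom_def)
  have runit: "mor (Runit D B) = \<iota> (A \<otimes>\<^sub>o X) \<cdot> \<Theta>"
    using Runit_coords[OF B_bimodule] by (simp add: \<Theta>_def[symmetric])
  have "(lext X \<zeta> \<cdot> \<theta>) \<cdot> R = lext X \<zeta> \<cdot> (\<theta> \<cdot> R)" by simp
  also have "\<dots> = (lext X \<zeta> \<cdot> lext (X \<otimes>\<^sub>o X) ((\<psi> \<otimes> \<iota> X) \<cdot> (\<iota> X \<otimes> \<sigma>))) \<cdot> \<Theta>"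
    by (simp only: R) simp
  also have "lext X \<zeta> \<cdot> lext (X \<otimes>\<^sub>o X) ((\<psi> \<otimes> \<iota> X) \<cdot> (\<iota> X \<otimes> \<sigma>)) = lext X (lext X \<zeta> \<cdot> (\<psi> \<otimes> \<iota> X) \<cdot> (\<iota> X \<otimes> \<sigma>))"
    by (rule lext_comp) simp_all
  finally have 1: "(lext X \<zeta> \<cdot> \<theta>) \<cdot> R = lext X (lext X \<zeta> \<cdot> (\<psi> \<otimes> \<iota> X) \<cdot> (\<iota> X \<otimes> \<sigma>)) \<cdot> \<Theta>" .
  have "(lext X \<zeta> \<cdot> \<theta>) \<cdot> R = mor (Runit D B) \<longleftrightarrow>
      lext X (lext X \<zeta> \<cdot> (\<psi> \<otimes> \<iota> X) \<cdot> (\<iota> X \<otimes> \<sigma>)) = \<iota> (A \<otimes>\<^sub>o X)"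
    unfolding 1 runit \<Theta>_def by (rule coords_cancel[OF B_bimodule unit_free_bimod]) simp_all
  also have "\<dots> \<longleftrightarrow> lext X \<zeta> \<cdot> (\<psi> \<otimes> \<iota> X) \<cdot> (\<iota> X \<otimes> \<sigma>) = e \<otimes> \<iota> X"
    by (rule lext_eq_ident) simp_all
  finally show ?thesis unfolding sel R_def .
qed

lemma algebra_iff_ring_triple:
  "algebra D B \<mu> u \<longleftrightarrow> (\<exists>\<zeta> \<sigma>. \<mu> = ring_mult X \<psi> \<zeta> \<and> u = ring_unit X \<psi> \<sigma> \<and> ring_triple X \<psi> \<zeta> \<sigma>)"
proof -
  have core: "algebra D B (ring_mult X \<psi> \<zeta>) (ring_unit X \<psi> \<sigma>) \<longleftrightarrow> ring_triple X \<psi> \<zeta> \<sigma>"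
    if \<zeta>: "\<zeta> \<in> hom C (X \<otimes>\<^sub>o X) (A \<otimes>\<^sub>o X)" and \<sigma>: "\<sigma> \<in> hom C \<one> (A \<otimes>\<^sub>o X)"
      and h: "ring_mult X \<psi> \<zeta> \<in> hom D (B \<odot> B) B" "ring_unit X \<psi> \<sigma> \<in> hom D U B"
      and c: "lext X \<zeta> \<cdot> (\<psi> \<otimes> \<iota> X) \<cdot> (\<iota> X \<otimes> \<psi>) = lext X \<psi> \<cdot> (\<zeta> \<otimes> \<iota> A)"
        "lext X \<sigma> = lext X \<psi> \<cdot> (\<sigma> \<otimes> \<iota> A)"
    for \<zeta> \<sigma>
  proof -
    have b: "is_bimod_arr C A (ring_mult X \<psi> \<zeta>)" "is_bimod_arr C A (ring_unit X \<psi> \<sigma>)"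
      and s: "src (ring_mult X \<psi> \<zeta>) = B \<odot> B" "tgt (ring_mult X \<psi> \<zeta>) = B" "src (ring_unit X \<psi> \<sigma>) = U" "tgt (ring_unit X \<psi> \<sigma>) = B"
      using h unfolding bimod_cat_hom by auto
    show ?thesis
      using ring_assoc_iff[OF \<zeta> b(1)] ring_left_unit_iff[OF \<zeta> \<sigma> b(2)] ring_right_unit_iff[OF \<zeta> \<sigma> b(2)]
        \<zeta> \<sigma> h c B_Obj
      by (auto simp: algebra_def ring_triple_def s Bimod_Arr_eq_iff)
  qed
  show ?thesis
  proof
    assume alg: "algebra D B \<mu> u"
    then have "\<mu> \<in> hom D (B \<odot> B) B" "u \<in> hom D U B" by (auto simp: algebra_def)
    with alg core show "\<exists>\<zeta> \<sigma>. \<mu> = ring_mult X \<psi> \<zeta> \<and> u = ring_unit X \<psi> \<sigma> \<and> ring_triple X \<psi> \<zeta> \<sigma>"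
      using ring_mult_hom_iff[of \<mu>] ring_unit_hom_iff[of u] by metis
  next
    assume "\<exists>\<zeta> \<sigma>. \<mu> = ring_mult X \<psi> \<zeta> \<and> u = ring_unit X \<psi> \<sigma> \<and> ring_triple X \<psi> \<zeta> \<sigma>"
    then obtain \<zeta> \<sigma> where \<mu>: "\<mu> = ring_mult X \<psi> \<zeta>" "u = ring_unit X \<psi> \<sigma>" and t: "ring_triple X \<psi> \<zeta> \<sigma>"
      by blast
    then have "ring_mult X \<psi> \<zeta> \<in> hom D (B \<odot> B) B" "ring_unit X \<psi> \<sigma> \<in> hom D U B"
      unfolding ring_triple_def ring_mult_hom_iff ring_unit_hom_iff by metis+
    with t core[of \<zeta> \<sigma>] show "algebra D B \<mu> u"
      unfolding ring_triple_def \<mu> by metis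
  qed
qed

section \<open>Coring structures\<close>

text \<open>Dual to the ring case, except that the two sides are now compared after the coordinate isomorphism
  of the target \<open>B \<otimes>\<^sub>A (B \<otimes>\<^sub>A B)\<close>.\<close>
lemma coring_coassoc_iff:
  assumes \<delta>: "\<delta> \<in> hom C X (A \<otimes>\<^sub>o X \<otimes>\<^sub>o X)" and b: "is_bimod_arr C A (coring_comult X \<psi> \<delta>)"
  shows "mor (bimod_assoc C coeq A B B B) \<cdot> mor (bimod_tensor_arr C coeq A (coring_comult X \<psi> \<delta>) idB) \<cdot> mor (coring_comult X \<psi> \<delta>)
      = mor (bimod_tensor_arr C coeq A idB (coring_comult X \<psi> \<delta>)) \<cdot> mor (coring_comult X \<psi> \<delta>)
    \<longleftrightarrow> lext (X \<otimes>\<^sub>o X \<otimes>\<^sub>o X) ((\<psi> \<otimes> \<iota> (X \<otimes>\<^sub>o X)) \<cdot> (\<iota> X \<otimes> \<delta>)) \<cdot> \<delta> = lext (X \<otimes>\<^sub>o X \<otimes>\<^sub>o X) (\<delta> \<otimes> \<iota> X) \<cdot> \<delta>"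
proof -
  have [simp]: "\<delta> \<in> Arr C" "Dom C \<delta> = X" "Cod C \<delta> = A \<otimes>\<^sub>o X \<otimes>\<^sub>o X" using \<delta> by (auto simp: hom_def)
  define d where "d = mor (coring_comult X \<psi> \<delta>)"
  have sel: "src (coring_comult X \<psi> \<delta>) = B" "tgt (coring_comult X \<psi> \<delta>) = B \<odot> B"
    by (simp_all add: coring_comult_def Let_def)
  have [simp]: "d \<in> Arr C" "Dom C d = A \<otimes>\<^sub>o X" "Cod C d = Cod C (bq B B)"
    using b by (auto simp: is_bimod_arr_def hom_def sel d_def)
  have d: "\<theta> \<cdot> d = lext (X \<otimes>\<^sub>o X) \<delta>" using \<theta>_comult[OF \<delta>] by (simp add: d_def)
  define \<Theta> where "\<Theta> = coords (B \<odot> B) B X (\<iota> (A \<otimes>\<^sub>o X))"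
  define \<Theta>' where "\<Theta>' = coords B (B \<odot> B) (X \<otimes>\<^sub>o X) \<theta>"
  note [simp] = coords3_typing[folded \<Theta>_def \<Theta>'_def]
  define L where "L = mor (bimod_tensor_arr C coeq A (coring_comult X \<psi> \<delta>) idB)"
  define R where "R = mor (bimod_tensor_arr C coeq A idB (coring_comult X \<psi> \<delta>))"
  define a where "a = mor (bimod_assoc C coeq A B B B)"
  have [simp]: "a \<in> Arr C" "Dom C a = Cod C (bq (B \<odot> B) B)" "Cod C a = Cod C (bq B (B \<odot> B))"
    and a: "\<Theta>' \<cdot> a = (\<theta> \<otimes> \<iota> X) \<cdot> \<Theta>"
    using assoc_coords by (auto simp: a_def hom_def \<Theta>_def \<Theta>'_def)
  have [simp]: "L \<in> Arr C" "Dom C L = Cod C (bq B B)" "Cod C L = Cod C (bq (B \<odot> B) B)"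
    and L: "\<Theta> \<cdot> L = (d \<otimes> \<iota> X) \<cdot> \<theta>"
    using tensor_id_coords[OF b] B_bimodule BB_bimodule by (auto simp: sel L_def \<Theta>_def d_def hom_def)
  have "\<theta> \<cdot> d \<cdot> (e \<otimes> \<iota> X) = (\<theta> \<cdot> d) \<cdot> (e \<otimes> \<iota> X)" by simp
  then have basis: "\<theta> \<cdot> d \<cdot> (e \<otimes> \<iota> X) = \<delta>"
    by (simp only: d) (simp add: lext_unit)
  have [simp]: "R \<in> Arr C" "Dom C R = Cod C (bq B B)" "Cod C R = Cod C (bq B (B \<odot> B))"
    and R: "\<Theta>' \<cdot> R = lext (X \<otimes>\<^sub>o X \<otimes>\<^sub>o X) ((\<psi> \<otimes> \<iota> (X \<otimes>\<^sub>o X)) \<cdot> (\<iota> X \<otimes> \<delta>)) \<cdot> \<theta>"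
    using id_tensor_coords[OF b, unfolded sel, OF B_free BB_free, folded d_def, unfolded basis]
    by (auto simp: R_def \<Theta>'_def hom_def)
  have "\<Theta>' \<cdot> a \<cdot> L \<cdot> d = (\<Theta>' \<cdot> a) \<cdot> L \<cdot> d" by simp
  also have "\<dots> = (\<theta> \<otimes> \<iota> X) \<cdot> (\<Theta> \<cdot> L) \<cdot> d" by (simp only: a) simp
  also have "\<dots> = ((\<theta> \<cdot> d) \<otimes> \<iota> X) \<cdot> (\<theta> \<cdot> d)" by (simp only: L) simp
  also have "\<dots> = lext (X \<otimes>\<^sub>o X \<otimes>\<^sub>o X) (\<delta> \<otimes> \<iota> X) \<cdot> lext (X \<otimes>\<^sub>o X) \<delta>"
    by (simp only: d) (simp add: lext_tensor)
  also have "\<dots> = lext (X \<otimes>\<^sub>o X \<otimes>\<^sub>o X) (lext (X \<otimes>\<^sub>o X \<otimes>\<^sub>o X) (\<delta> \<otimes> \<iota> X) \<cdot> \<delta>)"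
    by (rule lext_comp) simp_all
  finally have 1: "\<Theta>' \<cdot> a \<cdot> L \<cdot> d = lext (X \<otimes>\<^sub>o X \<otimes>\<^sub>o X) (lext (X \<otimes>\<^sub>o X \<otimes>\<^sub>o X) (\<delta> \<otimes> \<iota> X) \<cdot> \<delta>)" .
  have "\<Theta>' \<cdot> R \<cdot> d = (\<Theta>' \<cdot> R) \<cdot> d" by simp
  also have "\<dots> = lext (X \<otimes>\<^sub>o X \<otimes>\<^sub>o X) ((\<psi> \<otimes> \<iota> (X \<otimes>\<^sub>o X)) \<cdot> (\<iota> X \<otimes> \<delta>)) \<cdot> (\<theta> \<cdot> d)"
    by (simp only: R) simp
  also have "\<dots> = lext (X \<otimes>\<^sub>o X \<otimes>\<^sub>o X) (lext (X \<otimes>\<^sub>o X \<otimes>\<^sub>o X) ((\<psi> \<otimes> \<iota> (X \<otimes>\<^sub>o X)) \<cdot> (\<iota> X \<otimes> \<delta>)) \<cdot> \<delta>)"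
    unfolding d by (rule lext_comp) simp_all
  finally have 2: "\<Theta>' \<cdot> R \<cdot> d
      = lext (X \<otimes>\<^sub>o X \<otimes>\<^sub>o X) (lext (X \<otimes>\<^sub>o X \<otimes>\<^sub>o X) ((\<psi> \<otimes> \<iota> (X \<otimes>\<^sub>o X)) \<cdot> (\<iota> X \<otimes> \<delta>)) \<cdot> \<delta>)" .
  have "a \<cdot> L \<cdot> d = R \<cdot> d \<longleftrightarrow> \<Theta>' \<cdot> a \<cdot> L \<cdot> d = \<Theta>' \<cdot> R \<cdot> d"
    unfolding \<Theta>'_def by (rule coords_cancel_left[OF B_bimodule BB_free, symmetric]) simp_all
  also have "\<dots> \<longleftrightarrow> lext (X \<otimes>\<^sub>o X \<otimes>\<^sub>o X) (\<delta> \<otimes> \<iota> X) \<cdot> \<delta>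
      = lext (X \<otimes>\<^sub>o X \<otimes>\<^sub>o X) ((\<psi> \<otimes> \<iota> (X \<otimes>\<^sub>o X)) \<cdot> (\<iota> X \<otimes> \<delta>)) \<cdot> \<delta>"
    unfolding 1 2 by (rule lext_inject) simp_all
  finally show ?thesis unfolding d_def L_def R_def a_def by auto
qed

lemma coring_left_counit_iff:
  assumes \<delta>: "\<delta> \<in> hom C X (A \<otimes>\<^sub>o X \<otimes>\<^sub>o X)" and f: "f \<in> hom C X A"
    and b: "is_bimod_arr C A (coring_comult X \<psi> \<delta>)" "is_bimod_arr C A (coring_counit X \<psi> f)"
  shows "mor (Lunit D B) \<cdot> mor (bimod_tensor_arr C coeq A (coring_counit X \<psi> f) idB) \<cdot> mor (coring_comult X \<psi> \<delta>) = \<iota> (A \<otimes>\<^sub>o X)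
    \<longleftrightarrow> lext X (f \<otimes> \<iota> X) \<cdot> \<delta> = e \<otimes> \<iota> X"
proof -
  have [simp]: "\<delta> \<in> Arr C" "Dom C \<delta> = X" "Cod C \<delta> = A \<otimes>\<^sub>o X \<otimes>\<^sub>o X" using \<delta> by (auto simp: hom_def)
  have [simp]: "f \<in> Arr C" "Dom C f = X" "Cod C f = A" using f by (auto simp: hom_def)
  define d where "d = mor (coring_comult X \<psi> \<delta>)"
  have sel: "src (coring_comult X \<psi> \<delta>) = B" "tgt (coring_comult X \<psi> \<delta>) = B \<odot> B"
    "src (coring_counit X \<psi> f) = B" "tgt (coring_counit X \<psi> f) = U" "mor (coring_counit X \<psi> f) = lext \<one> f"
    by (simp_all add: coring_comult_def coring_counit_def Let_def)
  have [simp]: "d \<in> Arr C" "Dom C d = A \<otimes>\<^sub>o X" "Cod C d = Cod C (bq B B)"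
    using b by (auto simp: is_bimod_arr_def hom_def sel d_def)
  have d: "\<theta> \<cdot> d = lext (X \<otimes>\<^sub>o X) \<delta>" using \<theta>_comult[OF \<delta>] by (simp add: d_def)
  define \<Theta> where "\<Theta> = coords U B X (\<iota> (A \<otimes>\<^sub>o X))"
  note [simp] = coords_typing[OF U_bimodule B_free, folded \<Theta>_def, simplified]
  define L where "L = mor (bimod_tensor_arr C coeq A (coring_counit X \<psi> f) idB)"
  have [simp]: "L \<in> Arr C" "Dom C L = Cod C (bq B B)" "Cod C L = Cod C (bq U B)"
    and L: "\<Theta> \<cdot> L = (lext \<one> f \<otimes> \<iota> X) \<cdot> \<theta>"
    using tensor_id_coords[OF b(2)] B_bimodule U_bimodule by (auto simp: sel L_def \<Theta>_def hom_def)
  have lunit: "mor (Lunit D B) = \<Theta>"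
    using Lunit_coords[OF B_free] arg_cong[OF B_retract, of "\<lambda>x. x \<cdot> \<Theta>"] by (simp add: \<Theta>_def[symmetric])
  have "\<Theta> \<cdot> L \<cdot> d = (\<Theta> \<cdot> L) \<cdot> d" by simp
  also have "\<dots> = (lext \<one> f \<otimes> \<iota> X) \<cdot> (\<theta> \<cdot> d)" by (simp only: L) simp
  also have "\<dots> = lext X (f \<otimes> \<iota> X) \<cdot> lext (X \<otimes>\<^sub>o X) \<delta>" by (simp only: d) (simp add: lext_tensor)
  also have "\<dots> = lext X (lext X (f \<otimes> \<iota> X) \<cdot> \<delta>)" by (rule lext_comp) simp_all
  finally have 1: "\<Theta> \<cdot> L \<cdot> d = lext X (lext X (f \<otimes> \<iota> X) \<cdot> \<delta>)" .
  have "\<Theta> \<cdot> L \<cdot> d = \<iota> (A \<otimes>\<^sub>o X) \<longleftrightarrow> lext X (f \<otimes> \<iota> X) \<cdot> \<delta> = e \<otimes> \<iota> X"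
    unfolding 1 by (rule lext_eq_ident) simp_all
  then show ?thesis unfolding lunit L_def d_def .
qed

lemma coring_right_counit_iff:
  assumes \<delta>: "\<delta> \<in> hom C X (A \<otimes>\<^sub>o X \<otimes>\<^sub>o X)" and f: "f \<in> hom C X A"
    and b: "is_bimod_arr C A (coring_comult X \<psi> \<delta>)" "is_bimod_arr C A (coring_counit X \<psi> f)"
  shows "mor (Runit D B) \<cdot> mor (bimod_tensor_arr C coeq A idB (coring_counit X \<psi> f)) \<cdot> mor (coring_comult X \<psi> \<delta>) = \<iota> (A \<otimes>\<^sub>o X)
    \<longleftrightarrow> lext X (\<psi> \<cdot> (\<iota> X \<otimes> f)) \<cdot> \<delta> = e \<otimes> \<iota> X"
proof -
  have [simp]: "\<delta> \<in> Arr C" "Dom C \<delta> = X" "Cod C \<delta> = A \<otimes>\<^sub>o X \<otimes>\<^sub>o X" using \<delta> by (auto simp: hom_def)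
  have [simp]: "f \<in> Arr C" "Dom C f = X" "Cod C f = A" using f by (auto simp: hom_def)
  define d where "d = mor (coring_comult X \<psi> \<delta>)"
  have sel: "src (coring_comult X \<psi> \<delta>) = B" "tgt (coring_comult X \<psi> \<delta>) = B \<odot> B"
    "src (coring_counit X \<psi> f) = B" "tgt (coring_counit X \<psi> f) = U" "mor (coring_counit X \<psi> f) = lext \<one> f"
    by (simp_all add: coring_comult_def coring_counit_def Let_def)
  have [simp]: "d \<in> Arr C" "Dom C d = A \<otimes>\<^sub>o X" "Cod C d = Cod C (bq B B)"
    using b by (auto simp: is_bimod_arr_def hom_def sel d_def)
  have d: "\<theta> \<cdot> d = lext (X \<otimes>\<^sub>o X) \<delta>" using \<theta>_comult[OF \<delta>] by (simp add: d_def)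
  define \<Theta> where "\<Theta> = coords B U \<one> (\<iota> A)"
  note [simp] = coords_typing[OF B_bimodule unit_free_bimod, folded \<Theta>_def, simplified]
  define R where "R = mor (bimod_tensor_arr C coeq A idB (coring_counit X \<psi> f))"
  have basis: "\<iota> A \<cdot> lext \<one> f \<cdot> (e \<otimes> \<iota> X) = f" by (simp add: lext_unit)
  have [simp]: "R \<in> Arr C" "Dom C R = Cod C (bq B B)" "Cod C R = Cod C (bq B U)"
    and R: "\<Theta> \<cdot> R = lext X (\<psi> \<cdot> (\<iota> X \<otimes> f)) \<cdot> \<theta>"
    using id_tensor_coords[OF b(2), unfolded sel, OF B_free unit_free_bimod, unfolded basis]
    by (auto simp: R_def \<Theta>_def hom_def)
  have runit: "mor (Runit D B) = \<Theta>"
    using Runit_coords[OF B_bimodule] by (simp add: \<Theta>_def[symmetric])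
  have "\<Theta> \<cdot> R \<cdot> d = (\<Theta> \<cdot> R) \<cdot> d" by simp
  also have "\<dots> = lext X (\<psi> \<cdot> (\<iota> X \<otimes> f)) \<cdot> (\<theta> \<cdot> d)" by (simp only: R) simp
  also have "\<dots> = lext X (lext X (\<psi> \<cdot> (\<iota> X \<otimes> f)) \<cdot> \<delta>)"
    unfolding d by (rule lext_comp) simp_all
  finally have 1: "\<Theta> \<cdot> R \<cdot> d = lext X (lext X (\<psi> \<cdot> (\<iota> X \<otimes> f)) \<cdot> \<delta>)" .
  have "\<Theta> \<cdot> R \<cdot> d = \<iota> (A \<otimes>\<^sub>o X) \<longleftrightarrow> lext X (\<psi> \<cdot> (\<iota> X \<otimes> f)) \<cdot> \<delta> = e \<otimes> \<iota> X"
    unfolding 1 by (rule lext_eq_ident) simp_all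
  then show ?thesis unfolding runit R_def d_def .
qed

lemma coalgebra_iff_coring_triple:
  "coalgebra D B \<Delta> \<epsilon> \<longleftrightarrow> (\<exists>\<delta> f. \<Delta> = coring_comult X \<psi> \<delta> \<and> \<epsilon> = coring_counit X \<psi> f \<and> coring_triple X \<psi> \<delta> f)"
proof -
  have core: "coalgebra D B (coring_comult X \<psi> \<delta>) (coring_counit X \<psi> f) \<longleftrightarrow> coring_triple X \<psi> \<delta> f"
    if \<delta>: "\<delta> \<in> hom C X (A \<otimes>\<^sub>o X \<otimes>\<^sub>o X)" and f: "f \<in> hom C X A"
      and h: "coring_comult X \<psi> \<delta> \<in> hom D B (B \<odot> B)" "coring_counit X \<psi> f \<in> hom D B U"
      and c: "lext (X \<otimes>\<^sub>o X) \<delta> \<cdot> \<psi> = lext (X \<otimes>\<^sub>o X) ((\<psi> \<otimes> \<iota> X) \<cdot> (\<iota> X \<otimes> \<psi>)) \<cdot> (\<delta> \<otimes> \<iota> A)"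
        "lext \<one> f \<cdot> \<psi> = m \<cdot> (f \<otimes> \<iota> A)"
    for \<delta> f
  proof -
    have b: "is_bimod_arr C A (coring_comult X \<psi> \<delta>)" "is_bimod_arr C A (coring_counit X \<psi> f)"
      and s: "src (coring_comult X \<psi> \<delta>) = B" "tgt (coring_comult X \<psi> \<delta>) = B \<odot> B"
        "src (coring_counit X \<psi> f) = B" "tgt (coring_counit X \<psi> f) = U"
      using h unfolding bimod_cat_hom by auto
    show ?thesis
      using coring_coassoc_iff[OF \<delta> b(1)] coring_left_counit_iff[OF \<delta> f b] coring_right_counit_iff[OF \<delta> f b]
        \<delta> f h c B_Obj
      by (auto simp: coalgebra_def coring_triple_def s Bimod_Arr_eq_iff)
  qed
  show ?thesis
  proof
    assume coalg: "coalgebra D B \<Delta> \<epsilon>"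
    then have "\<Delta> \<in> hom D B (B \<odot> B)" "\<epsilon> \<in> hom D B U" by (auto simp: coalgebra_def)
    with coalg core show "\<exists>\<delta> f. \<Delta> = coring_comult X \<psi> \<delta> \<and> \<epsilon> = coring_counit X \<psi> f \<and> coring_triple X \<psi> \<delta> f"
      using coring_comult_hom_iff[of \<Delta>] coring_counit_hom_iff[of \<epsilon>] by metis
  next
    assume "\<exists>\<delta> f. \<Delta> = coring_comult X \<psi> \<delta> \<and> \<epsilon> = coring_counit X \<psi> f \<and> coring_triple X \<psi> \<delta> f"
    then obtain \<delta> f where \<Delta>: "\<Delta> = coring_comult X \<psi> \<delta>" "\<epsilon> = coring_counit X \<psi> f" and t: "coring_triple X \<psi> \<delta> f"
      by blast
    then have "coring_comult X \<psi> \<delta> \<in> hom D B (B \<odot> B)" "coring_counit X \<psi> f \<in> hom D B U"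
      unfolding coring_triple_def coring_comult_hom_iff coring_counit_hom_iff by metis+
    with t core[of \<delta> f] show "coalgebra D B \<Delta> \<epsilon>"
      unfolding coring_triple_def \<Delta> by metis
  qed
qed

end

context coflat_algebra
begin

section \<open>The bijections\<close>

definition entwining :: "'o \<Rightarrow> 'm \<Rightarrow> bool" where
  "entwining X \<psi> \<longleftrightarrow> \<psi> \<in> hom C (X \<otimes>\<^sub>o A) (A \<otimes>\<^sub>o X) \<and>
     \<psi> \<cdot> (\<iota> X \<otimes> m) = lext X \<psi> \<cdot> (\<psi> \<otimes> \<iota> A) \<and> \<psi> \<cdot> (\<iota> X \<otimes> e) = e \<otimes> \<iota> X"

lemma entwined_iff: "left_coflat C X \<Longrightarrow> entwined C coeq A m e X \<psi> \<longleftrightarrow> entwining X \<psi>"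
  unfolding entwined_def entwined_axioms_def entwining_def using coflat_algebra_axioms by blast

text \<open>Membership of the bimodule in the category is part of a (co)ring structure, so the right action
  always comes from an entwining.\<close>
lemma Obj_free_bimodule:
  assumes "left_coflat C X" "free_bimodule C A m X r \<in> Obj D"
  obtains \<psi> where "r = lext X \<psi>" "entwining X \<psi>"
proof -
  have X: "X \<in> Obj C" using assms(1) by (simp add: left_coflat_def)
  have B: "bimodule (free_bimodule C A m X r)" using Obj_bimodule[OF assms(2)] .
  show thesis
    using that[OF free_bimodule_action(2)[OF X B]] free_bimodule_iff[OF X free_bimodule_action(1)[OF X B]]
      free_bimodule_action[OF X B] B
    by (metis entwining_def)
qed

text \<open>Extension is inverse to restriction along the unit: ring structures are by
  \<open>algebra_iff_ring_triple\<close> exactly the extensions of triples, and restricting an extension returns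
  the triple by \<open>lext_unit\<close>.\<close>
lemma bij_betw_ring_data:
  assumes X: "left_coflat C X"
  shows "bij_betw (ring_data C coeq A m e X) (ring_structures C coeq A m e X)
    {(\<psi>, \<zeta>, \<sigma>). entwining X \<psi> \<and> ring_triple X \<psi> \<zeta> \<sigma>}"
proof -
  let ?g = "\<lambda>(\<psi>, \<zeta>, \<sigma>). (lext X \<psi>, ring_mult X \<psi> \<zeta>, ring_unit X \<psi> \<sigma>)"
  let ?T = "{(\<psi>, \<zeta>, \<sigma>). entwining X \<psi> \<and> ring_triple X \<psi> \<zeta> \<sigma>}"
  have S: "ring_structures C coeq A m e X = ?g ` ?T"
  proof (intro equalityI subsetI)
    fix s assume "s \<in> ring_structures C coeq A m e X"
    then obtain r \<mu> u where s: "s = (r, \<mu>, u)" and alg: "algebra D (free_bimodule C A m X r) \<mu> u"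
      by (auto simp: ring_structures_def)
    then obtain \<psi> where \<psi>: "r = lext X \<psi>" "entwining X \<psi>"
      by (auto simp: algebra_def elim: Obj_free_bimodule[OF X])
    then interpret entwined C coeq A m e X \<psi> by (simp add: entwined_iff[OF X])
    show "s \<in> ?g ` ?T"
      using alg \<psi>(2) unfolding s \<psi>(1) algebra_iff_ring_triple by force
  next
    fix s assume "s \<in> ?g ` ?T"
    then obtain \<psi> \<zeta> \<sigma> where s: "s = (lext X \<psi>, ring_mult X \<psi> \<zeta>, ring_unit X \<psi> \<sigma>)"
      and \<psi>: "entwining X \<psi>" and t: "ring_triple X \<psi> \<zeta> \<sigma>" by auto
    then interpret entwined C coeq A m e X \<psi> by (simp add: entwined_iff[OF X])
    show "s \<in> ring_structures C coeq A m e X"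
      using t unfolding s ring_structures_def by (auto simp: algebra_iff_ring_triple)
  qed
  have id: "ring_data C coeq A m e X (?g t) = t" if tT: "t \<in> ?T" for t
  proof -
    obtain \<psi> \<zeta> \<sigma> where t: "t = (\<psi>, \<zeta>, \<sigma>)" and \<psi>: "entwining X \<psi>" and c: "ring_triple X \<psi> \<zeta> \<sigma>"
      using tT by auto
    then interpret entwined C coeq A m e X \<psi> by (simp add: entwined_iff[OF X])
    have [simp]: "\<zeta> \<in> Arr C" "Dom C \<zeta> = X \<otimes>\<^sub>o X" "Cod C \<zeta> = A \<otimes>\<^sub>o X"
        "\<sigma> \<in> Arr C" "Dom C \<sigma> = \<one>" "Cod C \<sigma> = A \<otimes>\<^sub>o X"
      using c by (auto simp: ring_triple_def hom_def)
    have "(lext X \<zeta> \<cdot> \<theta>) \<cdot> basis2 = lext X \<zeta> \<cdot> (\<theta> \<cdot> basis2)" by simp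
    also have "\<dots> = \<zeta>" by (simp only: \<theta>_basis2) (simp add: lext_unit)
    finally show ?thesis
      using lext_unit[of \<psi> X "X \<otimes>\<^sub>o A"] lext_unit[of \<sigma> X \<one>]
      by (simp add: t ring_data_def ring_mult_def ring_unit_def Let_def)
  qed
  show ?thesis
    unfolding S by (rule bij_betw_byWitness[where f' = ?g]) (use id in \<open>auto simp del: split_paired_All\<close>)
qed

lemma bij_betw_coring_data:
  assumes X: "left_coflat C X"
  shows "bij_betw (coring_data C coeq A m e X) (coring_structures C coeq A m e X)
    {(\<psi>, \<delta>, f). entwining X \<psi> \<and> coring_triple X \<psi> \<delta> f}"
proof -
  let ?g = "\<lambda>(\<psi>, \<delta>, f). (lext X \<psi>, coring_comult X \<psi> \<delta>, coring_counit X \<psi> f)"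
  let ?T = "{(\<psi>, \<delta>, f). entwining X \<psi> \<and> coring_triple X \<psi> \<delta> f}"
  have S: "coring_structures C coeq A m e X = ?g ` ?T"
  proof (intro equalityI subsetI)
    fix s assume "s \<in> coring_structures C coeq A m e X"
    then obtain r \<Delta> \<epsilon> where s: "s = (r, \<Delta>, \<epsilon>)" and alg: "coalgebra D (free_bimodule C A m X r) \<Delta> \<epsilon>"
      by (auto simp: coring_structures_def)
    then obtain \<psi> where \<psi>: "r = lext X \<psi>" "entwining X \<psi>"
      by (auto simp: coalgebra_def elim: Obj_free_bimodule[OF X])
    then interpret entwined C coeq A m e X \<psi> by (simp add: entwined_iff[OF X])
    show "s \<in> ?g ` ?T"
      using alg \<psi>(2) unfolding s \<psi>(1) coalgebra_iff_coring_triple by force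
  next
    fix s assume "s \<in> ?g ` ?T"
    then obtain \<psi> \<delta> f where s: "s = (lext X \<psi>, coring_comult X \<psi> \<delta>, coring_counit X \<psi> f)"
      and \<psi>: "entwining X \<psi>" and t: "coring_triple X \<psi> \<delta> f" by auto
    then interpret entwined C coeq A m e X \<psi> by (simp add: entwined_iff[OF X])
    show "s \<in> coring_structures C coeq A m e X"
      using t unfolding s coring_structures_def by (auto simp: coalgebra_iff_coring_triple)
  qed
  have id: "coring_data C coeq A m e X (?g t) = t" if tT: "t \<in> ?T" for t
  proof -
    obtain \<psi> \<delta> f where t: "t = (\<psi>, \<delta>, f)" and \<psi>: "entwining X \<psi>" and c: "coring_triple X \<psi> \<delta> f"
      using tT by auto
    then interpret entwined C coeq A m e X \<psi> by (simp add: entwined_iff[OF X])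
    have \<delta>: "\<delta> \<in> hom C X (A \<otimes>\<^sub>o X \<otimes>\<^sub>o X)"
      and [simp]: "\<delta> \<in> Arr C" "Dom C \<delta> = X" "Cod C \<delta> = A \<otimes>\<^sub>o X \<otimes>\<^sub>o X"
        "f \<in> Arr C" "Dom C f = X" "Cod C f = A"
      using c by (auto simp: coring_triple_def hom_def)
    have \<theta>: "induced C (bq B B) (lext X \<psi> \<otimes> \<iota> X) = \<theta>"
      by (simp add: coords_def tensor_coords_def bimod_q_def)
    have [simp]: "mor (coring_comult X \<psi> \<delta>) \<in> Arr C" "Dom C (mor (coring_comult X \<psi> \<delta>)) = A \<otimes>\<^sub>o X"
      "Cod C (mor (coring_comult X \<psi> \<delta>)) = Cod C (bq B B)"
      using bimoduleD(4-6)[OF BB_bimodule] by (simp_all add: coring_comult_def Let_def)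
    have "\<theta> \<cdot> mor (coring_comult X \<psi> \<delta>) \<cdot> (e \<otimes> \<iota> X) = (\<theta> \<cdot> mor (coring_comult X \<psi> \<delta>)) \<cdot> (e \<otimes> \<iota> X)"
      by simp
    also have "\<dots> = \<delta>" by (simp only: \<theta>_comult[OF \<delta>]) (simp add: lext_unit)
    finally have "coring_data C coeq A m e X (lext X \<psi>, coring_comult X \<psi> \<delta>, coring_counit X \<psi> f)
        = (\<psi>, \<delta>, f)"
      using lext_unit[of \<psi> X "X \<otimes>\<^sub>o A"] lext_unit[of f \<one> X]
      by (simp add: coring_data_def Let_def \<theta> coring_counit_def)
    then show ?thesis by (simp add: t)
  qed
  show ?thesis
    unfolding S by (rule bij_betw_byWitness[where f' = ?g]) (use id in \<open>auto simp del: split_paired_All\<close>)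
qed

end

theorem proposition2p6:
  fixes C :: "('o, 'm) moncat" (structure)
    and coeq :: "'m \<Rightarrow> 'm \<Rightarrow> 'm"
    and A X :: 'o
    and m \<eta> :: 'm
  assumes "strict_monoidal_category C"
    and "has_coequalizers C"
    and "coequalizer_choice C coeq"
    and "algebra C A m \<eta>"
    and "left_coflat C A"
    and "left_coflat C X"
  shows "bij_betw (ring_data C coeq A m \<eta> X) (ring_structures C coeq A m \<eta> X)
      {(\<psi>, \<zeta>, \<sigma>).
         \<psi> \<in> hom C (X \<otimes>\<^sub>o A) (A \<otimes>\<^sub>o X) \<and>
         \<zeta> \<in> hom C (X \<otimes>\<^sub>o X) (A \<otimes>\<^sub>o X) \<and>
         \<sigma> \<in> hom C \<one> (A \<otimes>\<^sub>o X) \<and>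
         \<psi> \<cdot> (\<iota> X \<otimes> m) = (m \<otimes> \<iota> X) \<cdot> (\<iota> A \<otimes> \<psi>) \<cdot> (\<psi> \<otimes> \<iota> A) \<and>
         \<psi> \<cdot> (\<iota> X \<otimes> \<eta>) = \<eta> \<otimes> \<iota> X \<and>
         (m \<otimes> \<iota> X) \<cdot> (\<iota> A \<otimes> \<psi>) \<cdot> (\<zeta> \<otimes> \<iota> A)
           = (m \<otimes> \<iota> X) \<cdot> (\<iota> A \<otimes> \<zeta>) \<cdot> (\<psi> \<otimes> \<iota> X) \<cdot> (\<iota> X \<otimes> \<psi>) \<and>
         (m \<otimes> \<iota> X) \<cdot> (\<iota> A \<otimes> \<zeta>) \<cdot> (\<psi> \<otimes> \<iota> X) \<cdot> (\<iota> X \<otimes> \<zeta>)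
           = (m \<otimes> \<iota> X) \<cdot> (\<iota> A \<otimes> \<zeta>) \<cdot> (\<zeta> \<otimes> \<iota> X) \<and>
         (m \<otimes> \<iota> X) \<cdot> (\<iota> A \<otimes> \<sigma>) = (m \<otimes> \<iota> X) \<cdot> (\<iota> A \<otimes> \<psi>) \<cdot> (\<sigma> \<otimes> \<iota> A) \<and>
         (m \<otimes> \<iota> X) \<cdot> (\<iota> A \<otimes> \<zeta>) \<cdot> (\<psi> \<otimes> \<iota> X) \<cdot> (\<iota> X \<otimes> \<sigma>) = \<eta> \<otimes> \<iota> X \<and>
         \<eta> \<otimes> \<iota> X = (m \<otimes> \<iota> X) \<cdot> (\<iota> A \<otimes> \<zeta>) \<cdot> (\<sigma> \<otimes> \<iota> X)}
    \<and> bij_betw (coring_data C coeq A m \<eta> X) (coring_structures C coeq A m \<eta> X)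
      {(\<psi>, \<delta>, f).
         \<psi> \<in> hom C (X \<otimes>\<^sub>o A) (A \<otimes>\<^sub>o X) \<and>
         \<delta> \<in> hom C X (A \<otimes>\<^sub>o X \<otimes>\<^sub>o X) \<and>
         f \<in> hom C X A \<and>
         \<psi> \<cdot> (\<iota> X \<otimes> m) = (m \<otimes> \<iota> X) \<cdot> (\<iota> A \<otimes> \<psi>) \<cdot> (\<psi> \<otimes> \<iota> A) \<and>
         \<psi> \<cdot> (\<iota> X \<otimes> \<eta>) = \<eta> \<otimes> \<iota> X \<and>
         (m \<otimes> \<iota> X \<otimes> \<iota> X) \<cdot> (\<iota> A \<otimes> \<delta>) \<cdot> \<psi>
           = (m \<otimes> \<iota> X \<otimes> \<iota> X) \<cdot> (\<iota> A \<otimes> \<psi> \<otimes> \<iota> X) \<cdot> (\<iota> A \<otimes> \<iota> X \<otimes> \<psi>) \<cdot> (\<delta> \<otimes> \<iota> A) \<and>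
         (m \<otimes> \<iota> X \<otimes> \<iota> X \<otimes> \<iota> X) \<cdot> (\<iota> A \<otimes> \<psi> \<otimes> \<iota> X \<otimes> \<iota> X) \<cdot> (\<iota> A \<otimes> \<iota> X \<otimes> \<delta>) \<cdot> \<delta>
           = (m \<otimes> \<iota> X \<otimes> \<iota> X \<otimes> \<iota> X) \<cdot> (\<iota> A \<otimes> \<delta> \<otimes> \<iota> X) \<cdot> \<delta> \<and>
         m \<cdot> (\<iota> A \<otimes> f) \<cdot> \<psi> = m \<cdot> (f \<otimes> \<iota> A) \<and>
         (m \<otimes> \<iota> X) \<cdot> (\<iota> A \<otimes> f \<otimes> \<iota> X) \<cdot> \<delta> = \<eta> \<otimes> \<iota> X \<and>
         \<eta> \<otimes> \<iota> X = (m \<otimes> \<iota> X) \<cdot> (\<iota> A \<otimes> \<psi>) \<cdot> (\<iota> A \<otimes> \<iota> X \<otimes> f) \<cdot> \<delta>}"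
proof -
  interpret strict_monoidal_category C by fact
  interpret coflat_algebra C coeq A m \<eta>
    using assms by unfold_locales
  have [simp]: "X \<in> Obj C" using assms(6) by (simp add: left_coflat_def)
  \<comment> \<open>It remains to expand the linear extensions in the conditions.\<close>
  have ring: "entwining X \<psi> \<and> ring_triple X \<psi> \<zeta> \<sigma> \<longleftrightarrow>
         \<psi> \<in> hom C (X \<otimes>\<^sub>o A) (A \<otimes>\<^sub>o X) \<and>
         \<zeta> \<in> hom C (X \<otimes>\<^sub>o X) (A \<otimes>\<^sub>o X) \<and>
         \<sigma> \<in> hom C \<one> (A \<otimes>\<^sub>o X) \<and>
         \<psi> \<cdot> (\<iota> X \<otimes> m) = (m \<otimes> \<iota> X) \<cdot> (\<iota> A \<otimes> \<psi>) \<cdot> (\<psi> \<otimes> \<iota> A) \<and>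
         \<psi> \<cdot> (\<iota> X \<otimes> \<eta>) = \<eta> \<otimes> \<iota> X \<and>
         (m \<otimes> \<iota> X) \<cdot> (\<iota> A \<otimes> \<psi>) \<cdot> (\<zeta> \<otimes> \<iota> A)
           = (m \<otimes> \<iota> X) \<cdot> (\<iota> A \<otimes> \<zeta>) \<cdot> (\<psi> \<otimes> \<iota> X) \<cdot> (\<iota> X \<otimes> \<psi>) \<and>
         (m \<otimes> \<iota> X) \<cdot> (\<iota> A \<otimes> \<zeta>) \<cdot> (\<psi> \<otimes> \<iota> X) \<cdot> (\<iota> X \<otimes> \<zeta>)
           = (m \<otimes> \<iota> X) \<cdot> (\<iota> A \<otimes> \<zeta>) \<cdot> (\<zeta> \<otimes> \<iota> X) \<and>
         (m \<otimes> \<iota> X) \<cdot> (\<iota> A \<otimes> \<sigma>) = (m \<otimes> \<iota> X) \<cdot> (\<iota> A \<otimes> \<psi>) \<cdot> (\<sigma> \<otimes> \<iota> A) \<and>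
         (m \<otimes> \<iota> X) \<cdot> (\<iota> A \<otimes> \<zeta>) \<cdot> (\<psi> \<otimes> \<iota> X) \<cdot> (\<iota> X \<otimes> \<sigma>) = \<eta> \<otimes> \<iota> X \<and>
         \<eta> \<otimes> \<iota> X = (m \<otimes> \<iota> X) \<cdot> (\<iota> A \<otimes> \<zeta>) \<cdot> (\<sigma> \<otimes> \<iota> X)"
    for \<psi> \<zeta> \<sigma>
  proof (cases "\<psi> \<in> hom C (X \<otimes>\<^sub>o A) (A \<otimes>\<^sub>o X) \<and> \<zeta> \<in> hom C (X \<otimes>\<^sub>o X) (A \<otimes>\<^sub>o X) \<and> \<sigma> \<in> hom C \<one> (A \<otimes>\<^sub>o X)")
    case True
    then have [simp]: "\<psi> \<in> Arr C" "Dom C \<psi> = X \<otimes>\<^sub>o A" "Cod C \<psi> = A \<otimes>\<^sub>o X"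
      "\<zeta> \<in> Arr C" "Dom C \<zeta> = X \<otimes>\<^sub>o X" "Cod C \<zeta> = A \<otimes>\<^sub>o X"
      "\<sigma> \<in> Arr C" "Dom C \<sigma> = \<one>" "Cod C \<sigma> = A \<otimes>\<^sub>o X"
      by (auto simp: hom_def)
    show ?thesis
      using True unfolding entwining_def ring_triple_def lext_def by (simp add: conj_ac)
  qed (auto simp: entwining_def ring_triple_def)
  have coring: "entwining X \<psi> \<and> coring_triple X \<psi> \<delta> f \<longleftrightarrow>
         \<psi> \<in> hom C (X \<otimes>\<^sub>o A) (A \<otimes>\<^sub>o X) \<and>
         \<delta> \<in> hom C X (A \<otimes>\<^sub>o X \<otimes>\<^sub>o X) \<and>
         f \<in> hom C X A \<and>
         \<psi> \<cdot> (\<iota> X \<otimes> m) = (m \<otimes> \<iota> X) \<cdot> (\<iota> A \<otimes> \<psi>) \<cdot> (\<psi> \<otimes> \<iota> A) \<and>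
         \<psi> \<cdot> (\<iota> X \<otimes> \<eta>) = \<eta> \<otimes> \<iota> X \<and>
         (m \<otimes> \<iota> X \<otimes> \<iota> X) \<cdot> (\<iota> A \<otimes> \<delta>) \<cdot> \<psi>
           = (m \<otimes> \<iota> X \<otimes> \<iota> X) \<cdot> (\<iota> A \<otimes> \<psi> \<otimes> \<iota> X) \<cdot> (\<iota> A \<otimes> \<iota> X \<otimes> \<psi>) \<cdot> (\<delta> \<otimes> \<iota> A) \<and>
         (m \<otimes> \<iota> X \<otimes> \<iota> X \<otimes> \<iota> X) \<cdot> (\<iota> A \<otimes> \<psi> \<otimes> \<iota> X \<otimes> \<iota> X) \<cdot> (\<iota> A \<otimes> \<iota> X \<otimes> \<delta>) \<cdot> \<delta>
           = (m \<otimes> \<iota> X \<otimes> \<iota> X \<otimes> \<iota> X) \<cdot> (\<iota> A \<otimes> \<delta> \<otimes> \<iota> X) \<cdot> \<delta> \<and>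
         m \<cdot> (\<iota> A \<otimes> f) \<cdot> \<psi> = m \<cdot> (f \<otimes> \<iota> A) \<and>
         (m \<otimes> \<iota> X) \<cdot> (\<iota> A \<otimes> f \<otimes> \<iota> X) \<cdot> \<delta> = \<eta> \<otimes> \<iota> X \<and>
         \<eta> \<otimes> \<iota> X = (m \<otimes> \<iota> X) \<cdot> (\<iota> A \<otimes> \<psi>) \<cdot> (\<iota> A \<otimes> \<iota> X \<otimes> f) \<cdot> \<delta>"
    for \<psi> \<delta> f
  proof (cases "\<psi> \<in> hom C (X \<otimes>\<^sub>o A) (A \<otimes>\<^sub>o X) \<and> \<delta> \<in> hom C X (A \<otimes>\<^sub>o X \<otimes>\<^sub>o X) \<and> f \<in> hom C X A")
    case True
    then have [simp]: "\<psi> \<in> Arr C" "Dom C \<psi> = X \<otimes>\<^sub>o A" "Cod C \<psi> = A \<otimes>\<^sub>o X"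
      "\<delta> \<in> Arr C" "Dom C \<delta> = X" "Cod C \<delta> = A \<otimes>\<^sub>o X \<otimes>\<^sub>o X"
      "f \<in> Arr C" "Dom C f = X" "Cod C f = A"
      by (auto simp: hom_def)
    show ?thesis
      using True unfolding entwining_def coring_triple_def lext_def by (simp add: conj_ac)
  qed (auto simp: entwining_def coring_triple_def)
  show ?thesis
    using bij_betw_ring_data[OF assms(6)] bij_betw_coring_data[OF assms(6)] unfolding ring coring
    by (rule conjI)
qed

end
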